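(* Let $(\mathfrak{M},\tau)$ be a type II$_1$ factor, let $T \in \mathfrak{M}$, let $\lambda\in\mathbb{C}$, and let $\alpha \in (0, 1]$. Then $\lambda \in V_\alpha(T)$ if and only if there exists a diffuse abelian von Neumann subalgebra $\mathcal{A}$ of $\mathfrak{M}$ such that $\tau(1_{\{\lambda\}}(E_{\mathcal{A}}(T))) \geq \alpha$, where $E_{\mathcal{A}} : \mathfrak{M} \to \mathcal{A}$ is the normal, trace-preserving conditional expectation.
   Context: A type II$_1$ factor is regarded as a pair $(\mathfrak{M},\tau)$ with $\tau$ its normal, faithful, tracial state; $I_{\mathfrak{M}}$ is the unit of $\mathfrak{M}$, and von Neumann subalgebras contain $I_{\mathfrak{M}}$. For a normal operator $N$ and a Borel set $B\subseteq\mathbb{C}$, $1_B(N)$ is the spectral projection of $N$ for $B$. For $\alpha\in(0,1]$ and $T\in\mathfrak{M}$, the $\alpha$-numerical range of $T$ is $V_\alpha(T)=\frac1\alpha\{\tau(TX)\mid X\in\mathfrak{M},\ 0\le X\le I_{\mathfrak{M}},\ \tau(X)=\alpha\}$. *)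

theory Defs
  imports "HOL-Analysis.Analysis" "HOL-Library.Complex_Order"
begin

section \<open>Complex Hilbert spaces\<close>

text \<open>
  The library only has real inner products. A complex Hilbert space is a complete real
  inner product space with a complex scalar multiplication and a complex inner product, linear
  in the first argument, that extend the real structure: the real inner product is the real part
  of the complex one, so both induce the same norm. Positive definiteness of
  \<open>cinner\<close> comes from that of the real inner product.
\<close>

class complex_hilbert = real_inner + complete_space +
  fixes scaleC :: "complex \<Rightarrow> 'a \<Rightarrow> 'a"
    and cinner :: "'a \<Rightarrow> 'a \<Rightarrow> complex"
  assumes scaleC_add_right: "scaleC c (x + y) = scaleC c x + scaleC c y"
    and scaleC_add_left: "scaleC (c + d) x = scaleC c x + scaleC d x"
    and scaleC_scaleC: "scaleC c (scaleC d x) = scaleC (c * d) x"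
    and scaleC_of_real: "scaleC (complex_of_real r) x = scaleR r x"
    and cinner_commute: "cinner x y = cnj (cinner y x)"
    and cinner_add_left: "cinner (x + y) z = cinner x z + cinner y z"
    and cinner_scaleC_left: "cinner (scaleC c x) y = c * cinner x y"
    and inner_eq_Re_cinner: "inner x y = Re (cinner x y)"

lemma norm_scaleC:
  fixes x :: "'a::complex_hilbert"
  shows "norm (scaleC c x) = cmod c * norm x"
proof -
  have Im0: "Im (cinner x x) = 0"
    using cinner_commute[of x x] by (metis add.inverse_neutral complex_cnj Im_complex_of_real
      Reals_cnj_iff complex_is_Real_iff)
  have "cinner (scaleC c x) (scaleC c x) = c * (cnj c * cinner x x)"
    by (metis cinner_commute cinner_scaleC_left complex_cnj_mult)
  also have "\<dots> = complex_of_real ((cmod c)\<^sup>2) * cinner x x"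
    by (metis complex_norm_square mult.assoc)
  finally have "inner (scaleC c x) (scaleC c x) = (cmod c)\<^sup>2 * inner x x"
    using Im0 by (simp add: inner_eq_Re_cinner)
  then show ?thesis
    by (simp add: norm_eq_sqrt_inner real_sqrt_mult)
qed

lemma bounded_linear_scaleC: "bounded_linear (scaleC c :: 'a::complex_hilbert \<Rightarrow> 'a)"
proof (rule bounded_linear_intro[where K = "cmod c"])
  fix r and x y :: 'a
  show "scaleC c (x + y) = scaleC c x + scaleC c y"
    by (rule scaleC_add_right)
  show "scaleC c (r *\<^sub>R x) = r *\<^sub>R scaleC c x"
    by (metis scaleC_of_real scaleC_scaleC mult.commute)
  show "norm (scaleC c x) \<le> norm x * cmod c"
    by (simp add: norm_scaleC mult.commute)
qed


section \<open>Bounded operators\<close>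

text \<open>
  Operators are elements of \<open>'h \<Rightarrow>\<^sub>L 'h\<close>, which are only real-linear;
  \<open>B(H)\<close> consists of those satisfying \<open>clinear_op\<close>.
\<close>

type_synonym 'h operator = "'h \<Rightarrow>\<^sub>L 'h"

definition clinear_op :: "'h::complex_hilbert operator \<Rightarrow> bool" where
  "clinear_op X \<longleftrightarrow> (\<forall>c x. blinfun_apply X (scaleC c x) = scaleC c (blinfun_apply X x))"

definition scalar_op :: "complex \<Rightarrow> 'h::complex_hilbert operator" where
  "scalar_op c = Blinfun (scaleC c)"

definition scale_op :: "complex \<Rightarrow> 'h::complex_hilbert operator \<Rightarrow> 'h operator" where
  "scale_op c X = scalar_op c o\<^sub>L X"

definition adj :: "'h::complex_hilbert operator \<Rightarrow> 'h operator" where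
  "adj X = (THE Y. \<forall>x y. cinner (blinfun_apply X x) y = cinner x (blinfun_apply Y y))"

text \<open>
  In the order on \<open>complex\<close>, \<open>0 \<le> z\<close> means that \<open>z\<close> is real and nonnegative.
\<close>

definition positive_op :: "'h::complex_hilbert operator \<Rightarrow> bool" where
  "positive_op X \<longleftrightarrow> clinear_op X \<and> (\<forall>x. 0 \<le> cinner (blinfun_apply X x) x)"

definition op_le :: "'h::complex_hilbert operator \<Rightarrow> 'h operator \<Rightarrow> bool" where
  "op_le X Y \<longleftrightarrow> positive_op (Y - X)"

definition is_projection :: "'h::complex_hilbert operator \<Rightarrow> bool" where
  "is_projection P \<longleftrightarrow> clinear_op P \<and> adj P = P \<and> P o\<^sub>L P = P"


section \<open>Von Neumann algebras\<close>

definition commutant :: "'h::complex_hilbert operator set \<Rightarrow> 'h operator set" where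
  "commutant S = {X. clinear_op X \<and> (\<forall>Y\<in>S. X o\<^sub>L Y = Y o\<^sub>L X)}"

definition von_neumann_algebra :: "'h::complex_hilbert operator set \<Rightarrow> bool" where
  "von_neumann_algebra M \<longleftrightarrow> (\<forall>X\<in>M. adj X \<in> M) \<and> commutant (commutant M) = M"

definition factor :: "'h::complex_hilbert operator set \<Rightarrow> bool" where
  "factor M \<longleftrightarrow> von_neumann_algebra M \<and> M \<inter> commutant M = range scalar_op"

definition finite_algebra :: "'h::complex_hilbert operator set \<Rightarrow> bool" where
  "finite_algebra M \<longleftrightarrow>
     (\<forall>V\<in>M. adj V o\<^sub>L V = id_blinfun \<longrightarrow> V o\<^sub>L adj V = id_blinfun)"

definition abelian_projection ::
    "'h::complex_hilbert operator set \<Rightarrow> 'h operator \<Rightarrow> bool" where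
  "abelian_projection M P \<longleftrightarrow> P \<in> M \<and> is_projection P \<and>
     (\<forall>X\<in>M. \<forall>Y\<in>M. (P o\<^sub>L X o\<^sub>L P) o\<^sub>L (P o\<^sub>L Y o\<^sub>L P) = (P o\<^sub>L Y o\<^sub>L P) o\<^sub>L (P o\<^sub>L X o\<^sub>L P))"

definition type_II1 :: "'h::complex_hilbert operator set \<Rightarrow> bool" where
  "type_II1 M \<longleftrightarrow> id_blinfun \<noteq> (0 :: 'h operator) \<and> finite_algebra M \<and>
     (\<forall>P. abelian_projection M P \<longrightarrow> P = 0)"

definition minimal_projection ::
    "'h::complex_hilbert operator set \<Rightarrow> 'h operator \<Rightarrow> bool" where
  "minimal_projection M P \<longleftrightarrow> P \<in> M \<and> is_projection P \<and> P \<noteq> 0 \<and>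
     (\<forall>Q\<in>M. is_projection Q \<and> op_le Q P \<longrightarrow> Q = 0 \<or> Q = P)"

text \<open>A von Neumann algebra in the sense above contains the identity of the ambient space, so
  a subalgebra automatically has the unit of \<open>M\<close>.\<close>

definition diffuse_abelian_subalgebra ::
    "'h::complex_hilbert operator set \<Rightarrow> 'h operator set \<Rightarrow> bool" where
  "diffuse_abelian_subalgebra M A \<longleftrightarrow> A \<subseteq> M \<and> von_neumann_algebra A \<and>
     (\<forall>X\<in>A. \<forall>Y\<in>A. X o\<^sub>L Y = Y o\<^sub>L X) \<and> (\<nexists>P. minimal_projection A P)"


section \<open>Normal maps, traces and conditional expectations\<close>

definition is_supremum :: "('b \<Rightarrow> 'b \<Rightarrow> bool) \<Rightarrow> 'b set \<Rightarrow> 'b set \<Rightarrow> 'b \<Rightarrow> bool" where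
  "is_supremum le C D s \<longleftrightarrow> s \<in> C \<and> (\<forall>x\<in>D. le x s) \<and> (\<forall>u\<in>C. (\<forall>x\<in>D. le x u) \<longrightarrow> le s u)"

text \<open>
  Normality of a positive map from \<open>M\<close> into a set \<open>C\<close> ordered by \<open>le\<close>: it preserves
  suprema of bounded increasing nets of self-adjoint elements. Such nets are represented by their
  ranges, the upward directed sets with a supremum in \<open>M\<close> (in a von Neumann
  algebra, every bounded upward directed set of self-adjoint elements has one).
\<close>

definition normal_map ::
    "'h::complex_hilbert operator set \<Rightarrow> ('b \<Rightarrow> 'b \<Rightarrow> bool) \<Rightarrow> 'b set \<Rightarrow> ('h operator \<Rightarrow> 'b) \<Rightarrow> bool" where
  "normal_map M le C \<Phi> \<longleftrightarrow>
     (\<forall>D S. D \<subseteq> {X \<in> M. adj X = X} \<and> D \<noteq> {} \<and>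
        (\<forall>X\<in>D. \<forall>Y\<in>D. \<exists>Z\<in>D. op_le X Z \<and> op_le Y Z) \<and> is_supremum op_le M D S
        \<longrightarrow> is_supremum le C (\<Phi> ` D) (\<Phi> S))"

definition normal_faithful_tracial_state ::
    "'h::complex_hilbert operator set \<Rightarrow> ('h operator \<Rightarrow> complex) \<Rightarrow> bool" where
  "normal_faithful_tracial_state M \<tau> \<longleftrightarrow>
     (\<forall>X\<in>M. \<forall>Y\<in>M. \<tau> (X + Y) = \<tau> X + \<tau> Y) \<and>
     (\<forall>c. \<forall>X\<in>M. \<tau> (scale_op c X) = c * \<tau> X) \<and>
     (\<forall>X\<in>M. positive_op X \<longrightarrow> 0 \<le> \<tau> X) \<and>
     \<tau> id_blinfun = 1 \<and>
     (\<forall>X\<in>M. \<forall>Y\<in>M. \<tau> (X o\<^sub>L Y) = \<tau> (Y o\<^sub>L X)) \<and>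
     (\<forall>X\<in>M. positive_op X \<and> \<tau> X = 0 \<longrightarrow> X = 0) \<and>
     normal_map M (\<le>) UNIV \<tau>"

definition II1_factor ::
    "'h::complex_hilbert operator set \<Rightarrow> ('h operator \<Rightarrow> complex) \<Rightarrow> bool" where
  "II1_factor M \<tau> \<longleftrightarrow> factor M \<and> type_II1 M \<and> normal_faithful_tracial_state M \<tau>"

text \<open>
  Only the values of \<open>E\<close> on \<open>M\<close> are constrained; these are determined by \<open>M\<close>,
  \<open>\<tau>\<close> and \<open>A\<close>, so \<open>E\<close> is ``the'' expectation \<open>E\<^sub>A\<close>.
\<close>

definition normal_trace_preserving_expectation ::
    "'h::complex_hilbert operator set \<Rightarrow> ('h operator \<Rightarrow> complex) \<Rightarrow> 'h operator set
      \<Rightarrow> ('h operator \<Rightarrow> 'h operator) \<Rightarrow> bool" where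
  "normal_trace_preserving_expectation M \<tau> A E \<longleftrightarrow>
     (\<forall>X\<in>M. E X \<in> A) \<and>
     (\<forall>X\<in>M. \<forall>Y\<in>M. E (X + Y) = E X + E Y) \<and>
     (\<forall>c. \<forall>X\<in>M. E (scale_op c X) = scale_op c (E X)) \<and>
     (\<forall>X\<in>M. positive_op X \<longrightarrow> positive_op (E X)) \<and>
     (\<forall>a\<in>A. E a = a) \<and>
     (\<forall>a\<in>A. \<forall>b\<in>A. \<forall>X\<in>M. E (a o\<^sub>L X o\<^sub>L b) = a o\<^sub>L E X o\<^sub>L b) \<and>
     normal_map M op_le A E \<and>
     (\<forall>X\<in>M. \<tau> (E X) = \<tau> X)"


section \<open>Spectral projections of normal operators\<close>

definition projection_valued_measure :: "(complex set \<Rightarrow> 'h::complex_hilbert operator) \<Rightarrow> bool" where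
  "projection_valued_measure P \<longleftrightarrow>
     (\<forall>B\<in>sets borel. is_projection (P B)) \<and>
     P UNIV = id_blinfun \<and>
     (\<forall>B\<in>sets borel. \<forall>C\<in>sets borel. P (B \<inter> C) = P B o\<^sub>L P C) \<and>
     (\<forall>B x. range B \<subseteq> sets borel \<and> disjoint_family B \<longrightarrow>
        (\<lambda>n. blinfun_apply (P (B n)) x) sums blinfun_apply (P (\<Union>n::nat. B n)) x)"

definition scalar_spectral_measure ::
    "(complex set \<Rightarrow> 'h::complex_hilbert operator) \<Rightarrow> 'h \<Rightarrow> complex measure" where
  "scalar_spectral_measure P x =
     measure_of UNIV (sets borel) (\<lambda>B. ennreal (Re (cinner (blinfun_apply (P B) x) x)))"

text \<open>
  \<open>P\<close> is the spectral measure of \<open>N\<close>: it has bounded support and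
  \<open>N\<close> is the integral of \<open>z\<close> against \<open>P\<close>. The integral is taken weakly, and by
  polarization the diagonal matrix coefficients suffice.
\<close>

definition spectral_measure ::
    "'h::complex_hilbert operator \<Rightarrow> (complex set \<Rightarrow> 'h operator) \<Rightarrow> bool" where
  "spectral_measure N P \<longleftrightarrow>
     clinear_op N \<and> adj N o\<^sub>L N = N o\<^sub>L adj N \<and>
     projection_valued_measure P \<and>
     (\<exists>r. P (cball 0 r) = id_blinfun) \<and>
     (\<forall>x. cinner (blinfun_apply N x) x = integral\<^sup>L (scalar_spectral_measure P x) (\<lambda>z. z))"

text \<open>
  \<open>Q = 1\<^sub>B(N)\<close> for a Borel set \<open>B\<close>. By the spectral theorem, every
  normal \<open>N\<close> has exactly one spectral measure on Borel sets, so \<open>Q\<close> exists and is unique.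
\<close>

definition is_spectral_projection ::
    "'h::complex_hilbert operator \<Rightarrow> complex set \<Rightarrow> 'h operator \<Rightarrow> bool" where
  "is_spectral_projection N B Q \<longleftrightarrow> B \<in> sets borel \<and> (\<exists>P. spectral_measure N P \<and> Q = P B)"


section \<open>The numerical range\<close>

definition alpha_numerical_range ::
    "'h::complex_hilbert operator set \<Rightarrow> ('h operator \<Rightarrow> complex) \<Rightarrow> real \<Rightarrow> 'h operator \<Rightarrow> complex set" where
  "alpha_numerical_range M \<tau> \<alpha> T =
     {\<tau> (T o\<^sub>L X) / complex_of_real \<alpha> | X.
        X \<in> M \<and> op_le 0 X \<and> op_le X id_blinfun \<and> \<tau> X = complex_of_real \<alpha>}"

end

theory Submission
  imports Defs
begin

text \<open>
  If the spectral projection \<open>Q = 1\<^bsub>{\<mu>}\<^esub>(E\<^sub>A(T))\<close> has trace \<open>t \<ge> \<alpha>\<close>, then \<open>\<mu>\<close> lies in the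
  numerical range because of the operator \<open>(\<alpha>/t) Q\<close>: the projection belongs to \<open>A\<close>, so that
  \<open>\<tau>(T Q) = \<tau>(E\<^sub>A(T) Q) = \<mu> \<tau>(Q)\<close>. That \<open>Q\<close> belongs to \<open>A\<close> is \<open>spectral_projection_mem\<close>: its range is
  the eigenspace of \<open>E\<^sub>A(T)\<close>, which every operator in the commutant of \<open>A\<close> preserves.

  For the converse, let \<open>0 \<le> X \<le> 1\<close> with \<open>\<tau>(X) = \<alpha>\<close> and \<open>\<tau>(T X) = \<mu> \<alpha>\<close>. The set of all positive
  contractions with these two moments has an extreme point, and an extreme point is a projection
  (\<open>lyapunov\<close>): where an operator \<open>Z\<close> is not a projection, a corner of the algebra lives on which \<open>Z\<close> can be
  perturbed. This corner is not commutative, hence of real dimension at least four, whereas fixing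
  \<open>\<tau>(Z)\<close> and \<open>\<tau>(T Z)\<close> imposes three real conditions. So \<open>X\<close> can be replaced by a projection \<open>Q\<close>.
  Let \<open>\<nu>\<close> be the mean of \<open>T\<close> on \<open>1 - Q\<close>; it can be taken to differ from \<open>\<mu>\<close>, since otherwise \<open>Q = 1\<close> does as
  well. Then \<open>S = T - (\<mu> Q + \<nu> (1 - Q))\<close> has mean zero on \<open>Q\<close> and on \<open>1 - Q\<close>. Applied to half of a projection,
  \<open>lyapunov\<close> also cuts the projection into two pieces of equal trace on which \<open>S\<close> still has mean zero.
  Repeated cutting of \<open>Q\<close> and \<open>1 - Q\<close> gives a binary tree of projections
  (\<open>projection_tree_exists\<close>). It generates an abelian von Neumann algebra \<open>A\<close>, diffuse because the traces
  along a branch tend to zero, and \<open>E\<^sub>A(S) = 0\<close> (\<open>expectation_zero\<close>). Hence \<open>E\<^sub>A(T) = \<mu> Q + \<nu> (1 - Q)\<close>, whose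
  spectral projection at \<open>\<mu>\<close> is \<open>Q\<close>.

  The analytic core is that norm-bounded sequences of self-adjoint operators converge if they are
  Cauchy in the 2-norm \<open>\<parallel>X\<parallel>\<^sub>2 = \<tau>(X\<^sup>2)\<^bsup>1/2\<^esup>\<close> (\<open>bounded_fast_complete\<close>). This takes the place of weak compactness: extreme points come
  from a variational principle in complete sets (\<open>extreme_point_exists\<close>), and the conditional
  expectation onto an abelian algebra is a nearest point map (\<open>contraction_expectation\<close>). The other analytic
  input is that sums of tree projections approximate every projection of \<open>A\<close> in 2-norm
  (\<open>projection_mem_L\<close>), which makes \<open>E\<^sub>A(S)\<close> computable from the tree.
\<close>

section \<open>Nearest points and extreme points in semi-inner product spaces\<close>

text \<open>
  The form lives on a subspace because it is applied to the self-adjoint part of an algebra of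
  operators, with \<open>B X Y = Re \<tau>(X Y)\<close>, and to a Hilbert space.
\<close>

locale semi_inner =
  fixes V :: "'a::real_vector set" and B :: "'a \<Rightarrow> 'a \<Rightarrow> real"
  assumes subspace_V: "subspace V"
    and B_add: "\<And>x y z. x \<in> V \<Longrightarrow> y \<in> V \<Longrightarrow> z \<in> V \<Longrightarrow> B (x + y) z = B x z + B y z"
    and B_scale: "\<And>r x y. x \<in> V \<Longrightarrow> y \<in> V \<Longrightarrow> B (r *\<^sub>R x) y = r * B x y"
    and B_sym: "\<And>x y. x \<in> V \<Longrightarrow> y \<in> V \<Longrightarrow> B x y = B y x"
    and B_nonneg: "\<And>x. x \<in> V \<Longrightarrow> 0 \<le> B x x"
begin

lemma V_closed [simp]:
  "x \<in> V \<Longrightarrow> y \<in> V \<Longrightarrow> x + y \<in> V" "x \<in> V \<Longrightarrow> y \<in> V \<Longrightarrow> x - y \<in> V"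
  "x \<in> V \<Longrightarrow> r *\<^sub>R x \<in> V" "0 \<in> V"
  using subspace_V by (auto simp: subspace_add subspace_diff subspace_scale subspace_0)

lemma B_minus_left: "x \<in> V \<Longrightarrow> y \<in> V \<Longrightarrow> z \<in> V \<Longrightarrow> B (x - y) z = B x z - B y z"
  using B_add[of x "(-1) *\<^sub>R y" z] B_scale[of y z "-1"] V_closed(3)[of y "-1"] by simp

lemma B_add_right: "x \<in> V \<Longrightarrow> y \<in> V \<Longrightarrow> z \<in> V \<Longrightarrow> B z (x + y) = B z x + B z y"
  by (simp add: B_sym[of z] B_add)

lemma B_minus_right: "x \<in> V \<Longrightarrow> y \<in> V \<Longrightarrow> z \<in> V \<Longrightarrow> B z (x - y) = B z x - B z y"
  by (simp add: B_sym[of z] B_minus_left)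

lemma B_scale_right: "x \<in> V \<Longrightarrow> y \<in> V \<Longrightarrow> B y (r *\<^sub>R x) = r * B y x"
  by (simp add: B_sym[of y] B_scale)

lemmas B_simps = B_add B_minus_left B_add_right B_minus_right B_scale B_scale_right

lemma Cauchy_Schwarz:
  assumes "x \<in> V" "y \<in> V"
  shows "(B x y)\<^sup>2 \<le> B x x * B y y"
proof (cases "B y y = 0")
  case True
  have *: "0 \<le> B x x + 2 * t * B x y" for t
    using B_nonneg[of "x + t *\<^sub>R y"] assms True
    by (simp add: B_simps B_sym[of y x])
  have "B x y = 0"
  proof (rule ccontr)
    assume n: "B x y \<noteq> 0"
    show False using *[of "- (B x x + 1) / (2 * B x y)"] n by (simp add: field_simps)
  qed
  then show ?thesis using True by simp
next
  case False
  then have p: "B y y > 0" using B_nonneg[OF assms(2)] by simp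
  have "0 \<le> B (B y y *\<^sub>R x - B x y *\<^sub>R y) (B y y *\<^sub>R x - B x y *\<^sub>R y)"
    using assms by (intro B_nonneg) simp
  also have "\<dots> = B y y * (B x x * B y y - (B x y)\<^sup>2)"
    using assms by (simp add: B_simps B_sym[of y x] power2_eq_square algebra_simps)
  finally show ?thesis using p by (simp add: zero_le_mult_iff)
qed

lemma parallelogram:
  assumes "x \<in> V" "y \<in> V"
  shows "B (x + y) (x + y) + B (x - y) (x - y) = 2 * B x x + 2 * B y y"
  using assms by (simp add: B_simps)

lemma B_swap: assumes "x \<in> V" "y \<in> V" shows "B (x - y) (x - y) = B (y - x) (y - x)"
  using assms by (simp add: B_simps)

text \<open>
  Completeness is only required for sequences whose steps decrease geometrically: the constructions
  below produce such sequences, and for them no subsequence has to be extracted. The limit is taken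
  in the seminorm of \<open>B\<close>.
\<close>

definition fast_complete :: "'a set \<Rightarrow> bool" where
  "fast_complete K \<longleftrightarrow> (\<forall>s. (\<forall>n. s n \<in> K) \<and> (\<forall>n. B (s (Suc n) - s n) (s (Suc n) - s n) \<le> (1/8)^n)
     \<longrightarrow> (\<exists>l\<in>K. (\<lambda>n. B (s n - l) (s n - l)) \<longlonglongrightarrow> 0))"

text \<open>
  By the parallelogram law a minimizing sequence is Cauchy. The conclusion is the variational
  inequality, obtained by moving from the nearest point slightly towards \<open>b\<close>.
\<close>

lemma nearest_point:
  assumes KV: "K \<subseteq> V" and conv: "convex K" and ne: "K \<noteq> {}" and compl: "fast_complete K" and x: "x \<in> V"
  obtains k where "k \<in> K" "\<And>b. b \<in> K \<Longrightarrow> B (x - k) (b - k) \<le> 0"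
proof -
  define D where "D = (\<lambda>k. B (x - k) (x - k))"
  define d where "d = (INF k\<in>K. D k)"
  have D0: "D k \<ge> 0" if "k \<in> K" for k using that KV x B_nonneg unfolding D_def by auto
  have bdd: "bdd_below (D ` K)" using D0 by (auto simp: bdd_below_def)
  have dle: "d \<le> D k" if "k \<in> K" for k
    unfolding d_def using bdd that by (intro cINF_lower) auto
  have "\<exists>k\<in>K. D k < d + (1/8)^n/4" for n
  proof -
    have "(INF k\<in>K. D k) < d + (1/8)^n/4" unfolding d_def by simp
    then show ?thesis using cINF_less_iff[OF ne bdd] by simp
  qed
  then obtain s where sK: "\<And>n. s n \<in> K" and sD: "\<And>n. D (s n) < d + (1/8)^n/4" by metis
  have est: "B (a - b) (a - b) \<le> 2 * (D a - d) + 2 * (D b - d)" if "a \<in> K" "b \<in> K" for a b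
  proof -
    have aV: "a \<in> V" "b \<in> V" using that KV by auto
    let ?m = "(1/2) *\<^sub>R a + (1/2) *\<^sub>R b"
    have "?m \<in> K" using convexD[OF conv that, of "1/2" "1/2"] by simp
    from dle[OF this] have m: "d \<le> D ?m" .
    have "B (a - b) (a - b) = 2 * D a + 2 * D b - 4 * D ?m"
      unfolding D_def using aV x by (simp add: B_simps B_sym[of x a] B_sym[of x b] B_sym[of b a] algebra_simps)
    then show ?thesis using m by simp
  qed
  have "B (s (Suc n) - s n) (s (Suc n) - s n) \<le> (1/8)^n" for n
  proof -
    have "B (s (Suc n) - s n) (s (Suc n) - s n) \<le> 2 * ((1/8)^(Suc n)/4) + 2 * ((1/8)^n/4)"
      using est[OF sK sK, of "Suc n" n] sD[of n] sD[of "Suc n"] by argo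
    also have "\<dots> \<le> (1/8)^n" by simp
    finally show ?thesis .
  qed
  then obtain l where lK: "l \<in> K" and lim: "(\<lambda>n. B (s n - l) (s n - l)) \<longlonglongrightarrow> 0"
    using compl sK unfolding fast_complete_def by blast
  have lV: "l \<in> V" using lK KV by auto
  have Dl: "D l \<le> d"
  proof -
    have bound: "D l \<le> d + (1/8)^n/4 + B (s n - l) (s n - l) + 2 * sqrt (d + 1) * sqrt (B (s n - l) (s n - l))" for n
    proof -
      have sV: "s n \<in> V" using sK KV by auto
      have e: "D l = D (s n) + B (s n - l) (s n - l) + 2 * B (x - s n) (s n - l)"
        unfolding D_def using sV lV x
        by (simp add: B_simps B_sym[of x l] B_sym[of x "s n"] B_sym[of "s n" l] algebra_simps)
      have "(B (x - s n) (s n - l))\<^sup>2 \<le> D (s n) * B (s n - l) (s n - l)"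
        unfolding D_def using Cauchy_Schwarz sV lV x by simp
      also have "\<dots> \<le> (d + 1) * B (s n - l) (s n - l)"
        using sD[of n] B_nonneg[of "s n - l"] sV lV power_le_one[of "1/8::real" n]
        by (intro mult_right_mono) auto
      finally have "B (x - s n) (s n - l) \<le> sqrt ((d + 1) * B (s n - l) (s n - l))"
        by (rule real_le_rsqrt)
      then show ?thesis using e sD[of n] by (simp add: real_sqrt_mult)
    qed
    have "(\<lambda>n. d + (1/8)^n/4 + B (s n - l) (s n - l) + 2 * sqrt (d + 1) * sqrt (B (s n - l) (s n - l)))
       \<longlonglongrightarrow> d + 0/4 + 0 + 2 * sqrt (d + 1) * sqrt 0"
      by (intro tendsto_intros lim LIMSEQ_power_zero) simp_all
    then show ?thesis using bound by (intro LIMSEQ_le_const[of _ d]) auto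
  qed
  have "B (x - l) (b - l) \<le> 0" if b: "b \<in> K" for b
  proof -
    have bV: "b \<in> V" using b KV by auto
    have ineq: "2 * B (x - l) (b - l) \<le> t * B (b - l) (b - l)" if t: "0 < t" "t \<le> 1" for t
    proof -
      have "(1 - t) *\<^sub>R l + t *\<^sub>R b \<in> K" using convexD[OF conv lK b, of "1 - t" t] t by simp
      from dle[OF this] Dl have "D l \<le> D ((1 - t) *\<^sub>R l + t *\<^sub>R b)" by linarith
      also have "\<dots> = D l - 2 * t * B (x - l) (b - l) + t * t * B (b - l) (b - l)"
        unfolding D_def using bV lV x
        by (simp add: B_simps B_sym[of x l] B_sym[of x b] B_sym[of b l] algebra_simps)
      finally have "t * (2 * B (x - l) (b - l)) \<le> t * (t * B (b - l) (b - l))" by (simp add: algebra_simps)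
      then show ?thesis using t by simp
    qed
    have "((\<lambda>t. t * B (b - l) (b - l)) \<longlongrightarrow> 0 * B (b - l) (b - l)) (at_right 0)"
      by (intro tendsto_intros)
    then have "2 * B (x - l) (b - l) \<le> 0 * B (b - l) (b - l)"
    proof (rule tendsto_lowerbound)
      show "\<forall>\<^sub>F t in at_right 0. 2 * B (x - l) (b - l) \<le> t * B (b - l) (b - l)"
        using ineq by (intro eventually_at_rightI[of 0 1]) auto
    qed simp
    then show ?thesis by simp
  qed
  with lK that show ?thesis by blast
qed

text \<open>
  A smooth variational principle. A maximizer of \<open>B z z\<close> would be extreme by strict convexity, but the
  supremum need not be attained. Subtracting small multiples of squared distances to successive
  almost-maximizers forces these to converge, and the perturbed functional stays strictly convex as
  long as the multiples sum to less than one. The limit \<open>k\<close> of the almost-maximizers is extreme: if \<open>k + u\<close> and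
  \<open>k - u\<close> were both in \<open>K\<close>, the average of the functionals over them would exceed their values at \<open>k\<close>, which
  approach the suprema, by a fixed multiple of \<open>B u u\<close>.
\<close>

lemma extreme_point_exists:
  assumes KV: "K \<subseteq> V" and ne: "K \<noteq> {}" and compl: "fast_complete K"
    and bnd: "\<And>k. k \<in> K \<Longrightarrow> B k k \<le> C"
  obtains k where "k \<in> K" "\<And>u. u \<in> V \<Longrightarrow> k + u \<in> K \<Longrightarrow> k - u \<in> K \<Longrightarrow> B u u = 0"
proof -
  \<comment> \<open>\<open>\<eta> n\<close> is the permitted defect of the \<open>n\<close>-th almost-maximizer and \<open>t n\<close> the weight of the penalty around it;
    the squared step is at most \<open>(\<eta> n + \<eta> (n + 1)) / t n \<le> (1/8)\<^sup>n\<close>, and the weights sum to \<open>1/2\<close>.\<close>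
  define \<eta> where "\<eta> = (\<lambda>n. (1/16)^n / 8 :: real)"
  define t where "t = (\<lambda>n. (1/2)^n / 4 :: real)"
  define pick where "pick = (\<lambda>g e. SOME y. y \<in> K \<and> (\<forall>z\<in>K. g z \<le> g y + (e::real)))"
  define G where "G = rec_nat (\<lambda>z. B z z)
     (\<lambda>n g z. g z - t n * B (z - pick g (\<eta> n)) (z - pick g (\<eta> n)))"
  define y where "y = (\<lambda>n. pick (G n) (\<eta> n))"
  have G0: "G 0 z = B z z" for z by (simp add: G_def)
  have GS: "G (Suc n) z = G n z - t n * B (z - y n) (z - y n)" for n z by (simp add: G_def y_def)
  have \<eta>0: "\<eta> n > 0" and t0: "t n > 0" for n by (auto simp: \<eta>_def t_def)
  have pick: "pick g e \<in> K \<and> (\<forall>z\<in>K. g z \<le> g (pick g e) + e)"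
    if "e > 0" and b: "\<And>z. z \<in> K \<Longrightarrow> g z \<le> C" for g e
  proof -
    have bdd: "bdd_above (g ` K)" using b by (auto simp: bdd_above_def)
    have "(SUP z\<in>K. g z) - e < (SUP z\<in>K. g z)" using \<open>e > 0\<close> by simp
    then obtain k where k: "k \<in> K" "(SUP z\<in>K. g z) - e < g k" using less_cSUP_iff[OF ne bdd] by blast
    have "\<forall>z\<in>K. g z \<le> g k + e"
      using cSUP_upper[OF _ bdd] k(2) by (smt (verit))
    with k(1) show ?thesis unfolding pick_def by (rule_tac someI2[of _ k]) auto
  qed
  have GC: "y n \<in> K \<and> (\<forall>z\<in>K. G n z \<le> G n (y n) + \<eta> n) \<and> (\<forall>z\<in>K. G n z \<le> C)" for n
  proof (induction n)
    case 0
    then show ?case using pick[OF \<eta>0, of "G 0" 0] bnd unfolding y_def by (auto simp: G0)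
  next
    case (Suc n)
    have "G (Suc n) z \<le> C" if "z \<in> K" for z
    proof -
      have "t n * B (z - y n) (z - y n) \<ge> 0"
        using t0[of n] B_nonneg[OF V_closed(2), of z "y n"] Suc that KV by (intro mult_nonneg_nonneg) auto
      then show ?thesis using Suc that GS[of n z] by fastforce
    qed
    then show ?case using pick[OF \<eta>0, of "G (Suc n)" "Suc n"] unfolding y_def by auto
  qed
  then have yK: "\<And>n. y n \<in> K" and near: "\<And>n z. z \<in> K \<Longrightarrow> G n z \<le> G n (y n) + \<eta> n" by auto
  have yV: "\<And>n. y n \<in> V" using yK KV by auto
  have "B (y (Suc n) - y n) (y (Suc n) - y n) \<le> (1/8)^n" for n
  proof -
    have "G (Suc n) (y n) = G n (y n)"
      using GS[of n "y n"] B_scale[of 0 0 0] by simp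
    then have "G n (y (Suc n)) - t n * B (y (Suc n) - y n) (y (Suc n) - y n) \<ge> G n (y n) - \<eta> (Suc n)"
      using near[OF yK, of "Suc n" n] GS[of n "y (Suc n)"] by simp
    then have "t n * B (y (Suc n) - y n) (y (Suc n) - y n) \<le> \<eta> n + \<eta> (Suc n)"
      using near[OF yK, of n "Suc n"] by simp
    also have "\<dots> \<le> (1/16)^n / 4" by (simp add: \<eta>_def)
    also have "\<dots> = t n * (1/8)^n" by (simp add: t_def power_mult_distrib[symmetric])
    finally show ?thesis using t0[of n] by simp
  qed
  then obtain l where lK: "l \<in> K" and lim: "(\<lambda>n. B (y n - l) (y n - l)) \<longlonglongrightarrow> 0"
    using compl yK unfolding fast_complete_def by blast
  have lV: "l \<in> V" using lK KV by auto
  have C0: "C \<ge> 0" using bnd[OF lK] B_nonneg[OF lV] by simp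
  define s where "s = (\<lambda>n. \<Sum>k<n. t k)"
  have s_eq: "s n = (1 - (1/2)^n) / 2" for n
    by (induction n) (auto simp: s_def t_def field_simps)
  have s_le: "s n \<le> 1/2" for n by (simp add: s_eq)
  have diff: "B a a - B b b \<le> 2 * sqrt D * sqrt (B (a - b) (a - b))"
    if "a \<in> V" "b \<in> V" "B a a \<le> D" "B b b \<le> D" for a b D
  proof -
    have "B a a - B b b = B (a + b) (a - b)" using that by (simp add: B_simps B_sym[of a b])
    also have "\<dots> \<le> sqrt (B (a + b) (a + b) * B (a - b) (a - b))"
      using Cauchy_Schwarz[of "a + b" "a - b"] that by (intro real_le_rsqrt) auto
    also have "\<dots> \<le> sqrt (4 * D * B (a - b) (a - b))"
      using parallelogram[of a b] B_nonneg[of "a - b"] that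
      by (intro real_sqrt_le_mono mult_right_mono) auto
    finally show ?thesis by (simp add: real_sqrt_mult)
  qed
  \<comment> \<open>The functionals are Lipschitz uniformly in \<open>n\<close>, so that their values at \<open>y n\<close> and at the limit agree asymptotically.\<close>
  have Lip: "G n a - G n b \<le> (2 + 4 * s n) * sqrt C * sqrt (B (a - b) (a - b))" if ab: "a \<in> K" "b \<in> K" for n a b
  proof (induction n)
    case 0
    then show ?case using diff[of a b C] bnd ab KV by (auto simp: G0 s_def)
  next
    case (Suc n)
    have V: "a \<in> V" "b \<in> V" "y n \<in> V" using ab KV yV by auto
    have four: "B (z - y n) (z - y n) \<le> 4 * C" if "z \<in> K" for z
      using parallelogram[of z "y n"] B_nonneg[of "z + y n"] bnd[OF that] bnd[OF yK[of n]] V that KV by fastforce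
    have "B (b - y n) (b - y n) - B (a - y n) (a - y n) \<le> 2 * sqrt (4 * C) * sqrt (B (a - b) (a - b))"
      using diff[of "b - y n" "a - y n" "4 * C"] four ab V B_swap[of a b] by simp
    then have "t n * (B (b - y n) (b - y n) - B (a - y n) (a - y n)) \<le> t n * (4 * sqrt C * sqrt (B (a - b) (a - b)))"
      using t0[of n] by (intro mult_left_mono) (auto simp: real_sqrt_mult)
    then show ?case using Suc unfolding GS by (simp add: s_def algebra_simps)
  qed
  \<comment> \<open>Strict convexity, with the modulus \<open>1 - s n \<ge> 1/2\<close>.\<close>
  have mid: "G n (l + u) + G n (l - u) = 2 * G n l + 2 * (1 - s n) * B u u" if "u \<in> V" for n u
  proof (induction n)
    case 0
    then show ?case using parallelogram[OF lV that] by (simp add: G0 s_def)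
  next
    case (Suc n)
    have "B (l + u - y n) (l + u - y n) + B (l - u - y n) (l - u - y n) = 2 * B (l - y n) (l - y n) + 2 * B u u"
      using that lV yV[of n] by (simp add: B_simps)
    then have "t n * B (l + u - y n) (l + u - y n) + t n * B (l - u - y n) (l - u - y n)
      = 2 * t n * B (l - y n) (l - y n) + 2 * t n * B u u"
      by (metis (no_types, opaque_lifting) distrib_left mult.assoc mult.left_commute)
    then show ?case using Suc unfolding GS by (simp add: s_def algebra_simps)
  qed
  have "B u u = 0" if u: "u \<in> V" "l + u \<in> K" "l - u \<in> K" for u
  proof -
    have "B u u \<le> 2 * \<eta> n + 8 * sqrt C * sqrt (B (y n - l) (y n - l))" for n
    proof -
      have "2 * G n l + 2 * (1 - s n) * B u u \<le> 2 * (G n (y n) + \<eta> n)"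
        using mid[OF u(1), of n] near[OF u(2), of n] near[OF u(3), of n] by simp
      then have "2 * (1 - s n) * B u u \<le> 2 * \<eta> n + 2 * ((2 + 4 * s n) * sqrt C * sqrt (B (y n - l) (y n - l)))"
        using Lip[OF yK[of n] lK, of n] by simp
      also have "\<dots> \<le> 2 * \<eta> n + 2 * (4 * sqrt C * sqrt (B (y n - l) (y n - l)))"
        using s_le[of n] C0 B_nonneg[of "y n - l"] yV lV
        by (intro add_left_mono mult_left_mono mult_right_mono) auto
      finally have "2 * (1 - s n) * B u u \<le> 2 * \<eta> n + 8 * sqrt C * sqrt (B (y n - l) (y n - l))" by simp
      moreover have "1 * B u u \<le> 2 * (1 - s n) * B u u"
        using s_le[of n] B_nonneg[OF u(1)] by (intro mult_right_mono) auto
      ultimately show ?thesis by simp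
    qed
    moreover have "(\<lambda>n. 2 * \<eta> n + 8 * sqrt C * sqrt (B (y n - l) (y n - l))) \<longlonglongrightarrow> 2 * (0 / 8) + 8 * sqrt C * sqrt 0"
      unfolding \<eta>_def by (intro tendsto_intros lim LIMSEQ_power_zero) simp_all
    ultimately have "B u u \<le> 2 * (0 / 8) + 8 * sqrt C * sqrt 0"
      by (intro LIMSEQ_le_const) auto
    then show ?thesis using B_nonneg[OF u(1)] by simp
  qed
  with lK that show ?thesis by blast
qed

end

section \<open>Riesz representation, projections and adjoints\<close>

instance complex_hilbert \<subseteq> banach ..

interpretation hilbert: semi_inner "UNIV :: 'a::real_inner set" inner
  by unfold_locales (auto simp: inner_add_left inner_add_right intro: inner_commute)

lemma fast_complete_closed:
  fixes K :: "'a::{real_inner,banach} set"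
  assumes "closed K"
  shows "hilbert.fast_complete K"
  unfolding hilbert.fast_complete_def
proof (intro allI impI, elim conjE)
  fix s :: "nat \<Rightarrow> 'a"
  assume sK: "\<forall>n. s n \<in> K" and fast: "\<forall>n. inner (s (Suc n) - s n) (s (Suc n) - s n) \<le> (1/8)^n"
  define c :: real where "c = sqrt (1/8)"
  have N: "norm (norm (s (Suc n) - s n)) \<le> c ^ n" for n
    using fast[rule_format, of n] by (simp add: c_def norm_eq_sqrt_inner real_sqrt_power[symmetric])
  have "0 \<le> c" "c < 1" by (simp_all add: c_def)
  then have "summable (\<lambda>n. c ^ n)" by (intro summable_geometric) simp
  then have "summable (\<lambda>n. norm (s (Suc n) - s n))"
    by (rule summable_comparison_test') (rule N)
  then have "summable (\<lambda>n. s (Suc n) - s n)" by (rule summable_norm_cancel)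
  then have "convergent (\<lambda>n. \<Sum>i<n. s (Suc i) - s i)" by (simp add: summable_iff_convergent)
  then have "convergent (\<lambda>n. s n - s 0)" by (simp add: sum_lessThan_telescope)
  then have "convergent (\<lambda>n. (s n - s 0) + s 0)" by (intro convergent_add convergent_const)
  then obtain l where l: "s \<longlonglongrightarrow> l" by (auto simp: convergent_def)
  then have "l \<in> K" using assms sK by (auto intro: closed_sequentially)
  moreover have "(\<lambda>n. inner (s n - l) (s n - l)) \<longlonglongrightarrow> inner (l - l) (l - l)"
    by (intro tendsto_intros l)
  ultimately show "\<exists>l\<in>K. (\<lambda>n. inner (s n - l) (s n - l)) \<longlonglongrightarrow> 0" by auto
qed

text \<open>
  The representing vector is a multiple of the vector of least norm in the hyperplane \<open>{x. f x = 1}\<close>.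
\<close>

lemma riesz_representation:
  fixes f :: "'a::{real_inner,banach} \<Rightarrow> real"
  assumes "bounded_linear f"
  obtains u where "\<And>x. f x = inner u x"
proof (cases "\<forall>x. f x = 0")
  case True
  then show ?thesis using that[of 0] by simp
next
  case False
  interpret f: bounded_linear f by fact
  from False obtain z where z: "f z \<noteq> 0" by auto
  define K where "K = {x. f x = 1}"
  have "closed K" unfolding K_def
    by (intro closed_Collect_eq f.continuous_on continuous_intros)
  moreover have "convex K" unfolding K_def by (auto simp: convex_def f.add f.scale)
  moreover have "z /\<^sub>R f z \<in> K" unfolding K_def using z by (simp add: f.scale)
  ultimately obtain k where k: "k \<in> K" "\<And>b. b \<in> K \<Longrightarrow> inner (0 - k) (b - k) \<le> 0"
    using hilbert.nearest_point[of K 0] fast_complete_closed by (metis UNIV_I empty_iff subset_UNIV)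
  have fk: "f k = 1" using k(1) by (simp add: K_def)
  have orth: "inner k v = 0" if "f v = 0" for v
    using k(2)[of "k + v"] k(2)[of "k - v"] that fk by (auto simp: K_def f.add f.diff)
  have *: "inner k x = f x * inner k k" for x
    using orth[of "x - f x *\<^sub>R k"] fk by (simp add: f.diff f.scale inner_diff_right)
  have "inner k k \<noteq> 0" using fk f.zero by auto
  then have "f x = inner (k /\<^sub>R inner k k) x" for x
    using *[of x] by (simp add: field_simps)
  then show ?thesis using that by blast
qed

lemma orthogonal_projection:
  fixes V :: "'a::{real_inner,banach} set"
  assumes "closed V" "subspace V"
  obtains G :: "'a \<Rightarrow>\<^sub>L 'a" where "\<And>x. G x \<in> V" "\<And>x. x \<in> V \<Longrightarrow> G x = x"
    "\<And>x v. v \<in> V \<Longrightarrow> inner (x - G x) v = 0"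
proof -
  have "\<exists>k\<in>V. \<forall>v\<in>V. inner (x - k) v = 0" for x
  proof -
    have "V \<noteq> {}" using subspace_0[OF assms(2)] by auto
    then obtain k where k: "k \<in> V" "\<And>b. b \<in> V \<Longrightarrow> inner (x - k) (b - k) \<le> 0"
      using hilbert.nearest_point[of V x] fast_complete_closed[OF assms(1)] subspace_imp_convex[OF assms(2)] by blast
    have "inner (x - k) v = 0" if "v \<in> V" for v
      using k(2)[of "k + v"] k(2)[of "k - v"] that k(1) assms(2) by (auto simp: subspace_add subspace_diff)
    with k(1) show ?thesis by blast
  qed
  then obtain g where gV: "\<And>x. g x \<in> V" and g: "\<And>x v. v \<in> V \<Longrightarrow> inner (x - g x) v = 0" by metis
  have uniq: "a = g x" if "a \<in> V" "\<And>v. v \<in> V \<Longrightarrow> inner (x - a) v = 0" for a x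
  proof -
    have "g x - a \<in> V" using gV that(1) assms(2) by (simp add: subspace_diff)
    then have "inner (x - a) (g x - a) - inner (x - g x) (g x - a) = 0" using that(2) g by simp
    then have "inner (g x - a) (g x - a) = 0" by (simp add: inner_diff_left)
    then show ?thesis by simp
  qed
  have "bounded_linear g"
  proof (rule bounded_linear_intro[where K=1])
    fix x y show "g (x + y) = g x + g y"
      using gV assms(2) g[of _ x] g[of _ y]
      by (intro uniq[symmetric]) (auto simp: subspace_add inner_diff_left inner_add_left)
  next
    fix r x show "g (r *\<^sub>R x) = r *\<^sub>R g x"
      using gV assms(2) g[of _ x]
      by (intro uniq[symmetric]) (auto simp: subspace_scale inner_diff_left)
  next
    fix x
    have "inner x x = inner (g x) (g x) + inner (x - g x) (x - g x) + 2 * inner (x - g x) (g x)"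
      by (simp add: inner_diff_left inner_diff_right inner_commute)
    then have "inner (g x) (g x) \<le> inner x x" using g[OF gV, of x x] inner_ge_zero[of "x - g x"] by linarith
    then show "norm (g x) \<le> norm x * 1" by (simp add: norm_le)
  qed
  then have "blinfun_apply (Blinfun g) = g" by (rule bounded_linear_Blinfun_apply)
  moreover have "g x = x" if "x \<in> V" for x using uniq[of x x] that by simp
  ultimately show ?thesis using that[of "Blinfun g"] gV g by simp
qed

lemma cinner_add_right: "cinner x (y + z) = cinner x y + cinner x (z::'h::complex_hilbert)"
  using cinner_commute[of x "y + z"] cinner_commute[of x y] cinner_commute[of x z]
  by (simp add: cinner_add_left)

lemma cinner_scaleC_right: "cinner x (scaleC c y) = cnj c * cinner x (y::'h::complex_hilbert)"
  using cinner_commute[of x "scaleC c y"] cinner_commute[of x y] by (simp add: cinner_scaleC_left)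

text \<open>
  The imaginary part of the complex inner product is a real inner product with a rotated vector. This
  allows estimates with the real inner product alone.
\<close>

lemma cinner_eq: "cinner x y = Complex (inner x y) (inner x (scaleC \<i> (y::'h::complex_hilbert)))"
  by (simp add: complex_eq_iff inner_eq_Re_cinner cinner_scaleC_right)

lemma inner_scaleC_ii: "inner (scaleC \<i> x) y = - inner x (scaleC \<i> (y::'h::complex_hilbert))"
  by (simp add: inner_eq_Re_cinner cinner_scaleC_left cinner_scaleC_right)

lemma cinner_self: "cinner x x = of_real ((norm (x::'h::complex_hilbert))\<^sup>2)"
proof -
  have "Im (cinner x x) = Im (cnj (cinner x x))" by (rule arg_cong[OF cinner_commute])
  then have "Im (cinner x x) = 0" by simp
  then show ?thesis by (simp add: complex_eq_iff inner_eq_Re_cinner[symmetric] power2_norm_eq_inner)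
qed

lemma scaleC_eq: "scaleC c x = Re c *\<^sub>R x + Im c *\<^sub>R scaleC \<i> (x::'h::complex_hilbert)"
proof -
  have "scaleC c x = scaleC (of_real (Re c) + of_real (Im c) * \<i>) x"
    by (rule arg_cong[where f="\<lambda>c. scaleC c x"]) (simp add: complex_eq_iff)
  then show ?thesis by (simp add: scaleC_add_left scaleC_scaleC[symmetric] scaleC_of_real)
qed

lemma scaleC_ii_ii: "scaleC \<i> (scaleC \<i> x) = - (x::'h::complex_hilbert)"
  using scaleC_of_real[of "-1" x] by (simp add: scaleC_scaleC)

lemma clinear_op_iff: "clinear_op X \<longleftrightarrow> (\<forall>x. X (scaleC \<i> x) = scaleC \<i> (X x))"
  unfolding clinear_op_def
  by (metis (no_types, lifting) scaleC_eq blinfun.add_right blinfun.scaleR_right)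

lemma scalar_op_apply [simp]: "scalar_op c x = scaleC c x"
  unfolding scalar_op_def by (rule bounded_linear_Blinfun_apply[OF bounded_linear_scaleC, THEN fun_cong])

lemma scale_op_apply [simp]: "scale_op c X x = scaleC c (X x)"
  by (simp add: scale_op_def)

lemma clinear_scaleC: "clinear_op X \<Longrightarrow> X (scaleC c x) = scaleC c (X x)"
  by (simp add: clinear_op_def)

lemma scaleC_linear [simp]:
  "scaleC c (0::'h::complex_hilbert) = 0" "scaleC c (- x) = - scaleC c (x::'h)"
  "scaleC c (x - y) = scaleC c x - scaleC c (y::'h)" "scaleC c (r *\<^sub>R x) = r *\<^sub>R scaleC c (x::'h)"
proof -
  have l: "linear (scaleC c :: 'h \<Rightarrow> 'h)" by (rule bounded_linear.linear[OF bounded_linear_scaleC])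
  show "scaleC c (0::'h) = 0" "scaleC c (- x) = - scaleC c x"
    "scaleC c (x - y) = scaleC c x - scaleC c y" "scaleC c (r *\<^sub>R x) = r *\<^sub>R scaleC c x"
    by (rule linear_0[OF l] linear_neg[OF l] linear_diff[OF l] linear_scale[OF l])+
qed

text \<open>
  Self-adjointness for the real inner product. On complex linear operators it coincides with
  \<open>adj X = X\<close> (\<open>adj_self_iff\<close>), and it makes sense for operators whose complex linearity is not known yet.
\<close>

definition symmetric_op :: "'h::real_inner operator \<Rightarrow> bool" where
  "symmetric_op X \<longleftrightarrow> (\<forall>x y. inner (X x) y = inner x (X y))"

lemma blinfun_eq_inner: 
  fixes X Y :: "'h::real_inner \<Rightarrow>\<^sub>L 'h"
  assumes "\<And>x y. inner x (X y) = inner x (Y y)" shows "X = Y"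
  by (rule blinfun_eqI) (metis assms vector_eq_ldot)

lemma real_adjoint:
  fixes X :: "'h::complex_hilbert operator"
  obtains Y :: "'h operator" where "\<And>x y. inner (X x) y = inner x (Y y)"
proof -
  have "\<exists>u. \<forall>x. inner (X x) y = inner u x" for y
  proof -
    have "bounded_linear (\<lambda>x. inner (X x) y)" by (intro bounded_linear_intros blinfun.bounded_linear_right)
    from riesz_representation[OF this] show ?thesis by metis
  qed
  then obtain u where u: "\<And>x y. inner (X x) y = inner (u y) x" by metis
  have "bounded_linear u"
  proof (rule bounded_linear_intro[where K="norm X"])
    fix x y show "u (x + y) = u x + u y"
      by (rule vector_eq_rdot[THEN iffD1]) (auto simp: u[symmetric] inner_add_left inner_add_right)
  next
    fix r x show "u (r *\<^sub>R x) = r *\<^sub>R u x"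
      by (rule vector_eq_rdot[THEN iffD1]) (auto simp: u[symmetric])
  next
    fix y
    have "norm (u y) * norm (u y) = inner (X (u y)) y" by (simp add: u power2_norm_eq_inner[symmetric] power2_eq_square)
    also have "\<dots> \<le> norm (X (u y)) * norm y" by (rule norm_cauchy_schwarz)
    also have "\<dots> \<le> norm X * norm (u y) * norm y" by (intro mult_right_mono norm_blinfun) simp
    finally have "norm (u y) * norm (u y) \<le> norm (u y) * (norm y * norm X)" by (simp add: algebra_simps)
    then show "norm (u y) \<le> norm y * norm X"
      by (cases "norm (u y) = 0") (auto simp: mult_le_cancel_left)
  qed
  then have "blinfun_apply (Blinfun u) = u" by (rule bounded_linear_Blinfun_apply)
  then show ?thesis using that[of "Blinfun u"] u by (simp add: inner_commute)
qed

text \<open>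
  An adjoint for the real inner product is one for the complex inner product, because a complex linear
  operator commutes with multiplication by \<open>\<i>\<close>.
\<close>

lemma adj_unique:
  fixes X Y :: "'h::complex_hilbert operator"
  assumes "clinear_op X" "\<And>x y. inner (X x) y = inner x (Y y)"
  shows "clinear_op Y" "adj X = Y"
proof -
  have "inner x (Y (scaleC \<i> y)) = inner x (scaleC \<i> (Y y))" for x y
    using assms(2)[of x "scaleC \<i> y"] assms(2)[of "scaleC \<i> x" y] inner_scaleC_ii[of "X x" y]
      inner_scaleC_ii[of x "Y y"] clinear_scaleC[OF assms(1), of \<i> x] by simp
  then show Y: "clinear_op Y" unfolding clinear_op_iff by (metis vector_eq_ldot)
  have "cinner (X x) y = cinner x (Y y)" for x y
    by (simp add: cinner_eq assms(2) clinear_scaleC[OF Y])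
  moreover have "Z = Y" if "\<forall>x y. cinner (X x) y = cinner x (blinfun_apply Z y)" for Z
    by (rule blinfun_eq_inner) (metis assms(2) inner_eq_Re_cinner that)
  ultimately show "adj X = Y" unfolding adj_def by (intro the_equality) auto
qed

lemma
  fixes X :: "'h::complex_hilbert operator"
  assumes "clinear_op X"
  shows clinear_adj: "clinear_op (adj X)"
    and inner_adj: "inner (X x) y = inner x (adj X y)"
    and inner_adj2: "inner (adj X x) y = inner x (X y)"
    and adj_adj: "adj (adj X) = X"
proof -
  obtain Y :: "'h operator" where Y: "\<And>x y. inner (X x) y = inner x (Y y)"
    by (rule real_adjoint[of X]) blast
  note a = adj_unique[OF assms Y]
  show c: "clinear_op (adj X)" and b: "\<And>x y. inner (X x) y = inner x (adj X y)" using a Y by auto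
  show b2: "\<And>x y. inner (adj X x) y = inner x (X y)" using b by (simp add: inner_commute)
  show "adj (adj X) = X" by (rule adj_unique(2)[OF c b2])
qed

lemma adj_self_iff: "clinear_op X \<Longrightarrow> adj X = X \<longleftrightarrow> symmetric_op X"
  by (metis adj_unique(2) inner_adj symmetric_op_def)

lemma positive_op_iff:
  "positive_op X \<longleftrightarrow> clinear_op X \<and> symmetric_op X \<and> (\<forall>x. 0 \<le> inner (X x) x)"
proof (intro iffI conjI allI)
  assume p: "positive_op X"
  then show c: "clinear_op X" and "0 \<le> inner (X x) x" for x
    by (auto simp: positive_op_def less_eq_complex_def inner_eq_Re_cinner)
  have "inner (X x) (scaleC \<i> x) = 0" for x
    using p[unfolded positive_op_def, THEN conjunct2, rule_format, of x] by (simp add: less_eq_complex_def cinner_eq)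
  from this[of "_ + _"] this have z: "inner (X x) (scaleC \<i> y) + inner (X y) (scaleC \<i> x) = 0" for x y
    by (auto simp: scaleC_add_right blinfun.add_right inner_add_left inner_add_right)
  have "inner (X x) y = inner x (X y)" for x y
    using z[of x "scaleC \<i> y"] inner_scaleC_ii[of "X y" "scaleC \<i> x"]
    by (simp add: scaleC_ii_ii clinear_scaleC[OF c] inner_commute)
  then show "symmetric_op X" by (simp add: symmetric_op_def)
next
  assume *: "clinear_op X \<and> symmetric_op X \<and> (\<forall>x. 0 \<le> inner (X x) x)"
  then have c: "clinear_op X" and sym: "\<And>x y. inner (X x) y = inner x (X y)"
    by (auto simp: symmetric_op_def)
  have "inner (X x) (scaleC \<i> x) = 0" for x
    using inner_scaleC_ii[of "X x" x] clinear_scaleC[OF c, of \<i> x] sym[of "scaleC \<i> x" x]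
      inner_commute[of "scaleC \<i> x" "X x"] by simp
  with * show "positive_op X" by (auto simp: positive_op_def less_eq_complex_def cinner_eq)
qed

section \<open>The order on symmetric operators\<close>

text \<open>
  Positivity without complex linearity, which is kept as a separate condition
  (\<open>positive_op_psd\<close>).
\<close>

definition psd :: "'h::real_inner operator \<Rightarrow> bool" where
  "psd X \<longleftrightarrow> symmetric_op X \<and> (\<forall>x. 0 \<le> inner (X x) x)"

lemma symmetric_opD: "symmetric_op X \<Longrightarrow> inner (X x) y = inner x (X y)"
  by (simp add: symmetric_op_def)

lemma psd_symmetric: "psd X \<Longrightarrow> symmetric_op X" by (simp add: psd_def)

lemma psdD: "psd X \<Longrightarrow> 0 \<le> inner (X x) x" by (simp add: psd_def)

lemma positive_op_psd: "positive_op X \<longleftrightarrow> clinear_op X \<and> psd X"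
  by (auto simp: positive_op_iff psd_def)

lemma symmetric_op_simps [simp, intro]:
  "symmetric_op 0" "symmetric_op id_blinfun"
  "symmetric_op X \<Longrightarrow> symmetric_op Y \<Longrightarrow> symmetric_op (X + Y)"
  "symmetric_op X \<Longrightarrow> symmetric_op Y \<Longrightarrow> symmetric_op (X - Y)"
  "symmetric_op X \<Longrightarrow> symmetric_op (- X)"
  "symmetric_op X \<Longrightarrow> symmetric_op (r *\<^sub>R X)"
  by (auto simp: symmetric_op_def blinfun.bilinear_simps inner_add_left inner_add_right
      inner_diff_left inner_diff_right)

lemma symmetric_op_compose:
  assumes "symmetric_op X" "symmetric_op Y" "X o\<^sub>L Y = Y o\<^sub>L X"
  shows "symmetric_op (X o\<^sub>L Y)"
proof -
  have "X (Y y) = Y (X y)" for y using assms(3) by (metis blinfun_apply_blinfun_compose)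
  then show ?thesis using assms(1,2) by (simp add: symmetric_op_def)
qed

lemma symmetric_op_conj: "symmetric_op X \<Longrightarrow> symmetric_op Y \<Longrightarrow> symmetric_op (Y o\<^sub>L X o\<^sub>L Y)"
  by (simp add: symmetric_op_def)

lemma psd_simps [simp, intro]:
  "psd 0" "psd id_blinfun"
  "psd X \<Longrightarrow> psd Y \<Longrightarrow> psd (X + Y)"
  "psd X \<Longrightarrow> r \<ge> 0 \<Longrightarrow> psd (r *\<^sub>R X)"
  by (auto simp: psd_def blinfun.bilinear_simps inner_add_left)

lemma psd_sum: "(\<And>i. i \<in> I \<Longrightarrow> psd (f i)) \<Longrightarrow> psd (sum f I)"
  by (induction I rule: infinite_finite_induct) auto

lemma psd_conj: "psd X \<Longrightarrow> symmetric_op Y \<Longrightarrow> psd (Y o\<^sub>L X o\<^sub>L Y)"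
  unfolding psd_def
proof (intro conjI allI)
  assume *: "symmetric_op X \<and> (\<forall>x. 0 \<le> inner (X x) x)" "symmetric_op Y"
  then show "symmetric_op (Y o\<^sub>L X o\<^sub>L Y)" by (simp add: symmetric_op_conj)
  show "0 \<le> inner ((Y o\<^sub>L X o\<^sub>L Y) x) x" for x
    using * symmetric_opD[of Y "X (Y x)" x] by simp
qed

lemma psd_square:
  assumes "symmetric_op X" shows "psd (X o\<^sub>L X)"
proof -
  have "inner ((X o\<^sub>L X) x) x = inner (X x) (X x)" for x
    using symmetric_opD[OF assms, of "X x" x] by simp
  then show ?thesis using symmetric_op_compose[OF assms assms refl] by (simp add: psd_def)
qed

lemma psd_diffD: "psd (Y - X) \<Longrightarrow> inner (X x) x \<le> inner (Y x) x"
  using psdD[of "Y - X" x] by (simp add: blinfun.bilinear_simps inner_diff_left)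

lemma psd_trans: "psd (Y - X) \<Longrightarrow> psd (Z - Y) \<Longrightarrow> psd (Z - X)"
  using psd_simps(3)[of "Y - X" "Z - Y"] by simp

lemma psd_Cauchy_Schwarz:
  assumes "psd X" shows "(inner (X x) y)\<^sup>2 \<le> inner (X x) x * inner (X y) y"
proof -
  interpret semi_inner UNIV "\<lambda>x y. inner (X x) y"
  proof unfold_locales
    show "inner (X x) y = inner (X y) x" for x y
      using symmetric_opD[OF psd_symmetric[OF assms], of x y] by (simp add: inner_commute)
  qed (auto simp: blinfun.bilinear_simps inner_add_left psdD[OF assms])
  show ?thesis using Cauchy_Schwarz[of x y] by simp
qed

text \<open>
  This is the inequality \<open>X\<^sup>2 \<le> C X\<close>. The Cauchy-Schwarz inequality for the form of \<open>X\<close>, applied to \<open>x\<close> and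
  \<open>X x\<close>, bounds \<open>\<parallel>X x\<parallel>\<^sup>4\<close> by \<open>\<langle>X x, x\<rangle>\<close> times \<open>\<langle>X (X x), X x\<rangle>\<close>.
\<close>

lemma psd_bounded_square:
  assumes "psd X" "psd (C *\<^sub>R id_blinfun - X)" "C \<ge> 0"
  shows "inner (X x) (X x) \<le> C * inner (X x) x"
proof -
  let ?q = "inner (X x) (X x)"
  have "?q * ?q \<le> inner (X x) x * inner (X (X x)) (X x)"
    using psd_Cauchy_Schwarz[OF assms(1), of x "X x"] by (simp add: power2_eq_square)
  also have "\<dots> \<le> inner (X x) x * (C * ?q)"
    using psdD[OF assms(2), of "X x"] psdD[OF assms(1), of x]
    by (intro mult_left_mono) (auto simp: blinfun.bilinear_simps inner_diff_left)
  finally have "?q * ?q \<le> (C * inner (X x) x) * ?q" by (simp add: algebra_simps)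
  then show ?thesis using inner_ge_zero[of "X x"] psdD[OF assms(1), of x] assms(3)
    by (cases "?q = 0") (auto simp: mult_le_cancel_right)
qed

lemma psd_norm_le:
  assumes "psd X" "psd (C *\<^sub>R id_blinfun - X)" "C \<ge> 0"
  shows "norm (X x) \<le> C * norm x" "norm X \<le> C"
proof -
  show *: "norm (X x) \<le> C * norm x" for x
  proof -
    have "(norm (X x))\<^sup>2 \<le> C * inner (X x) x"
      using psd_bounded_square[OF assms, of x] by (simp add: power2_norm_eq_inner)
    also have "\<dots> \<le> C * (C * inner x x)"
      using psdD[OF assms(2), of x] assms(3)
      by (intro mult_left_mono) (auto simp: blinfun.bilinear_simps inner_diff_left)
    also have "\<dots> = (C * norm x)\<^sup>2" by (simp add: power_mult_distrib power2_norm_eq_inner power2_eq_square[of C])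
    finally show ?thesis by (rule power2_le_imp_le) (use assms(3) in simp)
  qed
  show "norm X \<le> C" by (rule norm_blinfun_bound[OF assms(3)]) (rule *)
qed

lemma symmetric_norm_psd:
  assumes "symmetric_op X" "norm X \<le> C"
  shows "psd (C *\<^sub>R id_blinfun - X)" "psd (C *\<^sub>R id_blinfun + X)"
proof -
  have "\<bar>inner (X x) x\<bar> \<le> C * inner x x" for x
  proof -
    have "\<bar>inner (X x) x\<bar> \<le> norm (X x) * norm x" by (rule Cauchy_Schwarz_ineq2)
    also have "\<dots> \<le> (C * norm x) * norm x"
      by (intro mult_right_mono order_trans[OF norm_blinfun[of X x]] assms(2)) simp_all
    finally show ?thesis by (simp add: power2_norm_eq_inner[symmetric] power2_eq_square)
  qed
  then have "inner (X x) x \<le> C * inner x x" "0 \<le> C * inner x x + inner (X x) x" for x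
    by (simp_all add: abs_le_iff) (smt (verit))
  then show "psd (C *\<^sub>R id_blinfun - X)" "psd (C *\<^sub>R id_blinfun + X)" using assms(1)
    by (auto simp: psd_def blinfun.bilinear_simps inner_add_left inner_diff_left)
qed

lemma psd_rescale:
  assumes "psd X"
  obtains r where "0 < r" "psd (r *\<^sub>R X)" "psd (id_blinfun - r *\<^sub>R X)"
proof -
  define r where "r = 1 / (norm X + 1)"
  have "norm X + 1 > 0" using norm_ge_zero[of X] by linarith
  then have r: "r > 0" "norm (r *\<^sub>R X) \<le> 1" by (simp_all add: r_def divide_le_eq)
  then have "psd (r *\<^sub>R X)" using assms by simp
  with r show ?thesis using that symmetric_norm_psd(1)[OF psd_symmetric, of "r *\<^sub>R X" 1] by simp
qed

lemma symmetric_square_zero: "symmetric_op X \<Longrightarrow> X o\<^sub>L X = 0 \<Longrightarrow> X = 0"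
proof (rule blinfun_eqI)
  fix x assume s: "symmetric_op X" and z: "X o\<^sub>L X = 0"
  have "inner (X x) (X x) = inner x ((X o\<^sub>L X) x)" using s by (simp add: symmetric_op_def)
  then show "X x = blinfun_apply 0 x" using z by simp
qed

lemma strong_limit:
  fixes L :: "nat \<Rightarrow> 'a::real_normed_vector \<Rightarrow>\<^sub>L 'b::real_normed_vector"
  assumes conv: "\<And>x. convergent (\<lambda>n. L n x)" and bnd: "\<And>n. norm (L n) \<le> C"
  obtains l :: "'a \<Rightarrow>\<^sub>L 'b" where "\<And>x. (\<lambda>n. L n x) \<longlonglongrightarrow> l x" "norm l \<le> C"
proof -
  obtain f where f: "\<And>x. (\<lambda>n. L n x) \<longlonglongrightarrow> f x"
    using conv unfolding convergent_def by metis
  have C0: "C \<ge> 0" using bnd[of 0] norm_ge_zero[of "L 0"] by linarith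
  have nf: "norm (f x) \<le> C * norm x" for x
  proof (rule LIMSEQ_le_const2)
    show "(\<lambda>n. norm (L n x)) \<longlonglongrightarrow> norm (f x)" using f by (intro tendsto_intros)
    show "\<exists>N. \<forall>n\<ge>N. norm (L n x) \<le> C * norm x"
      using bnd norm_blinfun by (meson mult_right_mono norm_ge_zero order_trans)
  qed
  have "bounded_linear f"
  proof (rule bounded_linear_intro[where K=C])
    fix x y
    have "(\<lambda>n. L n x + L n y) \<longlonglongrightarrow> f x + f y" by (intro tendsto_intros f)
    then show "f (x + y) = f x + f y" using f[of "x + y"] by (simp add: blinfun.add_right LIMSEQ_unique)
  next
    fix r x
    have "(\<lambda>n. r *\<^sub>R L n x) \<longlonglongrightarrow> r *\<^sub>R f x" by (intro tendsto_intros f)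
    then show "f (r *\<^sub>R x) = r *\<^sub>R f x" using f[of "r *\<^sub>R x"] by (simp add: blinfun.scaleR_right LIMSEQ_unique)
  next
    fix x show "norm (f x) \<le> norm x * C" using nf[of x] by (simp add: mult.commute)
  qed
  then have e: "blinfun_apply (Blinfun f) = f" by (rule bounded_linear_Blinfun_apply)
  then have "norm (Blinfun f) \<le> C" by (intro norm_blinfun_bound[OF C0]) (simp add: nf)
  then show ?thesis using that[of "Blinfun f"] f e by simp
qed

lemma symmetric_strong_limit:
  fixes L :: "nat \<Rightarrow> 'a::real_inner operator" and l :: "'a operator"
  assumes "\<And>x. (\<lambda>n. L n x) \<longlonglongrightarrow> l x" "\<And>n. symmetric_op (L n)"
  shows "symmetric_op l"
  unfolding symmetric_op_def
proof (intro allI)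
  fix x y
  have "(\<lambda>n. inner (L n x) y) \<longlonglongrightarrow> inner (l x) y" "(\<lambda>n. inner x (L n y)) \<longlonglongrightarrow> inner x (l y)"
    by (intro tendsto_intros assms)+
  then show "inner (l x) y = inner x (l y)"
    using assms(2) by (simp add: symmetric_op_def LIMSEQ_unique)
qed

lemma psd_strong_limit:
  fixes L :: "nat \<Rightarrow> 'a::real_inner operator" and l :: "'a operator"
  assumes "\<And>x. (\<lambda>n. L n x) \<longlonglongrightarrow> l x" "\<And>n. n \<ge> N \<Longrightarrow> psd (L n)"
  shows "psd l"
proof -
  have l': "\<And>x. (\<lambda>n. L (n + N) x) \<longlonglongrightarrow> l x" using assms(1) by (intro LIMSEQ_ignore_initial_segment)
  have "symmetric_op l" by (rule symmetric_strong_limit[OF l']) (simp add: assms(2) psd_symmetric)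
  moreover have "0 \<le> inner (l x) x" for x
  proof (rule LIMSEQ_le_const)
    show "(\<lambda>n. inner (L n x) x) \<longlonglongrightarrow> inner (l x) x" by (intro tendsto_intros assms)
    show "\<exists>N. \<forall>n\<ge>N. 0 \<le> inner (L n x) x" using assms(2) psdD by blast
  qed
  ultimately show ?thesis by (simp add: psd_def)
qed

text \<open>
  The differences \<open>X = A n - A m\<close> satisfy \<open>0 \<le> X \<le> 1\<close>, so \<open>\<parallel>X x\<parallel>\<^sup>2 \<le> \<langle>X x, x\<rangle>\<close>, which is a difference of terms of a
  bounded increasing real sequence.
\<close>

lemma monotone_strong_limit:
  fixes A :: "nat \<Rightarrow> 'a::{real_inner,banach} operator"
  assumes mono: "\<And>n. psd (A (Suc n) - A n)" and pos: "\<And>n. psd (A n)" and le: "\<And>n. psd (id_blinfun - A n)"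
  obtains l :: "'a operator" where "\<And>x. (\<lambda>n. A n x) \<longlonglongrightarrow> l x" "psd l" "psd (id_blinfun - l)"
    "\<And>n. psd (l - A n)"
proof -
  have mono': "psd (A n - A m)" if "m \<le> n" for m n
    using that by (induction rule: dec_induct) (auto intro: psd_trans mono)
  have "convergent (\<lambda>n. A n x)" for x
  proof -
    define a where "a = (\<lambda>n. inner (A n x) x)"
    have "incseq a" unfolding incseq_Suc_iff a_def
      by (intro allI psd_diffD mono)
    moreover have "a n \<le> inner x x" for n
      using psdD[OF le[of n], of x] by (simp add: a_def blinfun.bilinear_simps inner_diff_left)
    ultimately obtain L where "a \<longlonglongrightarrow> L" using incseq_convergent[of a "inner x x"] by blast
    then have "convergent a" by (rule convergentI)
    then have Ca: "Cauchy a" by (rule convergent_Cauchy)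
    have est: "(dist (A n x) (A m x))\<^sup>2 \<le> dist (a n) (a m)" if "m \<le> n" for m n
    proof -
      have "psd (1 *\<^sub>R id_blinfun - (A n - A m))"
        using psd_simps(3)[OF le[of n] pos[of m]] by (simp add: algebra_simps)
      from psd_bounded_square[OF mono'[OF that] this, of x]
      show ?thesis by (simp add: dist_norm power2_norm_eq_inner a_def blinfun.bilinear_simps inner_diff_left)
    qed
    have "Cauchy (\<lambda>n. A n x)"
    proof (rule CauchyI')
      fix e :: real assume "e > 0"
      then obtain M where M: "\<And>m n. m \<ge> M \<Longrightarrow> n \<ge> M \<Longrightarrow> dist (a m) (a n) < e\<^sup>2"
        using metric_CauchyD[OF Ca, of "e\<^sup>2"] by auto
      have "dist (A m x) (A n x) < e" if "m \<ge> M" "m < n" for m n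
      proof -
        have "(dist (A n x) (A m x))\<^sup>2 < e\<^sup>2" using est[of m n] M[of n m] that by fastforce
        then show ?thesis using \<open>e > 0\<close> by (simp add: power2_less_imp_less dist_commute)
      qed
      then show "\<exists>M. \<forall>m\<ge>M. \<forall>n>m. dist (A m x) (A n x) < e" by blast
    qed
    then show ?thesis by (rule Cauchy_convergent)
  qed
  moreover have "norm (A n) \<le> 1" for n using psd_norm_le(2)[of "A n" 1] pos le by simp
  ultimately obtain l :: "'a operator" where l: "\<And>x. (\<lambda>n. A n x) \<longlonglongrightarrow> l x" using strong_limit by blast
  show ?thesis
  proof (rule that[OF l])
    show "psd l" by (rule psd_strong_limit[OF l pos])
    show "psd (id_blinfun - l)"
      by (rule psd_strong_limit[of "\<lambda>n. id_blinfun - A n"]) (auto simp: blinfun.bilinear_simps intro!: tendsto_intros l le)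
    show "psd (l - A n)" for n
      by (rule psd_strong_limit[of "\<lambda>m. A m - A n" _ n]) (auto simp: blinfun.bilinear_simps intro!: tendsto_intros l mono')
  qed
qed

section \<open>Resolvents, square roots and Jordan decomposition\<close>

text \<open>
  For \<open>c = 1 / (1 + \<parallel>S\<parallel>)\<close> the operator \<open>B = 1 - c (1 + S)\<close> lies between \<open>0\<close> and \<open>1 - c\<close>, so \<open>x \<mapsto> B x + c y\<close> is a
  contraction. Its fixed point solves \<open>x + S x = y\<close>.
\<close>

lemma resolvent_exists:
  fixes S :: "'h::{real_inner,banach} operator"
  assumes "psd S"
  obtains R :: "'h operator" where "\<And>x. R x + S (R x) = x" "\<And>x. R (x + S x) = x"
proof -
  define c where "c = 1 / (1 + norm S)"
  have n0: "1 + norm S > 0" using norm_ge_zero[of S] by linarith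
  have c: "0 < c" "c \<le> 1" "c * norm S = 1 - c" using n0 by (auto simp: c_def field_simps)
  define B where "B = (1 - c) *\<^sub>R id_blinfun - c *\<^sub>R S"
  have Sn: "psd (norm S *\<^sub>R id_blinfun - S)"
    using symmetric_norm_psd(1)[OF psd_symmetric[OF assms] order_refl] .
  have "B = c *\<^sub>R (norm S *\<^sub>R id_blinfun - S)" by (simp add: B_def scaleR_diff_right c)
  then have B1: "psd B" using Sn c by simp
  have B2: "psd ((1 - c) *\<^sub>R id_blinfun - B)" using assms c by (simp add: B_def)
  have Bn: "norm (B x) \<le> (1 - c) * norm x" for x using psd_norm_le(1)[OF B1 B2] c by simp
  have "\<exists>!x. B x + c *\<^sub>R y = x" for y
  proof (rule banach_fix_type[of "1 - c"])
    show "\<forall>a b. dist (B a + c *\<^sub>R y) (B b + c *\<^sub>R y) \<le> (1 - c) * dist a b"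
      using Bn by (simp add: dist_norm blinfun.diff_right[symmetric])
  qed (use c in auto)
  moreover have "B x + c *\<^sub>R y = x \<longleftrightarrow> x + S x = y" for x y
  proof -
    have "B x + c *\<^sub>R y = x + c *\<^sub>R (y - (x + S x))"
      by (simp add: B_def blinfun.bilinear_simps algebra_simps)
    then show ?thesis using c by (metis add_cancel_left_right eq_iff_diff_eq_0 less_irrefl scaleR_eq_0_iff)
  qed
  ultimately have ex1: "\<exists>!x. x + S x = y" for y by simp
  then obtain r where r: "\<And>y. r y + S (r y) = y" by metis
  have uniq: "r y = x" if "x + S x = y" for x y using ex1[of y] r[of y] that by blast
  have "bounded_linear r"
  proof (rule bounded_linear_intro[where K=1])
    fix x y show "r (x + y) = r x + r y"
      by (intro uniq) (metis (no_types, lifting) r blinfun.add_right add.assoc add.left_commute)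
  next
    fix a x show "r (a *\<^sub>R x) = a *\<^sub>R r x"
      by (intro uniq) (metis r blinfun.scaleR_right scaleR_add_right)
  next
    fix x
    have "inner (r x) (r x) \<le> inner (r x) x"
      using psdD[OF assms, of "r x"] r[of x] by (metis inner_add_right inner_commute le_add_same_cancel1)
    also have "\<dots> \<le> norm (r x) * norm x" by (rule norm_cauchy_schwarz)
    finally have "norm (r x) * norm (r x) \<le> norm (r x) * norm x"
      by (simp add: power2_norm_eq_inner[symmetric] power2_eq_square)
    then show "norm (r x) \<le> norm x * 1" by (cases "norm (r x) = 0") (auto simp: mult_le_cancel_left)
  qed
  then have "blinfun_apply (Blinfun r) = r" by (rule bounded_linear_Blinfun_apply)
  then show ?thesis using that[of "Blinfun r"] r uniq by simp
qed

text \<open>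
  The operator \<open>(1 + S)\<^bsup>-1\<^esup>\<close>, which exists for positive \<open>S\<close>.
\<close>

definition resolvent :: "'h::{real_inner,banach} operator \<Rightarrow> 'h operator" where
  "resolvent S = (SOME R :: 'h operator. \<forall>x. R x + S (R x) = x \<and> R (x + S x) = x)"

lemma
  fixes S :: "'h::{real_inner,banach} operator"
  assumes "psd S"
  shows resolvent_right: "resolvent S x + S (resolvent S x) = x"
    and resolvent_left: "resolvent S (x + S x) = x"
proof -
  have "\<exists>R::'h operator. \<forall>x. R x + S (R x) = x \<and> R (x + S x) = x"
    using resolvent_exists[OF assms] by metis
  from someI_ex[OF this] show "resolvent S x + S (resolvent S x) = x" "resolvent S (x + S x) = x"
    unfolding resolvent_def by auto
qed

lemma resolvent_commute:
  fixes S Y :: "'h::{real_inner,banach} operator"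
  assumes "psd S" "\<And>x. Y (S x) = S (Y x)"
  shows "Y (resolvent S x) = resolvent S (Y x)"
proof -
  have "Y x = Y (resolvent S x) + S (Y (resolvent S x))"
    by (subst resolvent_right[OF assms(1), of x, symmetric]) (simp add: blinfun.add_right assms(2))
  then show ?thesis using resolvent_left[OF assms(1)] by metis
qed

text \<open>
  Everything is read off from \<open>x = u + S u\<close> with \<open>u = resolvent S x\<close>. The last statement is the operator form of
  \<open>s / (1 + s) \<le> s\<close>.
\<close>

lemma resolvent_psd:
  fixes S :: "'h::{real_inner,banach} operator"
  assumes "psd S"
  shows "psd (resolvent S)" "psd (id_blinfun - resolvent S)" "psd (S - (id_blinfun - resolvent S))"
proof -
  let ?R = "resolvent S"
  have S: "inner (S a) b = inner a (S b)" for a b by (rule symmetric_opD[OF psd_symmetric[OF assms]])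
  have sym: "inner (?R x) y = inner x (?R y)" for x y
  proof -
    have "inner (?R x) y = inner (?R x) (?R y) + inner (?R x) (S (?R y))"
      by (metis resolvent_right[OF assms] inner_add_right)
    also have "\<dots> = inner (?R x + S (?R x)) (?R y)" by (simp add: inner_add_left S)
    finally show ?thesis by (simp add: resolvent_right[OF assms])
  qed
  then have symR: "symmetric_op ?R" by (simp add: symmetric_op_def)
  have n: "0 \<le> inner (S z) z" for z by (rule psdD[OF assms])
  have "0 \<le> inner (?R x) x" "0 \<le> inner (x - ?R x) x" "0 \<le> inner (S x - (x - ?R x)) x" for x
  proof -
    obtain u where u: "u = ?R x" by simp
    have x: "x = u + S u" using resolvent_right[OF assms, of x] u by simp
    have "0 \<le> inner u x" "0 \<le> inner (x - u) x" "0 \<le> inner (S x - (x - u)) x"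
      using n[of u] n[of "S u"] inner_ge_zero[of "S u"] unfolding x
      by (simp_all add: inner_add_right inner_commute blinfun.add_right S)
    then show "0 \<le> inner (?R x) x" "0 \<le> inner (x - ?R x) x" "0 \<le> inner (S x - (x - ?R x)) x"
      by (simp_all add: u)
  qed
  then show "psd ?R" "psd (id_blinfun - ?R)" "psd (S - (id_blinfun - ?R))"
    using symR psd_symmetric[OF assms] by (auto simp: psd_def blinfun.diff_left)
qed

text \<open>
  With \<open>u\<close> and \<open>v\<close> the resolvents of \<open>T\<close> and \<open>S\<close> at \<open>x\<close>, the Cauchy-Schwarz inequality for the form of \<open>1 + S\<close> bounds
  \<open>\<langle>x, u\<rangle>\<^sup>2 = \<langle>(1 + S) v, u\<rangle>\<^sup>2\<close> by \<open>\<langle>x, v\<rangle> \<langle>(1 + S) u, u\<rangle> \<le> \<langle>x, v\<rangle> \<langle>x, u\<rangle>\<close>.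
\<close>

lemma resolvent_antimono:
  fixes S T :: "'h::{real_inner,banach} operator"
  assumes "psd S" "psd T" "psd (T - S)"
  shows "psd (resolvent S - resolvent T)"
proof -
  have "0 \<le> inner (resolvent S x) x - inner (resolvent T x) x" for x
  proof -
    obtain u where u: "u = resolvent T x" by simp
    obtain v where v: "v = resolvent S x" by simp
    have xu: "x = u + T u" and xv: "x = v + S v"
      using resolvent_right[OF assms(1), of x] resolvent_right[OF assms(2), of x] u v by auto
    have A: "psd (id_blinfun + S)" using assms(1) by simp
    have uS: "inner u u + inner (S u) u \<le> inner x u"
      using psd_diffD[OF assms(3), of u] unfolding xu by (simp add: inner_add_left)
    have "(inner x u)\<^sup>2 \<le> inner x v * (inner u u + inner (S u) u)"
      using psd_Cauchy_Schwarz[OF A, of v u] unfolding xv by (simp add: blinfun.add_left inner_add_left)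
    also have "\<dots> \<le> inner x v * inner x u"
      using uS psdD[OF A, of v] unfolding xv by (intro mult_left_mono) (auto simp: blinfun.add_left)
    finally have "inner x u * inner x u \<le> inner x v * inner x u" by (simp add: power2_eq_square)
    moreover have "0 \<le> inner x u" using uS psdD[OF assms(1), of u] inner_ge_zero[of u] by linarith
    moreover have "0 \<le> inner x v" using psdD[OF A, of v] unfolding xv by (simp add: blinfun.add_left)
    ultimately have "inner x u \<le> inner x v" by (cases "inner x u = 0") (auto simp: mult_le_cancel_right)
    then show ?thesis by (simp add: u v inner_commute)
  qed
  then show ?thesis using resolvent_psd(1)[OF assms(1)] resolvent_psd(1)[OF assms(2)]
    by (auto simp: psd_def blinfun.diff_left inner_diff_left)
qed

text \<open>
  The root is \<open>1 - L\<close> where \<open>L = (X + L\<^sup>2) / 2\<close>. The iteration of this equation converges in norm: its steps are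
  dominated by those of the scalar iteration \<open>t \<mapsto> (1 + t\<^sup>2) / 2\<close>, which increases to at most \<open>1\<close>. Everything that
  commutes with \<open>X\<close> commutes with the iterates, hence with the root.
\<close>

lemma contraction_sqrt:
  fixes X :: "'h::{real_inner,banach} operator"
  assumes X: "symmetric_op X" "norm X \<le> 1"
  obtains W :: "'h operator" where "psd W" "W o\<^sub>L W = id_blinfun - X"
    "\<And>Y. Y o\<^sub>L X = X o\<^sub>L Y \<Longrightarrow> Y o\<^sub>L W = W o\<^sub>L Y"
proof -
  define y :: "nat \<Rightarrow> real" where "y = rec_nat 0 (\<lambda>_ t. (1 + t * t) / 2)"
  define Z :: "nat \<Rightarrow> 'h operator" where "Z = rec_nat 0 (\<lambda>_ T. (1/2) *\<^sub>R (X + (T o\<^sub>L T)))"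
  have y0: "y 0 = 0" and yS: "y (Suc n) = (1 + y n * y n) / 2" for n by (auto simp: y_def)
  have Z0: "Z 0 = 0" and ZS: "Z (Suc n) = (1/2) *\<^sub>R (X + (Z n o\<^sub>L Z n))" for n by (auto simp: Z_def)
  have y01: "0 \<le> y n \<and> y n \<le> 1" for n
  proof (induction n)
    case (Suc n)
    then have "y n * y n \<le> 1 * 1" by (intro mult_mono) auto
    then show ?case using Suc by (simp add: yS)
  qed (simp add: y0)
  have Zn: "norm (Z n) \<le> y n" for n
  proof (induction n)
    case (Suc n)
    have "norm (X + (Z n o\<^sub>L Z n)) \<le> norm X + norm (Z n o\<^sub>L Z n)" by (rule norm_triangle_ineq)
    also have "\<dots> \<le> 1 + norm (Z n) * norm (Z n)" using X norm_blinfun_compose[of "Z n" "Z n"] by linarith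
    also have "\<dots> \<le> 1 + y n * y n" using Suc by (intro add_mono mult_mono) (auto intro: order_trans[OF norm_ge_zero])
    finally show ?case by (simp add: ZS yS)
  qed (simp add: Z0 y0)
  have Zd: "norm (Z (Suc n) - Z n) \<le> y (Suc n) - y n" for n
  proof (induction n)
    case 0
    then show ?case using X by (simp add: ZS Z0 yS y0)
  next
    case (Suc n)
    let ?D = "Z (Suc n) - Z n"
    have ym: "y n \<le> y (Suc n)" using Suc norm_ge_zero[of ?D] by linarith
    have "Z (Suc (Suc n)) - Z (Suc n) = (1/2) *\<^sub>R ((Z (Suc n) o\<^sub>L Z (Suc n)) - (Z n o\<^sub>L Z n))"
      unfolding ZS[of "Suc n"] by (subst (3) ZS) (simp add: scaleR_add_right scaleR_diff_right)
    also have "(Z (Suc n) o\<^sub>L Z (Suc n)) - (Z n o\<^sub>L Z n) = (?D o\<^sub>L Z (Suc n)) + (Z n o\<^sub>L ?D)"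
      by (rule blinfun_eqI) (simp add: blinfun.bilinear_simps)
    finally have "norm (Z (Suc (Suc n)) - Z (Suc n)) = (1/2) * norm ((?D o\<^sub>L Z (Suc n)) + (Z n o\<^sub>L ?D))" by simp
    also have "\<dots> \<le> (1/2) * (norm ?D * norm (Z (Suc n)) + norm (Z n) * norm ?D)"
      by (intro mult_left_mono order_trans[OF norm_triangle_ineq] add_mono norm_blinfun_compose) simp
    also have "\<dots> \<le> (1/2) * ((y (Suc n) - y n) * y (Suc n) + y n * (y (Suc n) - y n))"
      using Suc Zn[of n] Zn[of "Suc n"] y01[of n] ym
      by (intro mult_left_mono add_mono mult_mono) (auto intro: order_trans[OF norm_ge_zero])
    also have "\<dots> = (1 + y (Suc n) * y (Suc n)) / 2 - (1 + y n * y n) / 2" by (simp add: field_simps)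
    also have "\<dots> = y (Suc (Suc n)) - y (Suc n)" by (simp only: yS)
    finally show ?case .
  qed
  have "summable (\<lambda>n. norm (Z (Suc n) - Z n))"
  proof (rule summableI_nonneg_bounded[of _ 1])
    fix n
    have "(\<Sum>k<n. norm (Z (Suc k) - Z k)) \<le> (\<Sum>k<n. y (Suc k) - y k)" by (intro sum_mono Zd)
    also have "\<dots> = y n" by (simp add: sum_lessThan_telescope y0)
    also have "\<dots> \<le> 1" using y01 by simp
    finally show "(\<Sum>k<n. norm (Z (Suc k) - Z k)) \<le> 1" .
  qed simp
  then have "summable (\<lambda>n. Z (Suc n) - Z n)" by (rule summable_norm_cancel)
  then have "convergent (\<lambda>n. \<Sum>i<n. Z (Suc i) - Z i)" by (simp add: summable_iff_convergent)
  then have "convergent Z" by (simp add: sum_lessThan_telescope Z0)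
  then obtain L where L: "Z \<longlonglongrightarrow> L" by (auto simp: convergent_def)
  have Lx: "(\<lambda>n. Z n x) \<longlonglongrightarrow> L x" for x by (intro blinfun.tendsto L tendsto_const)
  have symZ: "symmetric_op (Z n)" for n
    by (induction n) (auto simp: Z0 ZS intro: X symmetric_op_compose)
  have symL: "symmetric_op L" by (rule symmetric_strong_limit[OF Lx symZ])
  have "norm L \<le> 1"
    by (rule LIMSEQ_le_const2[OF tendsto_norm[OF L]]) (use Zn y01 in \<open>auto intro: order_trans\<close>)
  then have psdW: "psd (id_blinfun - L)" using symmetric_norm_psd(1)[OF symL, of 1] by simp
  have "(\<lambda>n. (1/2) *\<^sub>R (X + (Z n o\<^sub>L Z n))) \<longlonglongrightarrow> (1/2) *\<^sub>R (X + (L o\<^sub>L L))"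
    by (intro tendsto_intros L bounded_bilinear.tendsto[OF bounded_bilinear_blinfun_compose])
  then have "(\<lambda>n. Z (Suc n)) \<longlonglongrightarrow> (1/2) *\<^sub>R (X + (L o\<^sub>L L))" by (simp add: ZS)
  then have eq: "L = (1/2) *\<^sub>R (X + (L o\<^sub>L L))" using LIMSEQ_unique LIMSEQ_Suc[OF L] by blast
  have "2 *\<^sub>R L = X + (L o\<^sub>L L)" using arg_cong[OF eq, of "\<lambda>t. 2 *\<^sub>R t"] by simp
  then have LL: "L o\<^sub>L L = L + L - X" by (simp add: scaleR_2 algebra_simps)
  have "(id_blinfun - L) o\<^sub>L (id_blinfun - L) = id_blinfun - X"
  proof (rule blinfun_eqI)
    fix x
    have "L (L x) = L x + L x - X x" using LL by (metis blinfun_apply_blinfun_compose blinfun.add_left blinfun.diff_left)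
    then show "((id_blinfun - L) o\<^sub>L (id_blinfun - L)) x = (id_blinfun - X) x"
      by (simp add: blinfun.bilinear_simps algebra_simps)
  qed
  moreover have "Y o\<^sub>L (id_blinfun - L) = (id_blinfun - L) o\<^sub>L Y" if "Y o\<^sub>L X = X o\<^sub>L Y" for Y
  proof -
    have XY: "Y (X x) = X (Y x)" for x using that by (metis blinfun_apply_blinfun_compose)
    have ZY: "Y (Z n x) = Z n (Y x)" for n x
      by (induction n arbitrary: x) (auto simp: Z0 ZS blinfun.bilinear_simps XY)
    have "(\<lambda>n. Y (Z n x)) \<longlonglongrightarrow> Y (L x)" for x
      by (intro blinfun.tendsto tendsto_const Lx)
    then have "Y (L x) = L (Y x)" for x unfolding ZY using Lx LIMSEQ_unique by blast
    then show ?thesis by (intro blinfun_eqI) (simp add: blinfun.bilinear_simps)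
  qed
  ultimately show ?thesis using that psdW by blast
qed

lemma psd_sqrt:
  fixes Z :: "'h::{real_inner,banach} operator"
  assumes "psd Z"
  obtains W :: "'h operator" where "psd W" "W o\<^sub>L W = Z" "\<And>Y. Y o\<^sub>L Z = Z o\<^sub>L Y \<Longrightarrow> Y o\<^sub>L W = W o\<^sub>L Y"
proof -
  define c where "c = norm Z + 1"
  have c: "c > 0" using norm_ge_zero[of Z] unfolding c_def by linarith
  define X where "X = id_blinfun - (1/c) *\<^sub>R Z"
  have Z: "symmetric_op Z" using assms psd_symmetric by blast
  then have symX: "symmetric_op X" by (simp add: X_def)
  have "psd (c *\<^sub>R id_blinfun - Z)" using symmetric_norm_psd(1)[OF Z, of c] by (simp add: c_def)
  then have "psd ((1/c) *\<^sub>R (c *\<^sub>R id_blinfun - Z))" using c by (intro psd_simps) auto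
  then have "psd X" using c by (simp add: X_def scaleR_diff_right)
  moreover have "psd (1 *\<^sub>R id_blinfun - X)" using assms c by (simp add: X_def)
  ultimately have "norm X \<le> 1" using psd_norm_le(2)[of X 1] by simp
  from contraction_sqrt[OF symX this] obtain W :: "'h operator" where W: "psd W" "W o\<^sub>L W = id_blinfun - X"
    "\<And>Y. Y o\<^sub>L X = X o\<^sub>L Y \<Longrightarrow> Y o\<^sub>L W = W o\<^sub>L Y" by blast
  show ?thesis
  proof (rule that[of "sqrt c *\<^sub>R W"])
    show "psd (sqrt c *\<^sub>R W)" using W(1) c by simp
    have "(sqrt c *\<^sub>R W) o\<^sub>L (sqrt c *\<^sub>R W) = (sqrt c * sqrt c) *\<^sub>R (W o\<^sub>L W)"
      by (rule blinfun_eqI) (simp add: blinfun.bilinear_simps)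
    then show "(sqrt c *\<^sub>R W) o\<^sub>L (sqrt c *\<^sub>R W) = Z" using c by (simp add: W(2) X_def)
    fix Y :: "'h operator" assume "Y o\<^sub>L Z = Z o\<^sub>L Y"
    then have "Y (Z x) = Z (Y x)" for x by (metis blinfun_apply_blinfun_compose)
    then have "Y o\<^sub>L X = X o\<^sub>L Y"
      by (intro blinfun_eqI) (simp add: X_def blinfun.bilinear_simps)
    from W(3)[OF this] have "Y (W x) = W (Y x)" for x by (metis blinfun_apply_blinfun_compose)
    then show "Y o\<^sub>L (sqrt c *\<^sub>R W) = (sqrt c *\<^sub>R W) o\<^sub>L Y"
      by (intro blinfun_eqI) (simp add: blinfun.bilinear_simps)
  qed
qed

lemma closure_subspace:
  fixes S :: "'a::real_normed_vector set"
  assumes "subspace S" shows "subspace (closure S)"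
proof (rule subspaceI)
  show "0 \<in> closure S" using subspace_0[OF assms] closure_subset by blast
next
  fix x y assume "x \<in> closure S" "y \<in> closure S"
  then obtain f g where "\<forall>n. f n \<in> S" "f \<longlonglongrightarrow> x" "\<forall>n. g n \<in> S" "g \<longlonglongrightarrow> y"
    by (auto simp: closure_sequential)
  then show "x + y \<in> closure S" unfolding closure_sequential
    by (intro exI[of _ "\<lambda>n. f n + g n"]) (auto intro!: tendsto_intros subspace_add[OF assms])
next
  fix c x assume "x \<in> closure S"
  then obtain f where "\<forall>n. f n \<in> S" "f \<longlonglongrightarrow> x" by (auto simp: closure_sequential)
  then show "c *\<^sub>R x \<in> closure S" unfolding closure_sequential
    by (intro exI[of _ "\<lambda>n. c *\<^sub>R f n"]) (auto intro!: tendsto_intros subspace_scale[OF assms])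
qed

text \<open>
  On the range of \<open>U\<close> the operator \<open>V\<close> vanishes, so there \<open>U\<close> has the form of \<open>U + V\<close>; on the orthogonal complement
  of the range \<open>U\<close> vanishes.
\<close>

lemma psd_if_annihilating_sum:
  fixes U V :: "'h::{real_inner,banach} operator"
  assumes U: "symmetric_op U" and VU: "V o\<^sub>L U = 0" and UV: "psd (U + V)"
  shows "psd U"
proof -
  let ?C = "closure (range U)"
  have "subspace (range U)"
    by (rule linear_subspace_image[OF _ subspace_UNIV])
      (simp add: bounded_linear.linear blinfun.bounded_linear_right)
  then have "subspace ?C" by (rule closure_subspace)
  then obtain G :: "'h operator" where G: "\<And>x. G x \<in> ?C" "\<And>x v. v \<in> ?C \<Longrightarrow> inner (x - G x) v = 0"
    using orthogonal_projection[of ?C] by (metis closed_closure)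
  have pos: "0 \<le> inner (U z) z" if "z \<in> ?C" for z
  proof -
    have "closed {z. 0 \<le> inner (U z) z}"
      by (intro closed_Collect_le continuous_intros)
    moreover have "range U \<subseteq> {z. 0 \<le> inner (U z) z}"
    proof clarsimp
      fix w
      have "V (U w) = 0" using VU by (metis blinfun_apply_blinfun_compose zero_blinfun.rep_eq)
      then show "0 \<le> inner (U (U w)) (U w)" using psdD[OF UV, of "U w"] by (simp add: blinfun.add_left)
    qed
    ultimately show ?thesis using that closure_minimal by blast
  qed
  have UG: "U (G x) = U x" for x
  proof -
    have "inner (U (x - G x)) y = 0" for y
      using G(2)[of "U y" x] closure_subset[of "range U"] symmetric_opD[OF U, of "x - G x" y] by auto
    then have "U (x - G x) = 0" by (metis inner_eq_zero_iff)
    then show ?thesis by (simp add: blinfun.diff_right)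
  qed
  have "0 \<le> inner (U x) x" for x
  proof -
    have "inner (U x) x = inner (U (G x)) x" by (simp add: UG)
    also have "\<dots> = inner (G x) (U (G x))" using symmetric_opD[OF U, of "G x" x] by (simp add: UG)
    finally show ?thesis using pos[OF G(1), of x] by (simp add: inner_commute)
  qed
  then show ?thesis using U by (simp add: psd_def)
qed

text \<open>
  The parts are \<open>(|D| + D) / 2\<close> and \<open>(|D| - D) / 2\<close> with \<open>|D|\<close> the root of \<open>D\<^sup>2\<close>. Their product is zero and their sum
  \<open>|D|\<close> is positive, so each of them is positive.
\<close>

lemma jordan_decomposition:
  fixes D :: "'h::{real_inner,banach} operator"
  assumes D: "symmetric_op D"
  obtains P N :: "'h operator" where "psd P" "psd N" "D = P - N" "P o\<^sub>L N = 0" "N o\<^sub>L P = 0"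
    "\<And>Y. Y o\<^sub>L D = D o\<^sub>L Y \<Longrightarrow> Y o\<^sub>L P = P o\<^sub>L Y \<and> Y o\<^sub>L N = N o\<^sub>L Y"
proof -
  obtain A :: "'h operator" where A: "psd A" "A o\<^sub>L A = D o\<^sub>L D"
    "\<And>Y. Y o\<^sub>L (D o\<^sub>L D) = (D o\<^sub>L D) o\<^sub>L Y \<Longrightarrow> Y o\<^sub>L A = A o\<^sub>L Y"
    using psd_sqrt[OF psd_square[OF D]] by blast
  have AA: "A (A x) = D (D x)" for x using A(2) by (metis blinfun_apply_blinfun_compose)
  have DA: "D (A x) = A (D x)" for x using A(3)[of D] blinfun_eqI[of "D o\<^sub>L (D o\<^sub>L D)" "(D o\<^sub>L D) o\<^sub>L D"]
    by (metis blinfun_apply_blinfun_compose)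
  define P where "P = (1/2) *\<^sub>R (A + D)"
  define N where "N = (1/2) *\<^sub>R (A - D)"
  have PN: "P o\<^sub>L N = 0" and NP: "N o\<^sub>L P = 0"
    by (rule blinfun_eqI, simp add: P_def N_def blinfun.bilinear_simps AA DA algebra_simps)+
  have sum: "P + N = A" "D = P - N" by (simp_all add: P_def N_def algebra_simps flip: scaleR_add_left)
  have sA: "symmetric_op A" using A(1) psd_symmetric by blast
  have sP: "symmetric_op P" "symmetric_op N" by (simp_all add: P_def N_def sA D)
  have "psd (P + N)" "psd (N + P)" using A(1) sum(1) by (simp_all add: add.commute)
  then have "psd P" "psd N" using psd_if_annihilating_sum sP NP PN by blast+
  moreover have "Y o\<^sub>L P = P o\<^sub>L Y \<and> Y o\<^sub>L N = N o\<^sub>L Y" if "Y o\<^sub>L D = D o\<^sub>L Y" for Y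
  proof -
    have YD: "Y (D x) = D (Y x)" for x using that by (metis blinfun_apply_blinfun_compose)
    have "Y o\<^sub>L (D o\<^sub>L D) = (D o\<^sub>L D) o\<^sub>L Y" by (rule blinfun_eqI) (simp add: YD)
    from A(3)[OF this] have "Y (A x) = A (Y x)" for x by (metis blinfun_apply_blinfun_compose)
    then show ?thesis using YD
      by (auto intro!: blinfun_eqI simp: P_def N_def blinfun.bilinear_simps)
  qed
  ultimately show ?thesis using that PN NP sum by blast
qed

lemma projection_commute:
  fixes G Y Y' :: "'h::real_inner operator"
  assumes G: "symmetric_op G" "\<And>x. G x \<in> V" "\<And>x. x \<in> V \<Longrightarrow> G x = x"
    and adj: "\<And>x y. inner (Y x) y = inner x (Y' y)"
    and Y: "\<And>x. x \<in> V \<Longrightarrow> Y x \<in> V" and Y': "\<And>x. x \<in> V \<Longrightarrow> Y' x \<in> V"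
  shows "Y o\<^sub>L G = G o\<^sub>L Y"
proof (rule blinfun_eq_inner)
  fix x y
  have "inner x (G (Y y)) = inner (Y' (G x)) y"
    using symmetric_opD[OF G(1), of x "Y y"] adj[of y "G x"] by (simp add: inner_commute)
  also have "\<dots> = inner (G (Y' (G x))) y" by (simp add: G Y')
  also have "\<dots> = inner (Y (G y)) (G x)"
    using symmetric_opD[OF G(1), of "Y' (G x)" y] adj[of "G y" "G x"] by (simp add: inner_commute)
  also have "\<dots> = inner x (Y (G y))"
    using symmetric_opD[OF G(1), of x "Y (G y)"] G Y by (simp add: inner_commute)
  finally show "inner x ((Y o\<^sub>L G) y) = inner x ((G o\<^sub>L Y) y)" by simp
qed

lemma symmetric_projection:
  fixes V :: "'h::{real_inner,banach} set"
  assumes "closed V" "subspace V"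
  obtains G :: "'h operator" where "symmetric_op G" "\<And>x. G x \<in> V" "\<And>x. x \<in> V \<Longrightarrow> G x = x"
proof -
  obtain G :: "'h operator" where G: "\<And>x. G x \<in> V" "\<And>x. x \<in> V \<Longrightarrow> G x = x"
    "\<And>x v. v \<in> V \<Longrightarrow> inner (x - G x) v = 0" using orthogonal_projection[OF assms] by metis
  have "inner (G x) y = inner x (G y)" for x y
    using G(3)[OF G(1)[of y], of x] G(3)[OF G(1)[of x], of y] inner_commute[of "G x" y]
      inner_commute[of "G x" "G y"] by (simp add: inner_diff_left)
  then show ?thesis using that[of G] G by (simp add: symmetric_op_def)
qed

lemma range_projection:
  fixes B :: "'h::{real_inner,banach} operator"
  assumes B: "symmetric_op B"
  obtains G :: "'h operator" where "symmetric_op G" "G o\<^sub>L G = G" "G o\<^sub>L B = B" "B o\<^sub>L G = B"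
    "\<And>x. G x \<in> closure (range B)"
    "\<And>Y Y'. (\<And>x y. inner (blinfun_apply Y x) y = inner x (blinfun_apply Y' y)) \<Longrightarrow> Y o\<^sub>L B = B o\<^sub>L Y \<Longrightarrow> Y o\<^sub>L G = G o\<^sub>L Y"
proof -
  let ?C = "closure (range B)"
  have "subspace (range B)"
    by (rule linear_subspace_image[OF _ subspace_UNIV])
      (simp add: bounded_linear.linear blinfun.bounded_linear_right)
  then have "subspace ?C" by (rule closure_subspace)
  then obtain G :: "'h operator" where G: "symmetric_op G" "\<And>x. G x \<in> ?C" "\<And>x. x \<in> ?C \<Longrightarrow> G x = x"
    using symmetric_projection[of ?C] by (metis closed_closure)
  have GB: "G o\<^sub>L B = B" by (rule blinfun_eqI) (use G(3) closure_subset[of "range B"] in auto)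
  have "inner x (B (G y)) = inner x (B y)" for x y
    using symmetric_opD[OF B, of x "G y"] symmetric_opD[OF B, of x y] symmetric_opD[OF G(1), of "B x" y] GB
    by (metis blinfun_apply_blinfun_compose)
  then have BG: "B o\<^sub>L G = B" by (intro blinfun_eq_inner) simp
  have inv: "Y x \<in> ?C" if YB: "\<And>x. Y (B x) = B (Y x)" and "x \<in> ?C" for Y :: "'h operator" and x
  proof -
    have "Y ` ?C \<subseteq> ?C"
      by (rule image_closure_subset) (use YB in \<open>auto intro!: continuous_intros closure_subset[THEN subsetD]\<close>)
    then show ?thesis using that by auto
  qed
  have "Y o\<^sub>L G = G o\<^sub>L Y" if adj: "\<And>x y. inner (Y x) y = inner x (Y' y)" and "Y o\<^sub>L B = B o\<^sub>L Y" for Y Y' :: "'h operator"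
  proof -
    have YB: "Y (B x) = B (Y x)" for x using that(2) by (metis blinfun_apply_blinfun_compose)
    have "inner x (Y' (B y)) = inner x (B (Y' y))" for x y
      using adj[of x "B y"] adj[of "B x" y] symmetric_opD[OF B] YB by metis
    then have Y'B: "Y' (B x) = B (Y' x)" for x by (metis vector_eq_ldot)
    show ?thesis by (rule projection_commute[of G ?C, OF G adj]) (use inv YB Y'B in auto)
  qed
  moreover have "G o\<^sub>L G = G" by (rule blinfun_eqI) (simp add: G)
  ultimately show ?thesis using that[of G] G GB BG by blast
qed

section \<open>Von Neumann algebras and traces\<close>

lemma commutant_clinear: "Y \<in> commutant S \<Longrightarrow> clinear_op Y"
  by (simp add: commutant_def)

lemma commutantD: "Y \<in> commutant S \<Longrightarrow> X \<in> S \<Longrightarrow> Y o\<^sub>L X = X o\<^sub>L Y"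
  by (simp add: commutant_def)

lemma adj_compose:
  "clinear_op X \<Longrightarrow> clinear_op Y \<Longrightarrow> adj (X o\<^sub>L Y) = adj Y o\<^sub>L adj X"
  by (rule adj_unique) (simp_all add: clinear_op_def inner_adj)

lemma commutant_adj:
  assumes "\<And>X. X \<in> S \<Longrightarrow> clinear_op X \<and> adj X \<in> S" "Y \<in> commutant S"
  shows "adj Y \<in> commutant S"
proof -
  have Y: "clinear_op Y" using assms(2) by (rule commutant_clinear)
  have "adj Y o\<^sub>L X = X o\<^sub>L adj Y" if "X \<in> S" for X
  proof -
    have X: "clinear_op X" "adj X \<in> S" using assms(1) that by auto
    have "adj (adj X o\<^sub>L Y) = adj (Y o\<^sub>L adj X)" using commutantD[OF assms(2) X(2)] by simp
    then show ?thesis using X Y by (simp add: adj_compose clinear_adj adj_adj)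
  qed
  then show ?thesis using clinear_adj[OF Y] by (simp add: commutant_def)
qed

lemma commutant_antimono: "S \<subseteq> T \<Longrightarrow> commutant T \<subseteq> commutant S"
  by (auto simp: commutant_def)

lemma von_neumann_algebra_double_commutant:
  assumes S: "\<And>X. X \<in> S \<Longrightarrow> clinear_op X \<and> adj X = X"
  shows "von_neumann_algebra (commutant (commutant S))" "S \<subseteq> commutant (commutant S)"
proof -
  show sub: "S \<subseteq> commutant (commutant S)" using S by (auto simp: commutant_def)
  have "commutant (commutant (commutant S)) \<subseteq> commutant S" by (rule commutant_antimono[OF sub])
  moreover have "commutant S \<subseteq> commutant (commutant (commutant S))" by (auto simp: commutant_def)
  ultimately have "commutant (commutant (commutant S)) = commutant S" by blast
  moreover have "adj X \<in> commutant (commutant S)" if "X \<in> commutant (commutant S)" for X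
    using that by (rule commutant_adj[rotated]) (use S in \<open>auto intro: commutant_adj commutant_clinear\<close>)
  ultimately show "von_neumann_algebra (commutant (commutant S))"
    by (simp add: von_neumann_algebra_def)
qed

locale vn_algebra =
  fixes N :: "'h::complex_hilbert operator set"
  assumes vn: "von_neumann_algebra N"
begin

lemma clinear: "X \<in> N \<Longrightarrow> clinear_op X"
  using vn commutant_clinear unfolding von_neumann_algebra_def by blast

lemma adj_closed: "X \<in> N \<Longrightarrow> adj X \<in> N"
  using vn by (simp add: von_neumann_algebra_def)

lemma commutant_adj_closed: "Y \<in> commutant N \<Longrightarrow> adj Y \<in> commutant N"
  by (rule commutant_adj) (auto simp: clinear adj_closed)

text \<open>
  Membership can be tested against the commutant alone: complex linearity comes for free, because
  multiplication by \<open>\<i>\<close> is in the commutant.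
\<close>

lemma memI:
  assumes "\<And>Y. Y \<in> commutant N \<Longrightarrow> Y o\<^sub>L X = X o\<^sub>L Y"
  shows "X \<in> N"
proof -
  have "scalar_op \<i> \<in> commutant N"
    by (auto simp: commutant_def clinear_op_def scaleC_scaleC mult.commute
        intro!: blinfun_eqI clinear_scaleC[OF clinear, symmetric])
  from assms[OF this] have "clinear_op X"
    unfolding clinear_op_iff by (metis blinfun_apply_blinfun_compose scalar_op_apply)
  then have "X \<in> commutant (commutant N)" using assms by (auto simp: commutant_def[of "commutant N"])
  then show ?thesis using vn by (simp add: von_neumann_algebra_def)
qed

lemma commutes: "X \<in> N \<Longrightarrow> Y \<in> commutant N \<Longrightarrow> Y (X x) = X (Y x)"
  by (metis commutantD blinfun_apply_blinfun_compose)

lemma memI_apply: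
  fixes X :: "'h operator"
  shows "(\<And>Y x. Y \<in> commutant N \<Longrightarrow> blinfun_apply Y (X x) = X (Y x)) \<Longrightarrow> X \<in> N"
  by (rule memI) (auto intro: blinfun_eqI)

lemma mem_intros [intro]:
  "0 \<in> N" "id_blinfun \<in> N" 
  "X \<in> N \<Longrightarrow> Y \<in> N \<Longrightarrow> X + Y \<in> N" "X \<in> N \<Longrightarrow> Y \<in> N \<Longrightarrow> X - Y \<in> N" "X \<in> N \<Longrightarrow> - X \<in> N"
  "X \<in> N \<Longrightarrow> r *\<^sub>R X \<in> N" "X \<in> N \<Longrightarrow> Y \<in> N \<Longrightarrow> X o\<^sub>L Y \<in> N"
  "X \<in> N \<Longrightarrow> scale_op c X \<in> N"
  by (rule memI_apply; frule commutant_clinear;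
      simp add: blinfun.bilinear_simps commutes[of X] commutes[of Y] clinear_scaleC)+

lemma sum_closed: "(\<And>i. i \<in> I \<Longrightarrow> f i \<in> N) \<Longrightarrow> sum f I \<in> N"
  by (induction I rule: infinite_finite_induct) auto

lemma strong_limit_closed:
  fixes l :: "'h operator"
  assumes "\<And>n. s n \<in> N" "\<And>x. (\<lambda>n. blinfun_apply (s n) x) \<longlonglongrightarrow> l x"
  shows "l \<in> N"
proof (rule memI_apply)
  fix Y x assume Y: "Y \<in> commutant N"
  have "(\<lambda>n. Y (s n x)) \<longlonglongrightarrow> Y (l x)" by (intro blinfun.tendsto tendsto_const assms)
  then show "Y (l x) = l (Y x)" using assms(2)[of "Y x"] commutes[OF assms(1) Y] LIMSEQ_unique by simp
qed

lemma bicommutant: "X \<in> N \<Longrightarrow> (\<And>Y. Y o\<^sub>L X = X o\<^sub>L Y \<Longrightarrow> Y o\<^sub>L Z = Z o\<^sub>L Y) \<Longrightarrow> Z \<in> N"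
  by (rule memI) (auto dest: commutantD)

lemma resolvent_closed: "psd S \<Longrightarrow> S \<in> N \<Longrightarrow> resolvent S \<in> N"
  by (rule memI_apply) (intro resolvent_commute commutes)

lemma range_projection_closed:
  assumes "B \<in> N" "symmetric_op B"
  obtains G :: "'h operator" where "G \<in> N" "symmetric_op G" "G o\<^sub>L G = G" "G o\<^sub>L B = B" "B o\<^sub>L G = B"
    "\<And>x. G x \<in> closure (range B)"
proof -
  obtain G :: "'h operator" where G: "symmetric_op G" "G o\<^sub>L G = G" "G o\<^sub>L B = B" "B o\<^sub>L G = B"
    "\<And>x. G x \<in> closure (range B)"
    "\<And>Y Y'. (\<And>x y. inner (blinfun_apply Y x) y = inner x (blinfun_apply Y' y)) \<Longrightarrow> Y o\<^sub>L B = B o\<^sub>L Y \<Longrightarrow> Y o\<^sub>L G = G o\<^sub>L Y"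
    using range_projection[OF assms(2)] by metis
  have "G \<in> N"
    by (rule memI, rule G(6)[OF inner_adj]) (auto intro: commutant_clinear commutantD assms(1))
  with G show ?thesis using that by blast
qed

lemma symmetric_iff: "X \<in> N \<Longrightarrow> adj X = X \<longleftrightarrow> symmetric_op X"
  by (simp add: adj_self_iff clinear)

lemma positive_iff: "X \<in> N \<Longrightarrow> positive_op X \<longleftrightarrow> psd X"
  by (simp add: positive_op_psd clinear)

lemma projection_iff: "X \<in> N \<Longrightarrow> is_projection X \<longleftrightarrow> symmetric_op X \<and> X o\<^sub>L X = X"
  by (simp add: is_projection_def clinear symmetric_iff)

lemma real_imaginary_parts:
  assumes "X \<in> N"
  obtains X1 X2 where "X1 \<in> N" "X2 \<in> N" "symmetric_op X1" "symmetric_op X2" "X = X1 + scale_op \<i> X2"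
proof -
  define X1 where "X1 = (1/2) *\<^sub>R (X + adj X)"
  define X2 where "X2 = scale_op (- \<i>) ((1/2) *\<^sub>R (X - adj X))"
  have a: "adj X \<in> N" and c: "clinear_op X" using assms adj_closed clinear by auto
  have m: "X1 \<in> N" "X2 \<in> N" using assms a unfolding X1_def X2_def by auto
  have "symmetric_op X1" by (auto simp: symmetric_op_def X1_def blinfun.bilinear_simps inner_add_left inner_add_right inner_adj[OF c] inner_adj2[OF c])
  moreover have "symmetric_op X2" 
    unfolding symmetric_op_def X2_def
    by (simp add: scaleC_eq[of "-\<i>"] blinfun.bilinear_simps inner_diff_left inner_diff_right inner_scaleC_ii)
       (simp add: clinear_scaleC[OF c, symmetric] clinear_scaleC[OF clinear_adj[OF c], symmetric] inner_adj[OF c] inner_adj2[OF c] inner_scaleC_ii)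
  moreover have "X = X1 + scale_op \<i> X2"
    by (rule blinfun_eqI) (simp add: X1_def X2_def blinfun.bilinear_simps scaleC_scaleC scaleC_of_real[of 1, simplified] algebra_simps flip: scaleR_add_left)
  ultimately show ?thesis using that m by blast
qed

end

locale tracial_algebra = vn_algebra M for M :: "'h::complex_hilbert operator set" +
  fixes \<tau> :: "'h operator \<Rightarrow> complex"
  assumes state: "normal_faithful_tracial_state M \<tau>"
begin

definition tr :: "'h operator \<Rightarrow> real" where "tr X = Re (\<tau> X)"

lemma tau_add: "X \<in> M \<Longrightarrow> Y \<in> M \<Longrightarrow> \<tau> (X + Y) = \<tau> X + \<tau> Y"
  and tau_scale: "X \<in> M \<Longrightarrow> \<tau> (scale_op c X) = c * \<tau> X"
  and tau_id: "\<tau> id_blinfun = 1"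
  and tau_comm: "X \<in> M \<Longrightarrow> Y \<in> M \<Longrightarrow> \<tau> (X o\<^sub>L Y) = \<tau> (Y o\<^sub>L X)"
  and tau_pos: "X \<in> M \<Longrightarrow> psd X \<Longrightarrow> 0 \<le> \<tau> X"
  and tau_faithful: "X \<in> M \<Longrightarrow> psd X \<Longrightarrow> \<tau> X = 0 \<Longrightarrow> X = 0"
  and tau_normal: "normal_map M (\<le>) UNIV \<tau>"
  using state by (auto simp: normal_faithful_tracial_state_def positive_iff)

lemma tau_scaleR: "X \<in> M \<Longrightarrow> \<tau> (r *\<^sub>R X) = of_real r * \<tau> X"
proof -
  assume "X \<in> M"
  moreover have "r *\<^sub>R X = scale_op (of_real r) X" by (rule blinfun_eqI) (simp add: scaleC_of_real blinfun.scaleR_left)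
  ultimately show ?thesis by (simp add: tau_scale)
qed

lemma tau_minus: "X \<in> M \<Longrightarrow> \<tau> (- X) = - \<tau> X"
  using tau_scaleR[of X "-1"] by simp

lemma tau_diff: "X \<in> M \<Longrightarrow> Y \<in> M \<Longrightarrow> \<tau> (X - Y) = \<tau> X - \<tau> Y"
  using tau_add[of X "- Y"] tau_minus[of Y] by auto

lemma tau_0 [simp]: "\<tau> 0 = 0"
  using tau_scaleR[of 0 0] by auto

lemma tau_sum: "(\<And>i. i \<in> I \<Longrightarrow> f i \<in> M) \<Longrightarrow> \<tau> (sum f I) = (\<Sum>i\<in>I. \<tau> (f i))"
  by (induction I rule: infinite_finite_induct) (auto simp: tau_add sum_closed)

lemma tr_simps:
  "X \<in> M \<Longrightarrow> Y \<in> M \<Longrightarrow> tr (X + Y) = tr X + tr Y"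
  "X \<in> M \<Longrightarrow> Y \<in> M \<Longrightarrow> tr (X - Y) = tr X - tr Y"
  "X \<in> M \<Longrightarrow> tr (- X) = - tr X"
  "X \<in> M \<Longrightarrow> tr (r *\<^sub>R X) = r * tr X"
  "tr id_blinfun = 1" "tr 0 = 0"
  by (simp_all add: tr_def tau_add tau_diff tau_minus tau_scaleR tau_id)

lemma tr_comm: "X \<in> M \<Longrightarrow> Y \<in> M \<Longrightarrow> tr (X o\<^sub>L Y) = tr (Y o\<^sub>L X)"
  by (simp add: tr_def tau_comm)

lemma tr_sum: "(\<And>i. i \<in> I \<Longrightarrow> f i \<in> M) \<Longrightarrow> tr (sum f I) = (\<Sum>i\<in>I. tr (f i))"
  by (simp add: tr_def tau_sum)

lemma tr_pos: "X \<in> M \<Longrightarrow> psd X \<Longrightarrow> 0 \<le> tr X"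
  using tau_pos[of X] by (simp add: tr_def less_eq_complex_def)

lemma tau_real: 
  assumes "X \<in> M" "symmetric_op X" shows "\<tau> X = of_real (tr X)"
proof -
  have "0 \<le> \<tau> (norm X *\<^sub>R id_blinfun - X)"
    using assms symmetric_norm_psd(1)[OF assms(2) order_refl] by (intro tau_pos) auto
  also have "\<tau> (norm X *\<^sub>R id_blinfun - X) = of_real (norm X) - \<tau> X"
    using assms by (subst tau_diff) (auto simp: tau_scaleR[OF mem_intros(2)] tau_id)
  finally have "Im (\<tau> X) = 0" by (simp add: less_eq_complex_def)
  then show ?thesis by (simp add: tr_def complex_eq_iff)
qed

lemma tr_faithful: "X \<in> M \<Longrightarrow> psd X \<Longrightarrow> tr X = 0 \<Longrightarrow> X = 0"
  using tau_faithful tau_real psd_symmetric by (metis of_real_0)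

lemma tr_mono: "X \<in> M \<Longrightarrow> Y \<in> M \<Longrightarrow> psd (Y - X) \<Longrightarrow> tr X \<le> tr Y"
  using tr_pos[of "Y - X"] by (auto simp: tr_simps)

text \<open>
  If \<open>W\<close> is the root of \<open>X\<close>, then \<open>\<tau>(X Y) = \<tau>(W Y W)\<close> by the trace property.
\<close>

lemma tr_prod_nonneg:
  assumes "X \<in> M" "Y \<in> M" "psd X" "psd Y" shows "0 \<le> tr (X o\<^sub>L Y)"
proof -
  obtain W where W: "psd W" "W o\<^sub>L W = X" "\<And>Y. Y o\<^sub>L X = X o\<^sub>L Y \<Longrightarrow> Y o\<^sub>L W = W o\<^sub>L Y"
    using psd_sqrt[OF assms(3)] by metis
  have WM: "W \<in> M" using bicommutant[OF assms(1) W(3)] by blast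
  have "X o\<^sub>L Y = W o\<^sub>L (W o\<^sub>L Y)" unfolding W(2)[symmetric] by (rule blinfun_eqI) simp
  then have "tr (X o\<^sub>L Y) = tr (W o\<^sub>L Y o\<^sub>L W)" using tr_comm[of W "W o\<^sub>L Y"] WM assms(2) by auto
  moreover have "0 \<le> tr (W o\<^sub>L Y o\<^sub>L W)"
    using WM assms W(1) by (intro tr_pos psd_conj psd_symmetric mem_intros)
  ultimately show ?thesis by simp
qed

text \<open>
  The strong limit of a bounded increasing sequence is its supremum in \<open>M\<close>, so normality applies.
\<close>

lemma tr_monotone_limit:
  assumes s: "\<And>n. s n \<in> M" "\<And>n. psd (s (Suc n) - s n)" "\<And>n. symmetric_op (s n)"
    and l: "\<And>x. (\<lambda>n. blinfun_apply (s n) x) \<longlonglongrightarrow> blinfun_apply l x" and le: "\<And>n. tr (s n) \<le> c"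
  shows "tr l \<le> c"
proof -
  have lM: "l \<in> M" by (rule strong_limit_closed[OF s(1) l])
  have syml: "symmetric_op l" by (rule symmetric_strong_limit[OF l s(3)])
  have mono: "psd (s n - s m)" if "m \<le> n" for m n
    using that by (induction rule: dec_induct) (auto intro: psd_trans s)
  have up: "psd (l - s m)" for m
    by (rule psd_strong_limit[of "\<lambda>n. s n - s m" _ m]) (auto simp: blinfun.bilinear_simps intro!: tendsto_intros l mono)
  have least: "psd (u - l)" if "u \<in> M" "\<And>m. psd (u - s m)" for u
    by (rule psd_strong_limit[of "\<lambda>n. u - s n" _ 0]) (auto simp: blinfun.bilinear_simps intro!: tendsto_intros l that)
  have "is_supremum op_le M (range s) l"
    unfolding is_supremum_def op_le_def using lM s(1) up least by (auto simp: positive_iff mem_intros)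
  moreover have "\<forall>X\<in>range s. \<forall>Y\<in>range s. \<exists>Z\<in>range s. op_le X Z \<and> op_le Y Z"
  proof clarsimp
    fix m n show "\<exists>k. op_le (s m) (s k) \<and> op_le (s n) (s k)"
      unfolding op_le_def using s(1) mono by (intro exI[of _ "max m n"]) (auto simp: positive_iff mem_intros)
  qed
  moreover have "range s \<subseteq> {X \<in> M. adj X = X}" using s by (auto simp: symmetric_iff)
  ultimately have "is_supremum (\<le>) UNIV (\<tau> ` range s) (\<tau> l)"
    using tau_normal unfolding normal_map_def by blast
  moreover have "\<tau> (s n) \<le> of_real c" for n
    using le[of n] tau_real[OF s(1,3)] by (simp add: less_eq_complex_def)
  ultimately have "\<tau> l \<le> of_real c" unfolding is_supremum_def by blast
  then show ?thesis by (simp add: tr_def less_eq_complex_def)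
qed

definition Msa :: "'h operator set" where "Msa = {X \<in> M. symmetric_op X}"

sublocale l2: semi_inner Msa "\<lambda>X Y. tr (X o\<^sub>L Y)"
proof unfold_locales
  show "subspace Msa" by (auto simp: Msa_def subspace_def)
  show "tr ((x + y) o\<^sub>L z) = tr (x o\<^sub>L z) + tr (y o\<^sub>L z)" if "x \<in> Msa" "y \<in> Msa" "z \<in> Msa" for x y z
    using that tr_simps(1)[of "x o\<^sub>L z" "y o\<^sub>L z"]
    by (auto simp: Msa_def bounded_bilinear.add_left[OF bounded_bilinear_blinfun_compose])
  show "tr ((r *\<^sub>R x) o\<^sub>L y) = r * tr (x o\<^sub>L y)" if "x \<in> Msa" "y \<in> Msa" for r x y
    using that tr_simps(4)[of "x o\<^sub>L y" r]
    by (auto simp: Msa_def bounded_bilinear.scaleR_left[OF bounded_bilinear_blinfun_compose])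
  show "tr (x o\<^sub>L y) = tr (y o\<^sub>L x)" if "x \<in> Msa" "y \<in> Msa" for x y
    using that tr_comm by (auto simp: Msa_def)
  show "0 \<le> tr (x o\<^sub>L x)" if "x \<in> Msa" for x
    using that by (intro tr_pos psd_square) (auto simp: Msa_def)
qed

end

section \<open>Completeness of bounded sets in the 2-norm\<close>

lemma geometric_tail_bound:
  fixes f :: "nat \<Rightarrow> 'a::real_normed_vector"
  assumes "\<And>k. n \<le> k \<Longrightarrow> norm (f (Suc k) - f k) \<le> c * (1/2)^k" "n \<le> m" "0 \<le> c"
  shows "norm (f m - f n) \<le> 2 * c * (1/2)^n"
proof -
  have "norm (f m - f n) \<le> 2 * c * ((1/2)^n - (1/2)^m)"
    using assms(2)
  proof (induction rule: dec_induct)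
    case (step k)
    have "norm (f (Suc k) - f n) \<le> norm (f (Suc k) - f k) + norm (f k - f n)"
      by (metis diff_add_cancel add_diff_eq norm_triangle_ineq)
    also have "\<dots> \<le> c * (1/2)^k + 2 * c * ((1/2)^n - (1/2)^k)"
      using assms(1)[OF step(1)] step(3) by simp
    finally show ?case by (simp add: field_simps)
  qed simp
  also have "\<dots> \<le> 2 * c * (1/2)^n" using assms(3) by (intro mult_left_mono) auto
  finally show ?thesis .
qed

context tracial_algebra
begin

text \<open>
  2-norm convergence is turned into strong convergence on the Hilbert space, on which \<open>\<tau>\<close> need not
  be given by a vector. Let \<open>D n\<close> be the differences of the sequence. The weighted sums
  \<open>S m K = (\<Sum>n = m..<m+K. 4\<^sup>n (D n)\<^sup>2)\<close> have trace at most \<open>2 (1/2)\<^sup>m\<close> but no bound in norm, so they are replaced by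
  \<open>Q m K = S / (1 + S)\<close>, which lies between \<open>0\<close> and \<open>1\<close>, has no larger trace and is monotone in \<open>K\<close>. Normality bounds
  the trace of the limit \<open>q m\<close> by \<open>2 (1/2)\<^sup>m\<close>, so that the \<open>q m\<close> decrease to \<open>0\<close>. On the range of \<open>r m = 1 - q m\<close> the
  differences satisfy \<open>\<parallel>D n (r m x)\<parallel> \<le> (1/2)\<^sup>n \<parallel>x\<parallel>\<close> for \<open>n \<ge> m\<close>, and as \<open>r m x \<longlonglongrightarrow> x\<close> this makes the sequence
  converge strongly. The 2-norm of \<open>Z = s n - l\<close> is then controlled by splitting
  \<open>\<tau>(Z\<^sup>2) = \<tau>(r Z\<^sup>2 r) + \<tau>(Z\<^sup>2 (1 - r\<^sup>2))\<close> at \<open>r = r n\<close>.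
\<close>

lemma bounded_fast_complete:
  assumes N: "vn_algebra N" "N \<subseteq> M"
    and s: "\<And>n. s n \<in> N" "\<And>n. symmetric_op (s n)" "\<And>n. norm (s n) \<le> C"
    and fast: "\<And>n. tr ((s (Suc n) - s n) o\<^sub>L (s (Suc n) - s n)) \<le> (1/8)^n"
  obtains l :: "'h operator" where "l \<in> N" "symmetric_op l" "\<And>x. (\<lambda>n. blinfun_apply (s n) x) \<longlonglongrightarrow> l x"
    "(\<lambda>n. tr ((s n - l) o\<^sub>L (s n - l))) \<longlonglongrightarrow> 0"
proof -
  interpret N: vn_algebra N by fact
  have C0: "0 \<le> C" using s(3)[of 0] norm_ge_zero[of "s 0"] by linarith
  have sM: "s n \<in> M" for n using s(1) N(2) by auto
  define D where "D = (\<lambda>n. s (Suc n) - s n)"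
  define Y where "Y = (\<lambda>n. D n o\<^sub>L D n)"
  define S where "S = (\<lambda>m K. \<Sum>n\<in>{m..<m+K}. (4::real)^n *\<^sub>R Y n)"
  define R where "R = (\<lambda>m K. resolvent (S m K))"
  define Q where "Q = (\<lambda>m K. id_blinfun - R m K)"
  have symD: "symmetric_op (D n)" for n using s(2) by (simp add: D_def)
  have Dapp: "D n x = s (Suc n) x - s n x" for n x by (simp add: D_def blinfun.diff_left)
  have YM: "Y n \<in> M" and psdY: "psd (Y n)" for n
    using sM psd_square[OF symD] by (auto simp: Y_def D_def)
  have YD: "inner (Y n x) x = (norm (D n x))\<^sup>2" for n x
    using symmetric_opD[OF symD, of n "D n x" x] by (simp add: Y_def power2_norm_eq_inner)
  have SM: "S m K \<in> M" and psdS: "psd (S m K)" for m K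
    using YM psdY by (auto simp: S_def intro!: sum_closed psd_sum)
  have trS: "tr (S m K) \<le> 2 * (1/2)^m" for m K
  proof -
    have "tr (S m K) = (\<Sum>n\<in>{m..<m+K}. 4^n * tr (Y n))"
      unfolding S_def by (subst tr_sum) (auto simp: YM tr_simps)
    also have "\<dots> \<le> (\<Sum>n\<in>{m..<m+K}. (1/2)^n)"
    proof (rule sum_mono)
      fix n
      have "4^n * tr (Y n) \<le> 4^n * (1/8)^n" using fast by (simp add: Y_def D_def)
      also have "\<dots> = (1/2::real)^n" by (simp flip: power_mult_distrib)
      finally show "4^n * tr (Y n) \<le> (1/2)^n" .
    qed
    also have "\<dots> = 2 * ((1/2)^m - (1/2)^(m+K))"
      by (induction K) simp_all
    also have "\<dots> \<le> 2 * (1/2)^m" by simp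
    finally show ?thesis .
  qed
  have RM: "R m K \<in> M" for m K unfolding R_def by (intro resolvent_closed psdS SM)
  have psdR: "psd (R m K)" and psdQ: "psd (Q m K)" and SQ: "psd (S m K - Q m K)" for m K
    using resolvent_psd[OF psdS] unfolding R_def Q_def by auto
  have QM: "Q m K \<in> M" for m K using RM by (auto simp: Q_def)
  have Q1: "psd (id_blinfun - Q m K)" for m K using psdR by (simp add: Q_def)
  have trQ: "tr (Q m K) \<le> 2 * (1/2)^m" for m K
    using tr_mono[OF QM SM SQ] trS by (rule order_trans)
  have Q_mono: "psd (S m' K' - S m K) \<Longrightarrow> psd (Q m' K' - Q m K)" for m K m' K'
    unfolding Q_def R_def using resolvent_antimono[OF psdS[of m K] psdS[of m' K']] by simp
  have QSuc: "psd (Q m (Suc K) - Q m K)" for m K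
    by (rule Q_mono) (use psdY in \<open>simp add: S_def\<close>)
  have QSuc2: "psd (Q m (Suc K) - Q (Suc m) K)" for m K
    by (rule Q_mono) (use psdY in \<open>simp add: S_def sum.atLeast_Suc_lessThan\<close>)
  have "\<exists>q::'h operator. (\<forall>x. (\<lambda>K. Q m K x) \<longlonglongrightarrow> blinfun_apply q x) \<and> psd q \<and> psd (id_blinfun - q)" for m
    using monotone_strong_limit[of "Q m", OF QSuc psdQ Q1] by metis
  then obtain q :: "nat \<Rightarrow> 'h operator" where q: "\<And>m x. (\<lambda>K. Q m K x) \<longlonglongrightarrow> blinfun_apply (q m) x"
    and psdq: "\<And>m. psd (q m)" and q1: "\<And>m. psd (id_blinfun - q m)" by metis
  have qM: "q m \<in> M" for m by (rule strong_limit_closed[OF QM q])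
  have trq: "tr (q m) \<le> 2 * (1/2)^m" for m
    by (rule tr_monotone_limit[OF QM QSuc psd_symmetric[OF psdQ] q trQ])
  define r where "r = (\<lambda>m. id_blinfun - q m)"
  have rM: "r m \<in> M" and psdr: "psd (r m)" and r1: "psd (id_blinfun - r m)" for m
    using qM q1 psdq by (auto simp: r_def)
  have rSuc: "psd (r (Suc m) - r m)" for m
  proof -
    have "(\<lambda>K. (Q m (Suc K) - Q (Suc m) K) x) \<longlonglongrightarrow> (q m - q (Suc m)) x" for x
      using LIMSEQ_Suc[OF q[of m x]] by (auto simp: blinfun.diff_left intro!: tendsto_diff q)
    then have "psd (q m - q (Suc m))" by (rule psd_strong_limit[where N=0]) (rule QSuc2)
    then show ?thesis by (simp add: r_def)
  qed
  obtain r' :: "'h operator" where r': "\<And>x. (\<lambda>m. r m x) \<longlonglongrightarrow> blinfun_apply r' x" "psd (id_blinfun - r')" "\<And>m. psd (r' - r m)"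
    using monotone_strong_limit[of r, OF rSuc psdr r1] by metis
  have r'M: "r' \<in> M" by (rule strong_limit_closed[OF rM r'(1)])
  have tr': "tr (id_blinfun - r') \<le> 2 * (1/2)^m" for m
  proof -
    have "tr (id_blinfun - r') \<le> tr (q m)"
      using r'(3)[of m] r'M qM by (intro tr_mono) (auto simp: r_def algebra_simps)
    then show ?thesis using trq[of m] by simp
  qed
  have lim0: "(\<lambda>m. 2 * (1/2::real)^m) \<longlonglongrightarrow> 2 * 0"
    by (intro tendsto_intros LIMSEQ_power_zero) simp
  have "tr (id_blinfun - r') \<le> 2 * 0" by (rule LIMSEQ_le_const[OF lim0]) (use tr' in blast)
  then have "tr (id_blinfun - r') = 0" using tr_pos[of "id_blinfun - r'"] r'M r'(2) by fastforce
  then have "id_blinfun - r' = 0" using r'M r'(2) by (intro tr_faithful) auto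
  then have rlim: "(\<lambda>m. r m x) \<longlonglongrightarrow> x" for x using r'(1)[of x] by (simp add: eq_iff_diff_eq_0[symmetric])
  \<comment> \<open>With \<open>u = (1 + S)\<^bsup>-1\<^esup> x\<close>, the summand \<open>4\<^sup>n (D n)\<^sup>2\<close> of \<open>S\<close> gives \<open>4\<^sup>n \<parallel>D n u\<parallel>\<^sup>2 \<le> \<langle>S u, u\<rangle> = \<langle>x - u, u\<rangle> \<le> \<parallel>x\<parallel>\<^sup>2\<close>.\<close>
  have key: "norm (s (Suc n) (r m x) - s n (r m x)) \<le> norm x * (1/2)^n" if mn: "m \<le> n" for m n x
  proof -
    have "norm (D n (R m K x)) \<le> norm x * (1/2)^n" if K: "n < m + K" for K
    proof -
      let ?u = "R m K x"
      have xu: "?u + S m K ?u = x" unfolding R_def by (rule resolvent_right[OF psdS])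
      have "4^n * inner (Y n ?u) ?u \<le> inner (S m K ?u) ?u"
      proof -
        have "inner (S m K ?u) ?u = (\<Sum>k\<in>{m..<m+K}. 4^k * inner (Y k ?u) ?u)"
          by (simp add: S_def blinfun.sum_left inner_sum_left blinfun.scaleR_left)
        moreover have "4^n * inner (Y n ?u) ?u \<le> (\<Sum>k\<in>{m..<m+K}. 4^k * inner (Y k ?u) ?u)"
          using mn K psdD[OF psdY] by (intro member_le_sum) auto
        ultimately show ?thesis by simp
      qed
      also have "\<dots> = inner x ?u - inner ?u ?u" by (subst xu[symmetric]) (simp add: inner_add_left)
      also have "\<dots> \<le> inner x x"
        using psd_diffD[OF psdQ[of m K, unfolded Q_def], of x] inner_ge_zero[of ?u]
          inner_commute[of x ?u] unfolding blinfun_apply_id_blinfun id_apply by linarith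
      finally have "4^n * (norm (D n ?u))\<^sup>2 \<le> (norm x)\<^sup>2" by (simp add: YD power2_norm_eq_inner)
      moreover have "(4::real)^n = (2^n)\<^sup>2" by (simp add: power2_eq_square flip: power_mult_distrib)
      ultimately have "(2^n * norm (D n ?u))\<^sup>2 \<le> (norm x)\<^sup>2" by (simp add: power_mult_distrib)
      then have "2^n * norm (D n ?u) \<le> norm x" by (rule power2_le_imp_le) simp
      then show ?thesis by (simp add: field_simps power_one_over)
    qed
    moreover have "(\<lambda>K. norm (D n (R m K x))) \<longlonglongrightarrow> norm (D n (r m x))"
    proof -
      have "(\<lambda>K. x - Q m K x) \<longlonglongrightarrow> x - q m x" by (intro tendsto_intros q)
      then have "(\<lambda>K. R m K x) \<longlonglongrightarrow> r m x" by (simp add: Q_def r_def blinfun.diff_left)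
      then show ?thesis by (rule tendsto_norm[OF blinfun.tendsto[OF tendsto_const]])
    qed
    ultimately have "norm (D n (r m x)) \<le> norm x * (1/2)^n"
      by (intro LIMSEQ_le_const2) (auto intro!: exI[of _ "Suc n"])
    then show ?thesis by (simp add: Dapp)
  qed
  have tail: "norm (s j (r m x) - s n (r m x)) \<le> 2 * norm x * (1/2)^n" if "m \<le> n" "n \<le> j" for m n j x
    using key that by (intro geometric_tail_bound) auto
  have Cb: "norm (s n x) \<le> C * norm x" for n x
    using norm_blinfun[of "s n" x] s(3)[of n] by (meson mult_right_mono norm_ge_zero order_trans)
  have "convergent (\<lambda>n. s n x)" for x
  proof (rule Cauchy_convergent, rule CauchyI')
    fix e :: real assume e: "e > 0"
    define c where "c = C + 1"
    have c: "c > 0" "C \<le> c" using C0 by (auto simp: c_def)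
    then have "e / (4 * c) > 0" using e by simp
    then obtain m where m: "norm (r m x - x) < e / (4 * c)"
      using LIMSEQ_D[OF rlim[of x]] by blast
    have "(\<lambda>n. 2 * norm x * (1/2::real)^n) \<longlonglongrightarrow> 2 * norm x * 0"
      by (intro tendsto_intros LIMSEQ_power_zero) simp
    then obtain n0 where n0: "\<And>n. n \<ge> n0 \<Longrightarrow> 2 * norm x * (1/2::real)^n < e/2"
      using e LIMSEQ_D[of "\<lambda>n. 2 * norm x * (1/2::real)^n" 0 "e/2"] by fastforce
    have "dist (s i x) (s j x) < e" if ij: "i \<ge> max n0 m" "i < j" for i j
    proof -
      have eq: "s j x - s i x = (s j (r m x) - s i (r m x)) - s j (r m x - x) + s i (r m x - x)"
        by (simp add: blinfun.diff_right)
      have "norm (s j x - s i x) \<le> norm (s j (r m x) - s i (r m x)) + norm (s j (r m x - x)) + norm (s i (r m x - x))"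
        unfolding eq using norm_triangle_ineq[of "(s j (r m x) - s i (r m x)) - s j (r m x - x)" "s i (r m x - x)"]
          norm_triangle_ineq4[of "s j (r m x) - s i (r m x)" "s j (r m x - x)"] by linarith
      also have "\<dots> \<le> 2 * norm x * (1/2)^i + C * norm (r m x - x) + C * norm (r m x - x)"
        using tail[of m i j x] Cb ij by (intro add_mono) auto
      also have "C * norm (r m x - x) \<le> e / 4"
      proof -
        have "C * norm (r m x - x) \<le> c * (e / (4 * c))"
          using m c by (intro mult_mono) auto
        also have "\<dots> = e / 4" using c by simp
        finally show ?thesis .
      qed
      finally show ?thesis using n0[of i] ij by (simp add: dist_norm norm_minus_commute)
    qed
    then show "\<exists>k. \<forall>i\<ge>k. \<forall>j>i. dist (s i x) (s j x) < e" by blast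
  qed
  then obtain l :: "'h operator" where l: "\<And>x. (\<lambda>n. s n x) \<longlonglongrightarrow> blinfun_apply l x" and nl: "norm l \<le> C"
    using strong_limit[of s C] s(3) by metis
  have lN: "l \<in> N" by (rule N.strong_limit_closed[OF s(1) l])
  have syml: "symmetric_op l" by (rule symmetric_strong_limit[OF l s(2)])
  have lM: "l \<in> M" using lN N(2) by auto
  have est: "tr ((s n - l) o\<^sub>L (s n - l)) \<le> 4 * (1/4)^n + 4 * C\<^sup>2 * (4 * (1/2)^n)" for n
  proof -
    define Z where "Z = s n - l"
    have ZM: "Z \<in> M" and symZ: "symmetric_op Z" using sM lM s(2) syml by (auto simp: Z_def)
    have nZ: "norm Z \<le> 2 * C" using norm_triangle_ineq4[of "s n" l] s(3)[of n] nl by (simp add: Z_def)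
    have symr: "symmetric_op (r n)" using psdr psd_symmetric by blast
    let ?ZZ = "Z o\<^sub>L Z" and ?rr = "r n o\<^sub>L r n"
    have ZZM: "?ZZ \<in> M" and rrM: "?rr \<in> M" using ZM rM by auto
    have Zr: "norm (Z (r n x)) \<le> 2 * norm x * (1/2)^n" for x
    proof (rule LIMSEQ_le_const2)
      show "(\<lambda>j. norm (s n (r n x) - s j (r n x))) \<longlonglongrightarrow> norm (Z (r n x))"
        unfolding Z_def blinfun.diff_left by (intro tendsto_intros l)
      show "\<exists>k. \<forall>j\<ge>k. norm (s n (r n x) - s j (r n x)) \<le> 2 * norm x * (1/2)^n"
        using tail[of n n _ x] by (auto simp: norm_minus_commute intro!: exI[of _ n])
    qed
    have p1: "psd ((4 * (1/4)^n) *\<^sub>R id_blinfun - (r n o\<^sub>L ?ZZ o\<^sub>L r n))"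
    proof -
      have "inner (r n (Z (Z (r n x)))) x \<le> 4 * (1/4)^n * inner x x" for x
      proof -
        have "inner (r n (Z (Z (r n x)))) x = (norm (Z (r n x)))\<^sup>2"
          using symmetric_opD[OF symr, of "Z (Z (r n x))" x] symmetric_opD[OF symZ, of "Z (r n x)" "r n x"]
          by (simp add: power2_norm_eq_inner)
        also have "\<dots> \<le> (2 * norm x * (1/2)^n)\<^sup>2" using Zr by (intro power_mono) auto
        also have "\<dots> = 4 * ((1/2)^n)\<^sup>2 * inner x x" by (simp add: power_mult_distrib power2_norm_eq_inner)
        also have "((1/2::real)^n)\<^sup>2 = (1/4)^n" by (simp add: power2_eq_square flip: power_mult_distrib)
        finally show ?thesis .
      qed
      moreover have "symmetric_op (r n o\<^sub>L ?ZZ o\<^sub>L r n)"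
        by (intro symmetric_op_conj symr symmetric_op_compose symZ refl)
      ultimately show ?thesis by (simp add: psd_def blinfun.bilinear_simps inner_diff_left)
    qed
    have "tr (r n o\<^sub>L ?ZZ o\<^sub>L r n) \<le> tr ((4 * (1/4)^n) *\<^sub>R id_blinfun)"
      using rM ZZM by (intro tr_mono p1) auto
    then have t1: "tr (r n o\<^sub>L ?ZZ o\<^sub>L r n) \<le> 4 * (1/4)^n" by (simp add: tr_simps(4)[OF mem_intros(2)] tr_simps)
    have "r n o\<^sub>L ?ZZ o\<^sub>L r n = r n o\<^sub>L (?ZZ o\<^sub>L r n)" by (rule blinfun_eqI) simp
    then have "tr (r n o\<^sub>L ?ZZ o\<^sub>L r n) = tr ((?ZZ o\<^sub>L r n) o\<^sub>L r n)"
      using tr_comm[of "r n" "?ZZ o\<^sub>L r n"] rM ZZM by auto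
    also have "(?ZZ o\<^sub>L r n) o\<^sub>L r n = ?ZZ o\<^sub>L ?rr" by (rule blinfun_eqI) simp
    finally have t2: "tr (?ZZ o\<^sub>L ?rr) \<le> 4 * (1/4)^n" using t1 by simp
    have p2: "psd ((4 * C\<^sup>2) *\<^sub>R id_blinfun - ?ZZ)"
    proof (rule symmetric_norm_psd(1))
      show "symmetric_op ?ZZ" by (intro symmetric_op_compose symZ refl)
      have "norm ?ZZ \<le> norm Z * norm Z" by (rule norm_blinfun_compose)
      also have "\<dots> \<le> (2 * C) * (2 * C)" using nZ C0 by (intro mult_mono) auto
      finally show "norm ?ZZ \<le> 4 * C\<^sup>2" by (simp add: power2_eq_square)
    qed
    have pos_id: "psd (id_blinfun - ?rr)"
    proof -
      have "inner (r n (r n x)) x \<le> inner x x" for x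
        using psd_bounded_square[OF psdr, of 1 n x] r1[of n] psd_diffD[OF r1, of n x]
          symmetric_opD[OF symr, of "r n x" x] by simp
      moreover have "symmetric_op ?rr" by (intro symmetric_op_compose symr refl)
      ultimately show ?thesis by (simp add: psd_def blinfun.bilinear_simps inner_diff_left)
    qed
    have p3: "psd (2 *\<^sub>R q n - (id_blinfun - ?rr))"
    proof -
      have "2 *\<^sub>R q n - (id_blinfun - ?rr) = q n o\<^sub>L q n"
        by (rule blinfun_eqI) (simp add: r_def blinfun.bilinear_simps scaleR_2)
      then show ?thesis using psd_square[OF psd_symmetric[OF psdq]] by simp
    qed
    have "0 \<le> tr (((4 * C\<^sup>2) *\<^sub>R id_blinfun - ?ZZ) o\<^sub>L (id_blinfun - ?rr))"
      using ZZM rrM by (intro tr_prod_nonneg p2 pos_id) auto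
    also have "((4 * C\<^sup>2) *\<^sub>R id_blinfun - ?ZZ) o\<^sub>L (id_blinfun - ?rr)
       = (4 * C\<^sup>2) *\<^sub>R (id_blinfun - ?rr) - (?ZZ - (?ZZ o\<^sub>L ?rr))"
      by (rule blinfun_eqI) (simp add: blinfun.bilinear_simps scaleR_diff_right)
    also have "tr \<dots> = 4 * C\<^sup>2 * tr (id_blinfun - ?rr) - (tr ?ZZ - tr (?ZZ o\<^sub>L ?rr))"
      using ZZM rrM tr_simps by (auto simp: mem_intros)
    finally have t3: "tr ?ZZ \<le> 4 * (1/4)^n + 4 * C\<^sup>2 * tr (id_blinfun - ?rr)" using t2 by simp
    have "tr (id_blinfun - ?rr) \<le> tr (2 *\<^sub>R q n)" using rrM qM by (intro tr_mono p3) auto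
    also have "\<dots> \<le> 4 * (1/2)^n" using trq[of n] qM by (simp add: tr_simps)
    finally have "4 * C\<^sup>2 * tr (id_blinfun - ?rr) \<le> 4 * C\<^sup>2 * (4 * (1/2)^n)" by (intro mult_left_mono) auto
    then show ?thesis using t3 by (simp add: Z_def)
  qed
  have "(\<lambda>n. tr ((s n - l) o\<^sub>L (s n - l))) \<longlonglongrightarrow> 0"
  proof (rule tendsto_sandwich[of "\<lambda>_. 0"])
    show "\<forall>\<^sub>F n in sequentially. 0 \<le> tr ((s n - l) o\<^sub>L (s n - l))"
      using s(2) syml sM lM by (intro always_eventually allI tr_pos psd_square) auto
    show "\<forall>\<^sub>F n in sequentially. tr ((s n - l) o\<^sub>L (s n - l)) \<le> 4 * (1/4)^n + 4 * C\<^sup>2 * (4 * (1/2)^n)"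
      using est by simp
    have "(\<lambda>n. 4 * (1/4::real)^n + 4 * C\<^sup>2 * (4 * (1/2)^n)) \<longlonglongrightarrow> 4 * 0 + 4 * C\<^sup>2 * (4 * 0)"
      by (intro tendsto_intros LIMSEQ_power_zero) simp_all
    then show "(\<lambda>n. 4 * (1/4::real)^n + 4 * C\<^sup>2 * (4 * (1/2)^n)) \<longlonglongrightarrow> 0" by simp
  qed simp
  then show ?thesis using that lN syml l by blast
qed

end

section \<open>Projections with prescribed moments\<close>

lemma scaleC_one [simp]: "scaleC 1 x = (x::'h::complex_hilbert)"
  using scaleC_of_real[of 1 x] by simp

lemma four_dependent:
  fixes f :: "real \<times> real \<times> real \<times> real \<Rightarrow> real \<times> real \<times> real"
  assumes "linear f"
  obtains v where "v \<noteq> 0" "f v = 0"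
proof -
  have "\<not> inj f"
  proof
    assume "inj f"
    then have "dim (range f) = DIM(real \<times> real \<times> real \<times> real)"
      using dim_image_eq[OF assms, of UNIV] by simp
    moreover have "dim (range f) \<le> DIM(real \<times> real \<times> real)" by (rule dim_subset_UNIV)
    ultimately show False by simp
  qed
  then show ?thesis using that linear_injective_0[OF assms] by blast
qed

lemma projection_psd:
  assumes "symmetric_op F" "F o\<^sub>L F = F"
  shows "psd F" "psd (id_blinfun - F)" "F (F x) = F x" "inner (F x) x = (norm (F x))\<^sup>2"
proof -
  show FF: "F (F x) = F x" for x using assms(2) by (metis blinfun_apply_blinfun_compose)
  show i: "inner (F x) x = (norm (F x))\<^sup>2" for x
    using symmetric_opD[OF assms(1), of "F x" x] by (simp add: FF power2_norm_eq_inner)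
  show "psd F" using assms(1) by (simp add: psd_def i)
  have "(id_blinfun - F) o\<^sub>L (id_blinfun - F) = id_blinfun - F"
    by (rule blinfun_eqI) (simp add: blinfun.bilinear_simps FF)
  then show "psd (id_blinfun - F)" using psd_square[of "id_blinfun - F"] assms(1) by simp
qed

text \<open>
  \<open>Z\<close> vanishes where \<open>F\<close> does, because \<open>\<parallel>Z y\<parallel>\<^sup>2 \<le> \<langle>Z y, y\<rangle> \<le> \<langle>F y, y\<rangle>\<close>.
\<close>

lemma below_projection:
  fixes F Z :: "'h::real_inner operator"
  assumes F: "symmetric_op F" "F o\<^sub>L F = F" and Z: "psd Z" "psd (F - Z)"
  shows "psd (id_blinfun - Z)" "Z (F x) = Z x" "F (Z x) = Z x"
proof -
  show i: "psd (id_blinfun - Z)" by (rule psd_trans[OF Z(2) projection_psd(2)[OF F]])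
  have "Z (y - F y) = 0" for y
  proof -
    have "inner (Z (y - F y)) (y - F y) \<le> inner (F (y - F y)) (y - F y)" by (rule psd_diffD[OF Z(2)])
    also have "F (y - F y) = 0" by (simp add: blinfun.diff_right projection_psd(3)[OF F])
    finally have "inner (Z (y - F y)) (Z (y - F y)) \<le> 0"
      using psd_bounded_square[OF Z(1), of 1 "y - F y"] i by simp
    then show ?thesis by (metis inner_eq_zero_iff inner_ge_zero order_antisym)
  qed
  then show ZF: "Z (F x) = Z x" for x by (metis blinfun.diff_right eq_iff_diff_eq_0)
  have "inner y (F (Z x)) = inner y (Z x)" for y
    using symmetric_opD[OF F(1), of y "Z x"] symmetric_opD[OF psd_symmetric[OF Z(1)], of _ x] ZF by metis
  then show "F (Z x) = Z x" by (metis vector_eq_ldot)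
qed

context tracial_algebra
begin

text \<open>
  The product need not be self-adjoint, but \<open>X Y + Y X\<close> is, and has twice the trace.
\<close>

lemma tau_prod_real:
  assumes "X \<in> M" "Y \<in> M" "symmetric_op X" "symmetric_op Y"
  shows "\<tau> (X o\<^sub>L Y) = of_real (tr (X o\<^sub>L Y))"
proof -
  have s: "symmetric_op ((X o\<^sub>L Y) + (Y o\<^sub>L X))"
    using assms(3,4) by (simp add: symmetric_op_def blinfun.bilinear_simps inner_add_left inner_add_right)
  have "\<tau> ((X o\<^sub>L Y) + (Y o\<^sub>L X)) = of_real (tr ((X o\<^sub>L Y) + (Y o\<^sub>L X)))"
    by (rule tau_real) (use assms s in auto)
  then have "Im (\<tau> ((X o\<^sub>L Y) + (Y o\<^sub>L X))) = 0" by simp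
  moreover have "\<tau> ((X o\<^sub>L Y) + (Y o\<^sub>L X)) = 2 * \<tau> (X o\<^sub>L Y)"
    using assms tau_add[of "X o\<^sub>L Y" "Y o\<^sub>L X"] tau_comm[of X Y] by auto
  ultimately show ?thesis by (simp add: tr_def complex_eq_iff)
qed

lemma noncommuting_symmetric:
  assumes G: "G \<in> M" "symmetric_op G" "G o\<^sub>L G = G" and nab: "\<not> abelian_projection M G"
  obtains A B where "A \<in> M" "B \<in> M" "symmetric_op A" "symmetric_op B" "A o\<^sub>L B \<noteq> B o\<^sub>L A"
    "G o\<^sub>L A o\<^sub>L G = A" "G o\<^sub>L B o\<^sub>L G = B"
proof -
  let ?c = "\<lambda>X. G o\<^sub>L X o\<^sub>L G"
  have GG: "G (G x) = G x" for x by (rule projection_psd(3)[OF G(2,3)])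
  obtain X Y where XY: "X \<in> M" "Y \<in> M" "?c X o\<^sub>L ?c Y \<noteq> ?c Y o\<^sub>L ?c X"
    using nab G unfolding abelian_projection_def projection_iff[OF G(1)] by auto
  obtain X1 X2 where X: "X1 \<in> M" "X2 \<in> M" "symmetric_op X1" "symmetric_op X2" "X = X1 + scale_op \<i> X2"
    using real_imaginary_parts[OF XY(1)] .
  obtain Y1 Y2 where Y: "Y1 \<in> M" "Y2 \<in> M" "symmetric_op Y1" "symmetric_op Y2" "Y = Y1 + scale_op \<i> Y2"
    using real_imaginary_parts[OF XY(2)] .
  have cl: "clinear_op G" "clinear_op X1" "clinear_op X2" "clinear_op Y1" "clinear_op Y2"
    using clinear G X Y by auto
  have "\<exists>A\<in>{X1, X2}. \<exists>B\<in>{Y1, Y2}. ?c A o\<^sub>L ?c B \<noteq> ?c B o\<^sub>L ?c A"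
  proof (rule ccontr)
    assume "\<not> ?thesis"
    then have e: "?c A o\<^sub>L ?c B = ?c B o\<^sub>L ?c A" if "A = X1 \<or> A = X2" "B = Y1 \<or> B = Y2" for A B
      using that by blast
    have e': "G (A (G (B (G x)))) = G (B (G (A (G x))))" if "A = X1 \<or> A = X2" "B = Y1 \<or> B = Y2" for A B x
      using arg_cong[OF e[OF that], of "\<lambda>Z. Z x"] by (simp add: GG)
    have "?c X o\<^sub>L ?c Y = ?c Y o\<^sub>L ?c X"
      by (rule blinfun_eqI) (simp add: X(5) Y(5) GG blinfun.bilinear_simps clinear_scaleC[OF cl(1)]
          clinear_scaleC[OF cl(2)] clinear_scaleC[OF cl(3)] clinear_scaleC[OF cl(4)] clinear_scaleC[OF cl(5)] scaleC_add_right e'[of X1 Y1] e'[of X1 Y2] e'[of X2 Y1] e'[of X2 Y2] add_ac)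
    with XY(3) show False by simp
  qed
  then obtain A B where AB: "A \<in> M" "B \<in> M" "symmetric_op A" "symmetric_op B" "?c A o\<^sub>L ?c B \<noteq> ?c B o\<^sub>L ?c A"
    using X Y by auto
  have "G o\<^sub>L ?c Z o\<^sub>L G = ?c Z" for Z by (rule blinfun_eqI) (simp add: GG)
  moreover have "?c A \<in> M" "?c B \<in> M" using AB G by auto
  ultimately show ?thesis using that[of "?c A" "?c B"] AB symmetric_op_conj G(2) by blast
qed

text \<open>
  Take non-commuting self-adjoint \<open>A\<close>, \<open>B\<close> in the corner and subtract multiples of \<open>G\<close> to make their traces zero. The
  trace property makes \<open>C = \<i> (A B - B A)\<close> orthogonal to \<open>G\<close>, \<open>A\<close> and \<open>B\<close> for the trace form. In a linear relation its
  coefficient is therefore zero, taking traces removes \<open>G\<close>, and \<open>A\<close>, \<open>B\<close> are independent as they do not commute.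
\<close>

lemma corner_dim_ge_4:
  assumes G: "G \<in> M" "symmetric_op G" "G o\<^sub>L G = G" and nab: "\<not> abelian_projection M G"
  obtains A B C where "A \<in> M" "B \<in> M" "C \<in> M" "symmetric_op A" "symmetric_op B" "symmetric_op C"
    "G o\<^sub>L A o\<^sub>L G = A" "G o\<^sub>L B o\<^sub>L G = B" "G o\<^sub>L C o\<^sub>L G = C"
    "\<And>a b c d. a *\<^sub>R G + b *\<^sub>R A + c *\<^sub>R B + d *\<^sub>R C = 0 \<Longrightarrow> a = 0 \<and> b = 0 \<and> c = 0 \<and> d = 0"
proof -
  have GG: "G (G x) = G x" for x by (rule projection_psd(3)[OF G(2,3)])
  obtain A' B' where A': "A' \<in> M" "B' \<in> M" "symmetric_op A'" "symmetric_op B'" "A' o\<^sub>L B' \<noteq> B' o\<^sub>L A'"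
    "G o\<^sub>L A' o\<^sub>L G = A'" "G o\<^sub>L B' o\<^sub>L G = B'" using noncommuting_symmetric[OF G nab] by metis
  have c1: "G (A' x) = A' x" "A' (G x) = A' x" "G (B' x) = B' x" "B' (G x) = B' x" for x
    using A'(6,7) GG by (metis blinfun_apply_blinfun_compose)+
  have "G \<noteq> 0"
  proof
    assume "G = 0"
    then have "A' x = 0" for x using c1(1)[of x] by simp
    then have "A' = 0" by (intro blinfun_eqI) simp
    with A'(5) show False by simp
  qed
  then have trG: "tr G \<noteq> 0" using tr_faithful[OF G(1) projection_psd(1)[OF G(2,3)]] by auto
  define A where "A = A' - (tr A' / tr G) *\<^sub>R G"
  define B where "B = B' - (tr B' / tr G) *\<^sub>R G"
  define D where "D = (A o\<^sub>L B) - (B o\<^sub>L A)"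
  define C where "C = scale_op \<i> D"
  have AB: "A \<in> M" "B \<in> M" using A' G unfolding A_def B_def by auto
  then have DM: "D \<in> M" unfolding D_def by auto
  then have "C \<in> M" unfolding C_def by auto
  note M = AB DM this
  have sym: "symmetric_op A" "symmetric_op B" using A' G unfolding A_def B_def by auto
  have cA: "clinear_op A" and cB: "clinear_op B" and cG: "clinear_op G" using M G clinear by auto
  have Gc: "G (A x) = A x" "A (G x) = A x" "G (B x) = B x" "B (G x) = B x" for x
    by (simp_all add: A_def B_def blinfun.bilinear_simps c1 GG)
  have "symmetric_op C"
    unfolding symmetric_op_def C_def D_def
    by (simp add: inner_scaleC_ii blinfun.diff_left inner_diff_left inner_diff_right)
       (simp add: clinear_scaleC[OF cA, symmetric] clinear_scaleC[OF cB, symmetric] symmetric_opD[OF sym(1)] symmetric_opD[OF sym(2)])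
  have GC: "G o\<^sub>L C o\<^sub>L G = C" "C o\<^sub>L G = C"
    by (rule blinfun_eqI, simp add: C_def D_def blinfun.bilinear_simps Gc clinear_scaleC[OF cG])+
  have DD: "D = (A' o\<^sub>L B') - (B' o\<^sub>L A')"
    by (rule blinfun_eqI) (simp add: D_def A_def B_def blinfun.bilinear_simps c1 GG algebra_simps)
  then have D0: "D \<noteq> 0" using A'(5) by simp
  have C0: "C \<noteq> 0"
  proof
    assume "C = 0"
    then have "scaleC (-\<i>) (C x) = 0" for x by simp
    then have "D x = 0" for x by (simp add: C_def scaleC_scaleC)
    then have "D = 0" by (intro blinfun_eqI) simp
    with D0 show False by simp
  qed
  have trA: "tr A = 0" and trB: "tr B = 0"
    using A' G trG by (simp_all add: A_def B_def tr_simps mem_intros)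
  have tC: "tr (C o\<^sub>L Z) = 0" if Z: "Z \<in> M" "\<tau> (D o\<^sub>L Z) = 0" for Z
  proof -
    have "C o\<^sub>L Z = scale_op \<i> (D o\<^sub>L Z)" by (rule blinfun_eqI) (simp add: C_def)
    then show ?thesis using M Z by (simp add: tr_def tau_scale mem_intros)
  qed
  have "\<tau> (D o\<^sub>L G) = 0"
  proof -
    have "D o\<^sub>L G = (A o\<^sub>L B) - (B o\<^sub>L A)" by (rule blinfun_eqI) (simp add: D_def blinfun.bilinear_simps Gc)
    then show ?thesis using M tau_comm[of A B] by (simp add: tau_diff mem_intros)
  qed
  moreover have "\<tau> (D o\<^sub>L A) = 0"
  proof -
    have "D o\<^sub>L A = (A o\<^sub>L (B o\<^sub>L A)) - ((B o\<^sub>L A) o\<^sub>L A)" by (rule blinfun_eqI) (simp add: D_def blinfun.bilinear_simps)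
    then show ?thesis using M tau_comm[of A "B o\<^sub>L A"] by (simp add: tau_diff mem_intros)
  qed
  moreover have "\<tau> (D o\<^sub>L B) = 0"
  proof -
    have "D o\<^sub>L B = ((A o\<^sub>L B) o\<^sub>L B) - (B o\<^sub>L (A o\<^sub>L B))" by (rule blinfun_eqI) (simp add: D_def blinfun.bilinear_simps)
    then show ?thesis using M tau_comm[of B "A o\<^sub>L B"] by (simp add: tau_diff mem_intros)
  qed
  ultimately have orth: "tr (C o\<^sub>L G) = 0" "tr (C o\<^sub>L A) = 0" "tr (C o\<^sub>L B) = 0" using tC M G by auto
  have trC: "tr C = 0" using orth(1) GC(2) by simp
  have trCC: "tr (C o\<^sub>L C) \<noteq> 0"
    using tr_faithful[OF mem_intros(7)[OF M(4) M(4)] psd_square[OF \<open>symmetric_op C\<close>]]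
      symmetric_square_zero[OF \<open>symmetric_op C\<close>] C0 by auto
  have indep: "a = 0 \<and> b = 0 \<and> c = 0 \<and> d = 0" if L: "a *\<^sub>R G + b *\<^sub>R A + c *\<^sub>R B + d *\<^sub>R C = 0" for a b c d
  proof -
    have "C o\<^sub>L (a *\<^sub>R G + b *\<^sub>R A + c *\<^sub>R B + d *\<^sub>R C)
       = a *\<^sub>R (C o\<^sub>L G) + b *\<^sub>R (C o\<^sub>L A) + c *\<^sub>R (C o\<^sub>L B) + d *\<^sub>R (C o\<^sub>L C)"
      by (rule blinfun_eqI) (simp add: blinfun.bilinear_simps)
    from arg_cong[OF this, of tr] have "d * tr (C o\<^sub>L C) = 0"
      using M G orth unfolding L by (simp add: tr_simps mem_intros)
    then have d: "d = 0" using trCC by simp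
    from arg_cong[OF L, of tr] have "a * tr G = 0"
      using M G trA trB trC by (simp add: tr_simps mem_intros)
    then have a: "a = 0" using trG by simp
    have L': "b *\<^sub>R A x + c *\<^sub>R B x = 0" for x using arg_cong[OF L, of "\<lambda>Z. blinfun_apply Z x"] a d by (simp add: blinfun.bilinear_simps)
    have "b *\<^sub>R D x = (b *\<^sub>R A (B x) + c *\<^sub>R B (B x)) - B (b *\<^sub>R A x + c *\<^sub>R B x)" for x
      by (simp add: D_def blinfun.bilinear_simps scaleR_diff_right)
    then have "b *\<^sub>R D x = 0" for x unfolding L' by simp
    then have b: "b = 0" using D0 by (metis blinfun_eqI scaleR_eq_0_iff zero_blinfun.rep_eq)
    then have "c *\<^sub>R B x = 0" for x using L'[of x] by simp
    moreover have "B \<noteq> 0" using D0 by (auto simp: D_def)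
    ultimately have "c = 0" by (metis blinfun_eqI scaleR_eq_0_iff zero_blinfun.rep_eq)
    then show ?thesis using a b d by simp
  qed
  show ?thesis
    by (rule that[OF M(1,2,4) sym \<open>symmetric_op C\<close> _ _ GC(1) indep])
      (rule blinfun_eqI, simp add: Gc)+
qed

end

lemma id_blinfun_compose [simp]: "id_blinfun o\<^sub>L X = X" "X o\<^sub>L id_blinfun = X"
  by (rule blinfun_eqI, simp)+

context tracial_algebra
begin

lemma tr_l2_tendsto:
  assumes T: "T \<in> Msa" and s: "\<And>n. s n \<in> Msa" and l: "l \<in> Msa"
    and lim: "(\<lambda>n. tr ((s n - l) o\<^sub>L (s n - l))) \<longlonglongrightarrow> 0"
  shows "(\<lambda>n. tr (T o\<^sub>L s n)) \<longlonglongrightarrow> tr (T o\<^sub>L l)"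
proof -
  have "(\<lambda>n. sqrt (tr (T o\<^sub>L T) * tr ((s n - l) o\<^sub>L (s n - l)))) \<longlonglongrightarrow> sqrt (tr (T o\<^sub>L T) * 0)"
    by (intro tendsto_intros lim)
  then have "(\<lambda>n. sqrt (tr (T o\<^sub>L T) * tr ((s n - l) o\<^sub>L (s n - l)))) \<longlonglongrightarrow> 0" by simp
  then have "(\<lambda>n. tr (T o\<^sub>L s n) - tr (T o\<^sub>L l)) \<longlonglongrightarrow> 0"
  proof (rule Lim_null_comparison[rotated], intro always_eventually allI)
    fix n
    have "\<bar>tr (T o\<^sub>L (s n - l))\<bar> \<le> sqrt (tr (T o\<^sub>L T) * tr ((s n - l) o\<^sub>L (s n - l)))"
      using l2.Cauchy_Schwarz[OF T, of "s n - l"] s l by (intro real_le_rsqrt) simp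
    then show "norm (tr (T o\<^sub>L s n) - tr (T o\<^sub>L l)) \<le> sqrt (tr (T o\<^sub>L T) * tr ((s n - l) o\<^sub>L (s n - l)))"
      using l2.B_minus_right[of "s n" l T] s l T by simp
  qed
  then show ?thesis using LIM_zero_iff by blast
qed

text \<open>
  Put \<open>B = Z - Z\<^sup>2\<close> and perturb by \<open>Y = B W B\<close> with \<open>W\<close> in the corner of the range projection of \<open>B\<close> and \<open>\<parallel>W\<parallel> \<le> 1\<close>. Then
  \<open>-B \<le> -B\<^sup>2 \<le> Y \<le> B\<^sup>2 \<le> B\<close>, and \<open>B\<close> is below both \<open>Z\<close> and \<open>F - Z\<close>, so \<open>Z \<plusminus> Y\<close> stays between \<open>0\<close> and \<open>F\<close>. The map
  \<open>W \<mapsto> Y\<close> is injective on the corner, whose dimension exceeds the number of trace conditions on \<open>Y\<close>.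
\<close>

lemma trace_preserving_perturbation:
  assumes F: "F \<in> M" "symmetric_op F" "F o\<^sub>L F = F" and Z: "Z \<in> M" "psd Z" "psd (F - Z)"
    and notproj: "Z o\<^sub>L Z \<noteq> Z" and T: "T1 \<in> Msa" "T2 \<in> Msa"
    and nab: "\<And>P. abelian_projection M P \<Longrightarrow> P = 0"
  obtains Y where "Y \<in> Msa" "Y \<noteq> 0" "psd (Z + Y)" "psd (Z - Y)" "psd (F - (Z + Y))" "psd (F - (Z - Y))"
    "tr Y = 0" "tr (T1 o\<^sub>L Y) = 0" "tr (T2 o\<^sub>L Y) = 0"
proof -
  note bp = below_projection[OF F(2,3) Z(2,3)]
  have sZ: "symmetric_op Z" using Z(2) psd_symmetric by blast
  define B where "B = Z - (Z o\<^sub>L Z)"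
  have BM: "B \<in> M" using Z by (auto simp: B_def)
  have sB: "symmetric_op B" using sZ symmetric_op_compose[OF sZ sZ] by (simp add: B_def)
  have sq: "inner (X (X x)) x = inner (X x) (X x)" if "symmetric_op X" for X :: "'h operator" and x
    using symmetric_opD[OF that, of "X x" x] by simp
  have psdB: "psd B"
    using psd_bounded_square[OF Z(2), of 1] bp(1) sB by (simp add: psd_def B_def blinfun.diff_left inner_diff_left sq[OF sZ])
  have ZB: "psd (Z - B)" using psd_square[OF sZ] by (simp add: B_def)
  have FZB: "psd ((F - Z) - B)"
  proof -
    have "(F - Z) o\<^sub>L (F - Z) = (F - Z) - B"
      by (rule blinfun_eqI) (simp add: B_def blinfun.bilinear_simps bp projection_psd(3)[OF F(2,3)])
    then show ?thesis using psd_square[of "F - Z"] F sZ by simp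
  qed
  have B1: "psd (1 *\<^sub>R id_blinfun - B)" using psd_trans[OF ZB bp(1)] by simp
  have BB: "inner (B x) (B x) \<le> inner (B x) x" for x using psd_bounded_square[OF psdB B1] by simp
  have "B \<noteq> 0" using notproj by (simp add: B_def)
  obtain G :: "'h operator" where G: "G \<in> M" "symmetric_op G" "G o\<^sub>L G = G" "G o\<^sub>L B = B" "B o\<^sub>L G = B"
    "\<And>x. G x \<in> closure (range B)" using range_projection_closed[OF BM sB] by metis
  have "G \<noteq> 0" using G(4) \<open>B \<noteq> 0\<close> by auto
  then have "\<not> abelian_projection M G" using nab by blast
  then obtain A1 A2 A3 where A: "A1 \<in> M" "A2 \<in> M" "A3 \<in> M" "symmetric_op A1" "symmetric_op A2" "symmetric_op A3"
    "G o\<^sub>L A1 o\<^sub>L G = A1" "G o\<^sub>L A2 o\<^sub>L G = A2" "G o\<^sub>L A3 o\<^sub>L G = A3"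
    and indep: "\<And>a b c d. a *\<^sub>R G + b *\<^sub>R A1 + c *\<^sub>R A2 + d *\<^sub>R A3 = 0 \<Longrightarrow> a = 0 \<and> b = 0 \<and> c = 0 \<and> d = 0"
    using corner_dim_ge_4[OF G(1-3)] by metis
  define W where "W = (\<lambda>(a,b,c,d). a *\<^sub>R G + b *\<^sub>R A1 + c *\<^sub>R A2 + d *\<^sub>R A3)"
  define Y where "Y = (\<lambda>v. B o\<^sub>L W v o\<^sub>L B)"
  have lW: "W (u + v) = W u + W v" "W (r *\<^sub>R u) = r *\<^sub>R W u" for u v r
    by (cases u; cases v; simp add: W_def algebra_simps)+
  have lY: "Y (u + v) = Y u + Y v" "Y (r *\<^sub>R u) = r *\<^sub>R Y u" for u v r
    by (rule blinfun_eqI, simp add: Y_def lW blinfun.bilinear_simps)+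
  have WM: "W v \<in> M" and sW: "symmetric_op (W v)" for v
    using A G by (auto simp: W_def split: prod.split)
  have YM: "Y v \<in> Msa" for v
    using BM WM[of v] symmetric_op_conj[OF sW sB, of v] by (auto simp: Y_def Msa_def)
  have YM': "Y v \<in> M" for v using YM[of v] by (simp add: Msa_def)
  define f where "f = (\<lambda>v. (tr (Y v), tr (T1 o\<^sub>L Y v), tr (T2 o\<^sub>L Y v)))"
  have "linear f"
    by (rule linearI) (simp_all add: f_def lY tr_simps YM' l2.B_simps YM T)
  then obtain v where v: "v \<noteq> 0" "f v = 0" by (rule four_dependent)
  have W0: "W v \<noteq> 0"
  proof
    obtain a b c d where abcd: "v = (a,b,c,d)" by (cases v) auto
    assume "W v = 0"
    then have "a = 0 \<and> b = 0 \<and> c = 0 \<and> d = 0" using indep by (simp add: W_def abcd)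
    with v abcd show False by (simp add: zero_prod_def)
  qed
  have WG: "G o\<^sub>L W v o\<^sub>L G = W v"
  proof -
    have "G (A (G x)) = A x" if "G o\<^sub>L A o\<^sub>L G = A" for A x
      using arg_cong[OF that, of "\<lambda>Z. blinfun_apply Z x"] by simp
    note e = this[OF A(7)] this[OF A(8)] this[OF A(9)]
    show ?thesis by (rule blinfun_eqI)
        (simp add: W_def blinfun.bilinear_simps e projection_psd(3)[OF G(2,3)] split: prod.split)
  qed
  \<comment> \<open>If \<open>B W B = 0\<close>, the form of \<open>W\<close> vanishes on the range of \<open>B\<close>, hence on its closure, which is the range of \<open>G\<close>.\<close>
  have Y0: "Y v \<noteq> 0"
  proof
    assume "Y v = 0"
    then have z: "inner (W v (B x)) (B y) = 0" for x y
    proof -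
      have "B (W v (B x)) = 0" using arg_cong[OF \<open>Y v = 0\<close>, of "\<lambda>Z. blinfun_apply Z x"] by (simp add: Y_def)
      then show ?thesis using symmetric_opD[OF sB, of "W v (B x)" y] by simp
    qed
    have z1: "inner (W v (B x)) y = 0" if "y \<in> closure (range B)" for x y
    proof -
      have "closed {y. inner (W v (B x)) y = 0}" by (intro closed_Collect_eq continuous_intros)
      moreover have "range B \<subseteq> {y. inner (W v (B x)) y = 0}" using z by auto
      ultimately show ?thesis using that closure_minimal by blast
    qed
    have z2: "inner (W v x) y = 0" if "x \<in> closure (range B)" "y \<in> closure (range B)" for x y
    proof -
      have "closed {x. inner (W v x) y = 0}" by (intro closed_Collect_eq continuous_intros)
      moreover have "range B \<subseteq> {x. inner (W v x) y = 0}" using z1 that by auto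
      ultimately show ?thesis using that closure_minimal by blast
    qed
    have "inner (G (W v (G x))) y = 0" for x y
      using z2[OF G(6) G(6), of x y] symmetric_opD[OF G(2)] by simp
    then have "W v x = 0" for x
      using arg_cong[OF WG, of "\<lambda>Z. blinfun_apply Z x"] by (metis blinfun_apply_blinfun_compose inner_eq_zero_iff)
    then show False using W0 by (auto intro: blinfun_eqI)
  qed
  define t where "t = 1 / norm (W v)"
  have t: "t > 0" "norm (t *\<^sub>R W v) \<le> 1" using W0 by (auto simp: t_def)
  define U where "U = t *\<^sub>R Y v"
  have UB: "\<bar>inner (U x) x\<bar> \<le> inner (B x) x" for x
  proof -
    have "inner (U x) x = inner ((t *\<^sub>R W v) (B x)) (B x)"
      using symmetric_opD[OF sB, of "W v (B x)" x] by (simp add: U_def Y_def blinfun.bilinear_simps)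
    also have "\<bar>\<dots>\<bar> \<le> norm ((t *\<^sub>R W v) (B x)) * norm (B x)" by (rule Cauchy_Schwarz_ineq2)
    also have "\<dots> \<le> 1 * norm (B x) * norm (B x)"
      by (intro mult_right_mono order_trans[OF norm_blinfun] t) auto
    also have "\<dots> = inner (B x) (B x)" by (simp add: power2_norm_eq_inner[symmetric] power2_eq_square)
    finally show ?thesis using BB[of x] by simp
  qed
  have UM: "U \<in> Msa" unfolding U_def using YM by simp
  then have sU: "symmetric_op U" by (simp add: Msa_def)
  have pos: "psd (X + U)" "psd (X - U)" if "psd (X - B)" for X
  proof -
    have sX: "symmetric_op X" using psd_symmetric[OF that] sB symmetric_op_simps(3)[of "X - B" B] by simp
    have "inner (B x) x \<le> inner (X x) x" for x by (rule psd_diffD[OF that])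
    then have "0 \<le> inner (X x) x + inner (U x) x" "0 \<le> inner (X x) x - inner (U x) x" for x
      using UB[of x] by (smt (verit))+
    then show "psd (X + U)" "psd (X - U)" using sX sU
      by (simp_all add: psd_def blinfun.bilinear_simps inner_add_left inner_diff_left)
  qed
  have "tr U = 0" "tr (T1 o\<^sub>L U) = 0" "tr (T2 o\<^sub>L U) = 0"
    using v(2) YM YM' T by (simp_all add: U_def f_def zero_prod_def tr_simps l2.B_scale_right)
  moreover have "U \<noteq> 0" using Y0 t by (simp add: U_def)
  ultimately show ?thesis
    using that[OF UM] pos[OF ZB] pos[OF FZB] by (simp add: algebra_simps)
qed

text \<open>
  A noncommutative Lyapunov theorem. The positive contractions below \<open>F\<close> with the moments of \<open>X\<close> form a
  2-norm complete set. At an extreme point the perturbation of \<open>trace_preserving_perturbation\<close> would contradict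
  extremality unless the point is a projection.
\<close>

lemma lyapunov:
  assumes F: "F \<in> M" "symmetric_op F" "F o\<^sub>L F = F" and X: "X \<in> M" "psd X" "psd (F - X)"
    and T: "T \<in> M" and nab: "\<And>P. abelian_projection M P \<Longrightarrow> P = 0"
  obtains Q where "Q \<in> M" "symmetric_op Q" "Q o\<^sub>L Q = Q" "psd (F - Q)" "\<tau> Q = \<tau> X" "\<tau> (T o\<^sub>L Q) = \<tau> (T o\<^sub>L X)"
proof -
  obtain T1 T2 where TT: "T1 \<in> M" "T2 \<in> M" "symmetric_op T1" "symmetric_op T2" "T = T1 + scale_op \<i> T2"
    using real_imaginary_parts[OF T] .
  have T12: "T1 \<in> Msa" "T2 \<in> Msa" and idM: "id_blinfun \<in> Msa" using TT by (auto simp: Msa_def)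
  define K where "K = {Z \<in> Msa. psd Z \<and> psd (F - Z) \<and> tr Z = tr X \<and> tr (T1 o\<^sub>L Z) = tr (T1 o\<^sub>L X)
     \<and> tr (T2 o\<^sub>L Z) = tr (T2 o\<^sub>L X)}"
  have KM: "K \<subseteq> Msa" by (auto simp: K_def)
  have XK: "X \<in> K" using X psd_symmetric by (auto simp: K_def Msa_def)
  have K1: "psd (id_blinfun - Z)" if "Z \<in> K" for Z
    using that below_projection(1)[OF F(2,3)] by (auto simp: K_def)
  have Kn: "norm Z \<le> 1" if "Z \<in> K" for Z
    using psd_norm_le(2)[of Z 1] that K1[OF that] by (auto simp: K_def)
  have "l2.fast_complete K" unfolding l2.fast_complete_def
  proof (intro allI impI, elim conjE)
    fix s assume sK: "\<forall>n. s n \<in> K" and fast: "\<forall>n. tr ((s (Suc n) - s n) o\<^sub>L (s (Suc n) - s n)) \<le> (1/8)^n"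
    have sM: "s n \<in> Msa" for n using sK KM by auto
    obtain l :: "'h operator" where l: "l \<in> M" "symmetric_op l" "\<And>x. (\<lambda>n. blinfun_apply (s n) x) \<longlonglongrightarrow> l x"
      "(\<lambda>n. tr ((s n - l) o\<^sub>L (s n - l))) \<longlonglongrightarrow> 0"
      using bounded_fast_complete[of M s 1] sM sK Kn fast vn_algebra_axioms by (auto simp: Msa_def)
    have lM: "l \<in> Msa" using l by (simp add: Msa_def)
    have psds: "psd (s n)" "psd (F - s n)" for n using sK by (auto simp: K_def)
    have "psd l" by (rule psd_strong_limit[OF l(3), of 0]) (rule psds)
    moreover have "psd (F - l)"
      by (rule psd_strong_limit[of "\<lambda>n. F - s n" _ 0]) (auto simp: blinfun.diff_left psds intro!: tendsto_intros l)
    moreover have lim: "tr (Z o\<^sub>L l) = c" if "Z \<in> Msa" "\<And>n. tr (Z o\<^sub>L s n) = c" for Z c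
      using tr_l2_tendsto[OF that(1) sM lM l(4)] that(2) by (simp add: LIMSEQ_const_iff)
    have "tr l = tr X" using lim[OF idM, of "tr X"] sK by (simp add: K_def)
    moreover have "tr (T1 o\<^sub>L l) = tr (T1 o\<^sub>L X)" "tr (T2 o\<^sub>L l) = tr (T2 o\<^sub>L X)"
      using sK by (auto intro!: lim T12 simp: K_def)
    ultimately have "l \<in> K" using lM by (simp add: K_def)
    then show "\<exists>l\<in>K. (\<lambda>n. tr ((s n - l) o\<^sub>L (s n - l))) \<longlonglongrightarrow> 0" using l(4) by blast
  qed
  moreover have "tr (Z o\<^sub>L Z) \<le> 1" if "Z \<in> K" for Z
  proof -
    have "psd Z" using that by (simp add: K_def)
    have sZ: "symmetric_op Z" and ZM: "Z \<in> M" using that by (auto simp: K_def Msa_def)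
    have "norm (Z o\<^sub>L Z) \<le> 1 * 1"
      using Kn[OF that] by (intro order_trans[OF norm_blinfun_compose] mult_mono) auto
    then have "psd (1 *\<^sub>R id_blinfun - (Z o\<^sub>L Z))"
      by (intro symmetric_norm_psd symmetric_op_compose sZ) auto
    then have "tr (Z o\<^sub>L Z) \<le> tr id_blinfun" using ZM by (intro tr_mono) auto
    then show ?thesis by (simp add: tr_simps)
  qed
  ultimately obtain Z where ZK: "Z \<in> K"
    and ext: "\<And>u. u \<in> Msa \<Longrightarrow> Z + u \<in> K \<Longrightarrow> Z - u \<in> K \<Longrightarrow> tr (u o\<^sub>L u) = 0"
    using l2.extreme_point_exists[OF KM, of 1] XK by (metis empty_iff)
  have Z: "Z \<in> M" "psd Z" "psd (F - Z)" "symmetric_op Z" "Z \<in> Msa" using ZK by (auto simp: K_def Msa_def)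
  have "Z o\<^sub>L Z = Z"
  proof (rule ccontr)
    assume np: "Z o\<^sub>L Z \<noteq> Z"
    obtain Y where Y: "Y \<in> Msa" "Y \<noteq> 0" "psd (Z + Y)" "psd (Z - Y)" "psd (F - (Z + Y))" "psd (F - (Z - Y))"
      "tr Y = 0" "tr (T1 o\<^sub>L Y) = 0" "tr (T2 o\<^sub>L Y) = 0"
      using trace_preserving_perturbation[OF F Z(1-3) np T12 nab] by metis
    have YM: "Y \<in> M" "symmetric_op Y" using Y(1) by (auto simp: Msa_def)
    have "Z + Y \<in> K" "Z - Y \<in> K"
      using ZK Y Z YM T12 by (auto simp: K_def tr_simps l2.B_add_right l2.B_minus_right)
    then have "tr (Y o\<^sub>L Y) = 0" using ext Y(1) by blast
    then have "Y o\<^sub>L Y = 0" using YM by (intro tr_faithful psd_square) auto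
    then show False using Y(2) YM symmetric_square_zero by blast
  qed
  moreover have "\<tau> Z = \<tau> X"
  proof -
    have "tr Z = tr X" using ZK by (simp add: K_def)
    then show ?thesis using tau_real[OF Z(1,4)] tau_real[OF X(1) psd_symmetric[OF X(2)]] by simp
  qed
  moreover have "\<tau> (T o\<^sub>L Z) = \<tau> (T o\<^sub>L X)"
  proof -
    have e: "\<tau> (T o\<^sub>L W) = of_real (tr (T1 o\<^sub>L W)) + \<i> * of_real (tr (T2 o\<^sub>L W))"
      if W: "W \<in> M" "symmetric_op W" for W
    proof -
      have "T o\<^sub>L W = (T1 o\<^sub>L W) + scale_op \<i> (T2 o\<^sub>L W)" by (rule blinfun_eqI) (simp add: TT(5) blinfun.add_left)
      then show ?thesis using TT W tau_prod_real by (simp add: tau_add tau_scale mem_intros)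
    qed
    show ?thesis using ZK X Z psd_symmetric[OF X(2)] by (simp add: e K_def)
  qed
  ultimately show ?thesis using that Z by blast
qed

end

section \<open>Conditional expectations onto abelian subalgebras\<close>

lemma psd_compose_commute:
  fixes X Y :: "'h::{real_inner,banach} operator"
  assumes "psd X" "psd Y" "X o\<^sub>L Y = Y o\<^sub>L X"
  shows "psd (X o\<^sub>L Y)"
proof -
  obtain W :: "'h operator" where W: "psd W" "W o\<^sub>L W = X" "\<And>Y. Y o\<^sub>L X = X o\<^sub>L Y \<Longrightarrow> Y o\<^sub>L W = W o\<^sub>L Y"
    using psd_sqrt[OF assms(1)] by metis
  have WY: "Y (W x) = W (Y x)" for x using W(3)[of Y] assms(3) by (metis blinfun_apply_blinfun_compose)
  have "X o\<^sub>L Y = W o\<^sub>L Y o\<^sub>L W" by (rule blinfun_eqI) (simp add: W(2)[symmetric] WY)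
  then show ?thesis using psd_conj[OF assms(2) psd_symmetric[OF W(1)]] by simp
qed

lemma (in vn_algebra) jordan_closed:
  assumes "D \<in> N" "symmetric_op D"
  obtains P Q where "P \<in> N" "Q \<in> N" "psd P" "psd Q" "D = P - Q" "P o\<^sub>L Q = 0" "Q o\<^sub>L P = 0"
proof -
  obtain P Q :: "'h operator" where "psd P" "psd Q" "D = P - Q" "P o\<^sub>L Q = 0" "Q o\<^sub>L P = 0"
    and c: "\<And>Y. Y o\<^sub>L D = D o\<^sub>L Y \<Longrightarrow> Y o\<^sub>L P = P o\<^sub>L Y \<and> Y o\<^sub>L Q = Q o\<^sub>L Y"
    using jordan_decomposition[OF assms(2)] by metis
  moreover have "P \<in> N" "Q \<in> N" using bicommutant[OF assms(1)] c by blast+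
  ultimately show ?thesis using that by blast
qed

locale abelian_subalgebra = tracial_algebra M \<tau> + A: vn_algebra A
  for M :: "'h::complex_hilbert operator set" and \<tau> and A +
  assumes sub: "A \<subseteq> M" and comm: "\<And>X Y. X \<in> A \<Longrightarrow> Y \<in> A \<Longrightarrow> X o\<^sub>L Y = Y o\<^sub>L X"
begin

lemma AM: "X \<in> A \<Longrightarrow> X \<in> M" using sub by auto

lemma psd_prod: "X \<in> A \<Longrightarrow> Y \<in> A \<Longrightarrow> psd X \<Longrightarrow> psd Y \<Longrightarrow> psd (X o\<^sub>L Y)"
  by (intro psd_compose_commute comm)

text \<open>
  Both traces are nonnegative, so the first one is zero. This combination of traces is the one that the
  variational inequality in \<open>contraction_expectation\<close> produces.
\<close>

lemma cube_trace_zero: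
  assumes P: "P \<in> A" "psd P" and le: "2 * tr (P o\<^sub>L P) + tr (P o\<^sub>L P o\<^sub>L P) \<le> 0"
  shows "P = 0"
proof -
  have sP: "symmetric_op P" and PM: "P \<in> M" using P psd_symmetric AM by auto
  have "0 \<le> tr (P o\<^sub>L P o\<^sub>L P)" "0 \<le> tr (P o\<^sub>L P)"
    using PM by (auto intro!: tr_pos psd_conj P sP psd_square)
  then have "tr (P o\<^sub>L P) = 0" using le by linarith
  then have "P o\<^sub>L P = 0" using PM by (intro tr_faithful psd_square sP) auto
  then show ?thesis by (rule symmetric_square_zero[OF sP])
qed

text \<open>
  The value \<open>h\<close> of the expectation at \<open>X\<close> is the point nearest to \<open>X\<close> in 2-norm among the \<open>b\<close> in \<open>A\<close> with
  \<open>-1 \<le> b \<le> 2\<close>. The interval is larger than \<open>[0, 1]\<close> so that the solution lies in its interior: once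
  \<open>0 \<le> h \<le> 1\<close> is known, \<open>h + c\<close> and \<open>h - c\<close> are admissible for self-adjoint contractions \<open>c\<close>, and the variational inequality
  becomes the equation \<open>\<tau>((X - h) c) = 0\<close>. To see \<open>h \<le> 1\<close>, the inequality is tested in a direction supported by the
  positive part of \<open>h - 1\<close>, and \<open>h \<ge> 0\<close> is obtained in the same way from the negative part of \<open>h\<close>.
\<close>

lemma contraction_expectation:
  assumes X: "X \<in> M" "psd X" "psd (id_blinfun - X)"
  obtains h where "h \<in> A" "psd h" "\<And>b. b \<in> A \<Longrightarrow> \<tau> (h o\<^sub>L b) = \<tau> (X o\<^sub>L b)"
proof -
  let ?I = "id_blinfun :: 'h operator"
  define K where "K = {b \<in> A. psd (b + ?I) \<and> psd (2 *\<^sub>R ?I - b)}"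
  have symK: "symmetric_op b" if "b \<in> K" for b
    using that psd_symmetric[of "b + ?I"] symmetric_op_simps(4)[of "b + ?I" ?I] by (auto simp: K_def)
  have KM: "K \<subseteq> Msa" using symK AM by (auto simp: Msa_def K_def)
  have Kn: "norm b \<le> 4" if "b \<in> K" for b
  proof -
    have e: "3 *\<^sub>R ?I - (b + ?I) = 2 *\<^sub>R ?I - b" by (rule blinfun_eqI) (simp add: blinfun.bilinear_simps algebra_simps scaleR_2 scaleR_left_distrib[of 2 1, simplified])
    have "psd (3 *\<^sub>R ?I - (b + ?I))" unfolding e using that by (simp add: K_def)
    then have "norm (b + ?I) \<le> 3" using that by (intro psd_norm_le(2)) (simp_all add: K_def)
    moreover have "norm ?I \<le> 1" by (intro norm_blinfun_bound) auto
    ultimately show ?thesis using norm_triangle_ineq4[of "b + ?I" ?I] by simp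
  qed
  have "convex K"
  proof (rule convexI)
    fix a b and u v :: real assume ab: "a \<in> K" "b \<in> K" and uv: "0 \<le> u" "0 \<le> v" "u + v = 1"
    have 1: "u *\<^sub>R a + v *\<^sub>R b + ?I = u *\<^sub>R (a + ?I) + v *\<^sub>R (b + ?I)"
      using uv(3) by (simp add: algebra_simps flip: scaleR_left_distrib)
    have 2: "2 *\<^sub>R ?I - (u *\<^sub>R a + v *\<^sub>R b) = u *\<^sub>R (2 *\<^sub>R ?I - a) + v *\<^sub>R (2 *\<^sub>R ?I - b)"
    proof -
      have "u *\<^sub>R (2 *\<^sub>R ?I - a) + v *\<^sub>R (2 *\<^sub>R ?I - b) = (u + v) *\<^sub>R (2 *\<^sub>R ?I) - (u *\<^sub>R a + v *\<^sub>R b)"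
        unfolding scaleR_left_distrib scaleR_diff_right by simp
      then show ?thesis using uv(3) by simp
    qed
    show "u *\<^sub>R a + v *\<^sub>R b \<in> K" using ab uv(1,2) unfolding K_def by (auto simp: 1 2)
  qed
  moreover have "l2.fast_complete K" unfolding l2.fast_complete_def
  proof (intro allI impI, elim conjE)
    fix s assume sK: "\<forall>n. s n \<in> K" and fast: "\<forall>n. tr ((s (Suc n) - s n) o\<^sub>L (s (Suc n) - s n)) \<le> (1/8)^n"
    have f: "s n \<in> A" "symmetric_op (s n)" "norm (s n) \<le> 4"
      "tr ((s (Suc n) - s n) o\<^sub>L (s (Suc n) - s n)) \<le> (1/8)^n" for n
      using sK symK Kn fast by (auto simp: K_def)
    obtain l :: "'h operator" where l: "l \<in> A" "symmetric_op l" "\<And>x. (\<lambda>n. blinfun_apply (s n) x) \<longlonglongrightarrow> l x"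
      "(\<lambda>n. tr ((s n - l) o\<^sub>L (s n - l))) \<longlonglongrightarrow> 0"
      by (rule bounded_fast_complete[OF A.vn_algebra_axioms sub, of s 4, OF f]) (rule that)
    have psds: "psd (s n + ?I)" "psd (2 *\<^sub>R ?I - s n)" for n using sK by (auto simp: K_def)
    have "psd (l + ?I)"
      by (rule psd_strong_limit[of "\<lambda>n. s n + ?I" _ 0]) (auto simp: blinfun.add_left psds intro!: tendsto_intros l)
    moreover have "psd (2 *\<^sub>R ?I - l)"
      by (rule psd_strong_limit[of "\<lambda>n. 2 *\<^sub>R ?I - s n" _ 0]) (auto simp: blinfun.diff_left psds intro!: tendsto_intros l)
    ultimately have "l \<in> K" using l(1) by (simp add: K_def)
    then show "\<exists>l\<in>K. (\<lambda>n. tr ((s n - l) o\<^sub>L (s n - l))) \<longlonglongrightarrow> 0" using l(4) by blast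
  qed
  moreover have "0 \<in> K" by (auto simp: K_def)
  moreover have XMsa: "X \<in> Msa" using X psd_symmetric by (auto simp: Msa_def)
  ultimately obtain h where hK: "h \<in> K" and var: "\<And>b. b \<in> K \<Longrightarrow> tr ((X - h) o\<^sub>L (b - h)) \<le> 0"
    using l2.nearest_point[OF KM] by (metis empty_iff)
  have hA: "h \<in> A" and hb: "psd (h + ?I)" "psd (2 *\<^sub>R ?I - h)" using hK by (auto simp: K_def)
  have hM: "h \<in> M" and sh: "symmetric_op h" using AM hA symK hK by auto
  have X_h: "X - h \<in> M" using X hM by auto
  have trc: "tr ((X - h) o\<^sub>L (r *\<^sub>R c)) = r * tr ((X - h) o\<^sub>L c)" if "c \<in> M" for r c
    using that X_h tr_simps(4)[of "(X - h) o\<^sub>L c" r]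
    by (simp add: bounded_bilinear.scaleR_right[OF bounded_bilinear_blinfun_compose] mem_intros)
  \<comment> \<open>The steps from \<open>h\<close> to \<open>h + (2 - h) d\<close> and to \<open>h - (h + 1) d\<close> stay in \<open>K\<close> for \<open>0 \<le> d \<le> 1\<close>: they move towards the
    upper and the lower end of the interval.\<close>
  have upper: "tr ((X - h) o\<^sub>L ((2 *\<^sub>R ?I - h) o\<^sub>L c)) \<le> 0"
    and lower: "tr ((X - h) o\<^sub>L ((h + ?I) o\<^sub>L c)) \<ge> 0" if c: "c \<in> A" "psd c" for c
  proof -
    obtain r where r: "0 < r" "psd (r *\<^sub>R c)" "psd (?I - r *\<^sub>R c)" using psd_rescale[OF c(2)] .
    define d where "d = r *\<^sub>R c"
    have d: "d \<in> A" "psd d" "psd (?I - d)" using c r by (auto simp: d_def)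
    note d1 = d(3)
    have uA: "2 *\<^sub>R ?I - h \<in> A" "h + ?I \<in> A" "?I - d \<in> A" using hA d by auto
    have "h + ((2 *\<^sub>R ?I - h) o\<^sub>L d) \<in> K" unfolding K_def
    proof (intro CollectI conjI)
      show "h + ((2 *\<^sub>R ?I - h) o\<^sub>L d) \<in> A" using hA uA d by auto
      have e: "h + ((2 *\<^sub>R ?I - h) o\<^sub>L d) + ?I = (h + ?I) + ((2 *\<^sub>R ?I - h) o\<^sub>L d)" by simp
      show "psd (h + ((2 *\<^sub>R ?I - h) o\<^sub>L d) + ?I)" unfolding e by (intro psd_simps(3) hb(1) psd_prod[OF uA(1) d(1) hb(2) d(2)])
      have e: "2 *\<^sub>R ?I - (h + ((2 *\<^sub>R ?I - h) o\<^sub>L d)) = (2 *\<^sub>R ?I - h) o\<^sub>L (?I - d)"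
        by (rule blinfun_eqI) (simp add: blinfun.bilinear_simps algebra_simps)
      show "psd (2 *\<^sub>R ?I - (h + ((2 *\<^sub>R ?I - h) o\<^sub>L d)))"
        unfolding e by (rule psd_prod[OF uA(1,3) hb(2) d1])
    qed
    from var[OF this] have "r * tr ((X - h) o\<^sub>L ((2 *\<^sub>R ?I - h) o\<^sub>L c)) \<le> 0"
      using trc[of "(2 *\<^sub>R ?I - h) o\<^sub>L c" r] AM c(1) uA
      by (simp add: d_def bounded_bilinear.scaleR_right[OF bounded_bilinear_blinfun_compose] mem_intros)
    then show "tr ((X - h) o\<^sub>L ((2 *\<^sub>R ?I - h) o\<^sub>L c)) \<le> 0" using r by (simp add: mult_le_0_iff)
    have "h - ((h + ?I) o\<^sub>L d) \<in> K" unfolding K_def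
    proof (intro CollectI conjI)
      show "h - ((h + ?I) o\<^sub>L d) \<in> A" using hA uA d by auto
      have e: "h - ((h + ?I) o\<^sub>L d) + ?I = (h + ?I) o\<^sub>L (?I - d)"
        by (rule blinfun_eqI) (simp add: blinfun.bilinear_simps algebra_simps)
      show "psd (h - ((h + ?I) o\<^sub>L d) + ?I)" unfolding e by (rule psd_prod[OF uA(2,3) hb(1) d1])
      have e: "2 *\<^sub>R ?I - (h - ((h + ?I) o\<^sub>L d)) = (2 *\<^sub>R ?I - h) + ((h + ?I) o\<^sub>L d)" by simp
      show "psd (2 *\<^sub>R ?I - (h - ((h + ?I) o\<^sub>L d)))"
        unfolding e by (intro psd_simps(3) hb(2) psd_prod[OF uA(2) d(1) hb(1) d(2)])
    qed
    moreover have "(h - ((h + ?I) o\<^sub>L d)) - h = (-r) *\<^sub>R ((h + ?I) o\<^sub>L c)"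
      by (rule blinfun_eqI) (simp add: d_def blinfun.bilinear_simps)
    ultimately have "- r * tr ((X - h) o\<^sub>L ((h + ?I) o\<^sub>L c)) \<le> 0"
      using var trc[of "(h + ?I) o\<^sub>L c" "- r"] AM c(1) uA by (metis A.mem_intros(7))
    then show "tr ((X - h) o\<^sub>L ((h + ?I) o\<^sub>L c)) \<ge> 0" using r by (simp add: zero_le_mult_iff)
  qed
  have le1: "psd (?I - h)"
  proof -
    have hI: "h - ?I \<in> A" "symmetric_op (h - ?I)" using hA sh by auto
    obtain P Q where J: "P \<in> A" "Q \<in> A" "psd P" "psd Q" "h - ?I = P - Q" "P o\<^sub>L Q = 0" "Q o\<^sub>L P = 0"
      using A.jordan_closed[OF hI] .
    have h: "h = ?I + P - Q" using J(5) by (simp add: algebra_simps)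
    have QP: "Q (P x) = 0" for x using J(7) by (metis blinfun_apply_blinfun_compose zero_blinfun.rep_eq)
    let ?C = "(h + ?I) o\<^sub>L P"
    have I: "h + ?I \<in> A" using hA by auto
    have CA: "?C \<in> A" "psd ?C" using I J(1) psd_prod[OF I J(1) hb(1) J(3)] by auto
    have "0 \<le> tr ((?I - X) o\<^sub>L ?C)" using X CA AM by (intro tr_prod_nonneg) auto
    moreover have "0 \<le> tr ((X - h) o\<^sub>L ?C)" using lower J by blast
    ultimately have "0 \<le> tr (((?I - X) o\<^sub>L ?C) + ((X - h) o\<^sub>L ?C))"
      using tr_simps(1)[of "(?I - X) o\<^sub>L ?C" "(X - h) o\<^sub>L ?C"] X X_h AM[OF CA(1)] by (auto simp: mem_intros)
    also have "((?I - X) o\<^sub>L ?C) + ((X - h) o\<^sub>L ?C) = - (2 *\<^sub>R (P o\<^sub>L P) + (P o\<^sub>L P o\<^sub>L P))"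
      by (rule blinfun_eqI) (simp add: h blinfun.bilinear_simps QP algebra_simps scaleR_2)
    also have "tr \<dots> = - (2 * tr (P o\<^sub>L P) + tr (P o\<^sub>L P o\<^sub>L P))"
      using AM[OF J(1)] by (simp add: tr_simps mem_intros)
    finally have "P = 0" using cube_trace_zero J by auto
    then have "?I - h = Q" using h by simp
    then show ?thesis using J(4) by simp
  qed
  have ge0: "psd h"
  proof -
    obtain P Q where J: "P \<in> A" "Q \<in> A" "psd P" "psd Q" "h = P - Q" "P o\<^sub>L Q = 0" "Q o\<^sub>L P = 0"
      using A.jordan_closed[OF hA sh] .
    have PQ: "P (Q x) = 0" for x using J(6) by (metis blinfun_apply_blinfun_compose zero_blinfun.rep_eq)
    let ?C = "(2 *\<^sub>R ?I - h) o\<^sub>L Q"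
    have I: "2 *\<^sub>R ?I - h \<in> A" using hA by auto
    have CA: "?C \<in> A" "psd ?C" using I J(2) psd_prod[OF I J(2) hb(2) J(4)] by auto
    have "0 \<le> tr (X o\<^sub>L ?C)" using X CA AM by (intro tr_prod_nonneg) auto
    moreover have "tr ((X - h) o\<^sub>L ?C) \<le> 0" using upper J(2,4) by blast
    ultimately have "0 \<le> tr ((X o\<^sub>L ?C) - ((X - h) o\<^sub>L ?C))"
      using tr_simps(2)[of "X o\<^sub>L ?C" "(X - h) o\<^sub>L ?C"] X X_h AM[OF CA(1)] by (auto simp: mem_intros)
    also have "(X o\<^sub>L ?C) - ((X - h) o\<^sub>L ?C) = - (2 *\<^sub>R (Q o\<^sub>L Q) + (Q o\<^sub>L Q o\<^sub>L Q))"
      by (rule blinfun_eqI) (simp add: J(5) blinfun.bilinear_simps PQ algebra_simps scaleR_2)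
    also have "tr \<dots> = - (2 * tr (Q o\<^sub>L Q) + tr (Q o\<^sub>L Q o\<^sub>L Q))"
      using AM[OF J(2)] by (simp add: tr_simps mem_intros)
    finally have "Q = 0" using cube_trace_zero J(2,4) by auto
    then show ?thesis using J(3,5) by simp
  qed
  have zero1: "tr ((X - h) o\<^sub>L c) = 0" if c: "c \<in> A" "symmetric_op c" "norm c \<le> 1" for c
  proof -
    have p: "psd (?I - c)" "psd (?I + c)" using symmetric_norm_psd[OF c(2,3)] by simp_all
    have e: "2 *\<^sub>R ?I = ?I + ?I" by (simp add: scaleR_2)
    have es: "h + c + ?I = h + (?I + c)" "2 *\<^sub>R ?I - (h + c) = (?I - h) + (?I - c)"
      "h - c + ?I = h + (?I - c)" "2 *\<^sub>R ?I - (h - c) = (?I - h) + (?I + c)" by (simp_all add: e)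
    have "h + c \<in> K" "h - c \<in> K" unfolding K_def mem_Collect_eq es
      using p ge0 le1 hA c(1) by auto
    from var[OF this(1)] var[OF this(2)] show ?thesis using trc[of c "-1"] AM[OF c(1)] by simp
  qed
  have zero: "tr ((X - h) o\<^sub>L c) = 0" if c: "c \<in> A" "symmetric_op c" for c
  proof (cases "c = 0")
    case False
    have "tr ((X - h) o\<^sub>L ((1 / norm c) *\<^sub>R c)) = 0" using c False by (intro zero1) auto
    then show ?thesis using trc[OF AM[OF c(1)]] False by simp
  qed (simp add: tr_simps)
  have "\<tau> (h o\<^sub>L b) = \<tau> (X o\<^sub>L b)" if b: "b \<in> A" for b
  proof -
    obtain b1 b2 where B: "b1 \<in> A" "b2 \<in> A" "symmetric_op b1" "symmetric_op b2" "b = b1 + scale_op \<i> b2"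
      using A.real_imaginary_parts[OF b] .
    have "\<tau> ((X - h) o\<^sub>L b1) = 0" "\<tau> ((X - h) o\<^sub>L b2) = 0"
      using zero[OF B(1,3)] zero[OF B(2,4)] tau_prod_real[OF X_h] B AM sh psd_symmetric[OF X(2)] by simp_all
    moreover have "(X - h) o\<^sub>L b = ((X - h) o\<^sub>L b1) + scale_op \<i> ((X - h) o\<^sub>L b2)"
      by (rule blinfun_eqI) (simp add: B(5) blinfun.add_left blinfun.add_right clinear_scaleC[OF clinear[OF X_h]])
    ultimately have "\<tau> ((X - h) o\<^sub>L b) = 0"
      using X_h B AM by (simp add: tau_add tau_scale mem_intros)
    moreover have "(X - h) o\<^sub>L b = (X o\<^sub>L b) - (h o\<^sub>L b)" by (rule blinfun_eqI) (simp add: blinfun.diff_left)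
    ultimately show ?thesis using X hM AM[OF b] by (simp add: tau_diff mem_intros)
  qed
  then show ?thesis using that hA ge0 by blast
qed

end

context abelian_subalgebra
begin

text \<open>
  Pairing with \<open>b = adj d\<close> is enough, by faithfulness. This makes all algebraic properties of the expectation
  consequences of uniqueness.
\<close>

lemma trace_pairing_zero:
  assumes "d \<in> A" "\<And>b. b \<in> A \<Longrightarrow> \<tau> (d o\<^sub>L b) = 0"
  shows "d = 0"
proof -
  have c: "clinear_op d" and a: "adj d \<in> A" using assms A.clinear A.adj_closed by auto
  have e: "inner (d (adj d x)) y = inner (adj d x) (adj d y)" for x y by (rule inner_adj[OF c])
  moreover have "inner x (d (adj d y)) = inner (adj d x) (adj d y)" for x y by (simp add: inner_adj2[OF c])
  ultimately have "psd (d o\<^sub>L adj d)" by (simp add: psd_def symmetric_op_def)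
  moreover have "d o\<^sub>L adj d \<in> M" using assms a by (auto intro: AM)
  moreover have "\<tau> (d o\<^sub>L adj d) = 0" using assms a by blast
  ultimately have dd: "d o\<^sub>L adj d = 0" using tau_faithful by blast
  have "inner (adj d x) (adj d x) = 0" for x
    using e[of x x] arg_cong[OF dd, of "\<lambda>Z. blinfun_apply Z x"] by simp
  then have "adj d = 0" by (intro blinfun_eqI) simp
  then have "inner (d x) y = 0" for x y by (simp add: inner_adj[OF c])
  then have "d x = 0" for x by (metis inner_eq_zero_iff)
  then show "d = 0" by (intro blinfun_eqI) simp
qed

lemma expectation_exists:
  assumes X: "X \<in> M"
  shows "\<exists>h\<in>A. \<forall>b\<in>A. \<tau> (h o\<^sub>L b) = \<tau> (X o\<^sub>L b)"
proof -
  let ?I = "id_blinfun :: 'h operator"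
  have sa: "\<exists>h\<in>A. \<forall>b\<in>A. \<tau> (h o\<^sub>L b) = \<tau> (X o\<^sub>L b)" if X: "X \<in> M" "symmetric_op X" for X
  proof -
    define c where "c = norm X + 1"
    have c: "c > 0" using norm_ge_zero[of X] unfolding c_def by linarith
    define Y where "Y = (1 / (2*c)) *\<^sub>R (c *\<^sub>R ?I + X)"
    have p: "psd (c *\<^sub>R ?I - X)" "psd (c *\<^sub>R ?I + X)"
      using symmetric_norm_psd[OF X(2), of c] by (auto simp: c_def)
    have "psd Y" unfolding Y_def using p(2) c by (intro psd_simps(4)) auto
    moreover have "?I - Y = (1 / (2*c)) *\<^sub>R (c *\<^sub>R ?I - X)"
      using c by (intro blinfun_eqI) (simp add: Y_def blinfun.bilinear_simps scaleR_add_right scaleR_diff_right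
           algebra_simps flip: scaleR_add_left)
    then have "psd (?I - Y)" using p(1) c by simp
    moreover have YM: "Y \<in> M" unfolding Y_def using X by auto
    ultimately obtain h where h: "h \<in> A" "\<And>b. b \<in> A \<Longrightarrow> \<tau> (h o\<^sub>L b) = \<tau> (Y o\<^sub>L b)"
      using contraction_expectation[of Y] by metis
    have "\<tau> (((2*c) *\<^sub>R h - c *\<^sub>R ?I) o\<^sub>L b) = \<tau> (X o\<^sub>L b)" if b: "b \<in> A" for b
    proof -
      have "((2*c) *\<^sub>R h - c *\<^sub>R ?I) o\<^sub>L b = (2*c) *\<^sub>R (h o\<^sub>L b) - c *\<^sub>R b"
        by (rule blinfun_eqI) (simp add: blinfun.bilinear_simps)
      moreover have "X o\<^sub>L b = (2*c) *\<^sub>R (Y o\<^sub>L b) - c *\<^sub>R b"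
        using c by (intro blinfun_eqI) (simp add: Y_def blinfun.bilinear_simps)
      ultimately show ?thesis using h b AM YM by (simp add: tau_diff tau_scaleR mem_intros)
    qed
    moreover have "(2*c) *\<^sub>R h - c *\<^sub>R ?I \<in> A" using h by auto
    ultimately show ?thesis by blast
  qed
  obtain X1 X2 where XX: "X1 \<in> M" "X2 \<in> M" "symmetric_op X1" "symmetric_op X2" "X = X1 + scale_op \<i> X2"
    using real_imaginary_parts[OF X] .
  obtain h1 where h1: "h1 \<in> A" "\<And>b. b \<in> A \<Longrightarrow> \<tau> (h1 o\<^sub>L b) = \<tau> (X1 o\<^sub>L b)" using sa XX by metis
  obtain h2 where h2: "h2 \<in> A" "\<And>b. b \<in> A \<Longrightarrow> \<tau> (h2 o\<^sub>L b) = \<tau> (X2 o\<^sub>L b)" using sa XX by metis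
  have e: "(Z1 + scale_op \<i> Z2) o\<^sub>L b = (Z1 o\<^sub>L b) + scale_op \<i> (Z2 o\<^sub>L b)" for Z1 Z2 b :: "'h operator"
    by (rule blinfun_eqI) (simp add: blinfun.add_left)
  have "\<tau> ((h1 + scale_op \<i> h2) o\<^sub>L b) = \<tau> (X o\<^sub>L b)" if b: "b \<in> A" for b
    using h1 h2 XX b AM by (simp add: e tau_add tau_scale mem_intros)
  moreover have "h1 + scale_op \<i> h2 \<in> A" using h1 h2 by auto
  ultimately show ?thesis by blast
qed

definition E :: "'h operator \<Rightarrow> 'h operator" where
  "E X = (SOME h. h \<in> A \<and> (\<forall>b\<in>A. \<tau> (h o\<^sub>L b) = \<tau> (X o\<^sub>L b)))"

lemma E_mem: "X \<in> M \<Longrightarrow> E X \<in> A"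
  and tau_E: "X \<in> M \<Longrightarrow> b \<in> A \<Longrightarrow> \<tau> (E X o\<^sub>L b) = \<tau> (X o\<^sub>L b)"
proof -
  have "E X \<in> A \<and> (\<forall>b\<in>A. \<tau> (E X o\<^sub>L b) = \<tau> (X o\<^sub>L b))" if "X \<in> M" for X
  proof -
    have ex: "\<exists>h. h \<in> A \<and> (\<forall>b\<in>A. \<tau> (h o\<^sub>L b) = \<tau> (X o\<^sub>L b))"
      using expectation_exists[OF that] by blast
    show ?thesis unfolding E_def by (rule someI_ex[OF ex])
  qed
  then show "X \<in> M \<Longrightarrow> E X \<in> A" "X \<in> M \<Longrightarrow> b \<in> A \<Longrightarrow> \<tau> (E X o\<^sub>L b) = \<tau> (X o\<^sub>L b)" by blast+
qed

lemma E_unique: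
  assumes "X \<in> M" "h \<in> A" "\<And>b. b \<in> A \<Longrightarrow> \<tau> (h o\<^sub>L b) = \<tau> (X o\<^sub>L b)"
  shows "E X = h"
proof -
  have "E X - h = 0"
  proof (rule trace_pairing_zero)
    show "E X - h \<in> A" using E_mem assms by auto
    fix b assume b: "b \<in> A"
    have "(E X - h) o\<^sub>L b = (E X o\<^sub>L b) - (h o\<^sub>L b)" by (rule blinfun_eqI) (simp add: blinfun.diff_left)
    then show "\<tau> ((E X - h) o\<^sub>L b) = 0"
      using tau_E[OF assms(1) b] assms(2,3) b E_mem[OF assms(1)] AM by (simp add: tau_diff mem_intros)
  qed
  then show ?thesis by simp
qed

lemma E_add: "X \<in> M \<Longrightarrow> Y \<in> M \<Longrightarrow> E (X + Y) = E X + E Y"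
proof (rule E_unique)
  assume X: "X \<in> M" "Y \<in> M"
  then show "X + Y \<in> M" "E X + E Y \<in> A" using E_mem by auto
  have e: "(Z1 + Z2) o\<^sub>L b = (Z1 o\<^sub>L b) + (Z2 o\<^sub>L b)" for Z1 Z2 b :: "'h operator"
    by (rule blinfun_eqI) (simp add: blinfun.add_left)
  show "\<tau> ((E X + E Y) o\<^sub>L b) = \<tau> ((X + Y) o\<^sub>L b)" if "b \<in> A" for b
    using that X E_mem[OF X(1)] E_mem[OF X(2)] AM by (simp add: e tau_add tau_E mem_intros)
qed

lemma E_scale: "X \<in> M \<Longrightarrow> E (scale_op c X) = scale_op c (E X)"
proof (rule E_unique)
  assume X: "X \<in> M"
  then show "scale_op c X \<in> M" "scale_op c (E X) \<in> A" using E_mem by auto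
  have e: "scale_op c Z o\<^sub>L b = scale_op c (Z o\<^sub>L b)" for Z b :: "'h operator"
    by (rule blinfun_eqI) simp
  show "\<tau> (scale_op c (E X) o\<^sub>L b) = \<tau> (scale_op c X o\<^sub>L b)" if "b \<in> A" for b
    using that X E_mem[OF X] AM by (simp add: e tau_scale tau_E mem_intros)
qed

lemma E_diff: "X \<in> M \<Longrightarrow> Y \<in> M \<Longrightarrow> E (X - Y) = E X - E Y"
  using E_add[of "X - Y" Y] by (simp add: mem_intros)

lemma E_module: "a \<in> A \<Longrightarrow> b \<in> A \<Longrightarrow> X \<in> M \<Longrightarrow> E (a o\<^sub>L X o\<^sub>L b) = a o\<^sub>L E X o\<^sub>L b"
proof (rule E_unique)
  assume X: "a \<in> A" "b \<in> A" "X \<in> M"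
  have EX: "E X \<in> A" using X E_mem by auto
  show "a o\<^sub>L X o\<^sub>L b \<in> M" "a o\<^sub>L E X o\<^sub>L b \<in> A" using X AM EX by auto
  fix c assume c: "c \<in> A"
  have e: "\<tau> ((a o\<^sub>L Z o\<^sub>L b) o\<^sub>L c) = \<tau> (Z o\<^sub>L (b o\<^sub>L c o\<^sub>L a))" if "Z \<in> M" for Z
  proof -
    have "(a o\<^sub>L Z o\<^sub>L b) o\<^sub>L c = a o\<^sub>L (Z o\<^sub>L b o\<^sub>L c)" "(Z o\<^sub>L b o\<^sub>L c) o\<^sub>L a = Z o\<^sub>L (b o\<^sub>L c o\<^sub>L a)"
      by (rule blinfun_eqI, simp)+
    then show ?thesis using tau_comm[of a "Z o\<^sub>L b o\<^sub>L c"] that X c AM by (simp add: mem_intros)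
  qed
  show "\<tau> ((a o\<^sub>L E X o\<^sub>L b) o\<^sub>L c) = \<tau> ((a o\<^sub>L X o\<^sub>L b) o\<^sub>L c)"
    using e X c EX AM tau_E[of X "b o\<^sub>L c o\<^sub>L a"] by (simp add: A.mem_intros)
qed

lemma E_id: "a \<in> A \<Longrightarrow> E a = a" by (rule E_unique) (auto intro: AM)

lemma tau_E_eq: "X \<in> M \<Longrightarrow> \<tau> (E X) = \<tau> X"
  using tau_E[of X id_blinfun] by (auto simp: A.mem_intros)

lemma E_psd:
  assumes "X \<in> M" "psd X" shows "psd (E X)"
proof -
  obtain r where r: "0 < r" "psd (r *\<^sub>R X)" "psd (id_blinfun - r *\<^sub>R X)" using psd_rescale[OF assms(2)] .
  have p: "psd (r *\<^sub>R X)" "r *\<^sub>R X \<in> M" using assms r by auto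
  obtain h where h: "h \<in> A" "psd h" "\<And>b. b \<in> A \<Longrightarrow> \<tau> (h o\<^sub>L b) = \<tau> ((r *\<^sub>R X) o\<^sub>L b)"
    using contraction_expectation[OF p(2,1) r(3)] by metis
  have "E (r *\<^sub>R X) = h" by (rule E_unique) (use h p in auto)
  moreover have "Z = scale_op (of_real (1/r)) (r *\<^sub>R Z)" for Z :: "'h operator"
    using r by (intro blinfun_eqI) (simp add: scaleC_of_real[of "1/r"] blinfun.scaleR_left del: of_real_divide)
  ultimately have "E X = scale_op (of_real (1/r)) h" using E_scale[OF p(2), of "of_real (1/r)"] by metis
  also have "\<dots> = (1/r) *\<^sub>R h" by (intro blinfun_eqI) (simp add: scaleC_of_real[of "1/r"] blinfun.scaleR_left del: of_real_divide)
  finally show ?thesis using h(2) r by simp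
qed

text \<open>
  Let \<open>u\<close> bound the image of \<open>D\<close> and let \<open>k\<close> be a small multiple of the negative part of \<open>u - E S\<close>. Splitting
  \<open>\<tau> = \<tau>(k \<cdot>) + \<tau>((1 - k) \<cdot>)\<close> into two positive functionals shows that normality of \<open>\<tau>\<close> passes to \<open>\<tau>(k \<cdot>)\<close>, so
  \<open>\<tau>(k S) \<le> \<tau>(k u)\<close>. As \<open>k (u - E S)\<close> is a negative multiple of the square of the negative part, this part is zero.
\<close>

lemma E_normal: "normal_map M op_le A E"
  unfolding normal_map_def
proof (intro allI impI, elim conjE)
  fix D S
  assume D: "D \<subseteq> {X \<in> M. adj X = X}" "D \<noteq> {}" "\<forall>X\<in>D. \<forall>Y\<in>D. \<exists>Z\<in>D. op_le X Z \<and> op_le Y Z"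
    and S: "is_supremum op_le M D S"
  have DM: "X \<in> M" "symmetric_op X" if "X \<in> D" for X using that D(1) symmetric_iff by auto
  have SM: "S \<in> M" using S by (simp add: is_supremum_def)
  have XS: "psd (S - X)" if "X \<in> D" for X
    using S that DM[OF that] SM by (auto simp: is_supremum_def op_le_def positive_op_psd)
  have supt: "is_supremum (\<le>) UNIV (\<tau> ` D) (\<tau> S)"
    using tau_normal D S unfolding normal_map_def by blast
  show "is_supremum op_le A (E ` D) (E S)" unfolding is_supremum_def
  proof (intro conjI ballI impI)
    show "E S \<in> A" using SM E_mem by blast
    fix x assume "x \<in> E ` D"
    then obtain X where X: "X \<in> D" "x = E X" by auto
    have "S - X \<in> M" using SM DM[OF X(1)] by auto
    then have "psd (E S - E X)" using E_psd[of "S - X"] E_diff[OF SM DM(1)[OF X(1)]] XS[OF X(1)] by simp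
    moreover have "E S - E X \<in> A" using E_mem SM DM(1)[OF X(1)] by auto
    ultimately show "op_le x (E S)" using X(2) by (simp add: op_le_def A.positive_iff)
  next
    fix u assume u: "u \<in> A" "\<forall>x\<in>E ` D. op_le x u"
    have ES: "E S \<in> A" using SM E_mem by blast
    have uX: "psd (u - E X)" if "X \<in> D" for X using u(2) that by (auto simp: op_le_def positive_op_psd)
    obtain X0 where X0: "X0 \<in> D" using D(2) by auto
    have "S - X0 \<in> M" using SM DM[OF X0] by auto
    then have "psd (E S - E X0)" using E_psd[of "S - X0"] E_diff[OF SM DM(1)[OF X0]] XS[OF X0] by simp
    then have "symmetric_op ((u - E X0) - (E S - E X0))" using uX[OF X0] psd_symmetric symmetric_op_simps(4) by blast
    then have sd: "symmetric_op (u - E S)" by simp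
    have dA: "u - E S \<in> A" using u(1) ES by auto
    obtain P Q where J: "P \<in> A" "Q \<in> A" "psd P" "psd Q" "u - E S = P - Q" "P o\<^sub>L Q = 0" "Q o\<^sub>L P = 0"
      using A.jordan_closed[OF dA sd] .
    obtain r where r: "0 < r" "psd (r *\<^sub>R Q)" "psd (id_blinfun - r *\<^sub>R Q)" using psd_rescale[OF J(4)] .
    define k where "k = r *\<^sub>R Q"
    have k: "k \<in> A" "psd k" and k1: "psd (id_blinfun - k)" using J r by (auto simp: k_def)
    have kM: "k \<in> M" "u \<in> M" "E S \<in> M" "Q \<in> M" using k u(1) ES J(2) AM by auto
    have ld: "k o\<^sub>L (Y - Z) = (k o\<^sub>L Y) - (k o\<^sub>L Z)" "(id_blinfun - k) o\<^sub>L Y = Y - (k o\<^sub>L Y)" for Y Z :: "'h operator"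
      by (rule blinfun_eqI, simp add: blinfun.bilinear_simps)+
    have tk: "\<tau> (k o\<^sub>L E X) = \<tau> (k o\<^sub>L X)" if "X \<in> M" for X
      using tau_E[OF that k(1)] tau_comm[of k X] tau_comm[of k "E X"] that kM AM[OF E_mem[OF that]] by simp
    \<comment> \<open>An upper bound of \<open>\<tau>\<close> on \<open>D\<close>; that it also bounds \<open>\<tau> S\<close> is the claim \<open>\<tau>(k S) \<le> \<tau>(k u)\<close>.\<close>
    define c where "c = \<tau> S - \<tau> (k o\<^sub>L S) + \<tau> (k o\<^sub>L u)"
    have "\<tau> X \<le> c" if X: "X \<in> D" for X
    proof -
      note XM = DM[OF X]
      have SXM: "S - X \<in> M" using SM XM by auto
      have nonneg: "0 \<le> \<tau> (Y o\<^sub>L Z)" if "Y \<in> M" "Z \<in> M" "psd Y" "psd Z" for Y Z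
        using tau_prod_real[OF that(1,2) psd_symmetric[OF that(3)] psd_symmetric[OF that(4)]]
          tr_prod_nonneg[OF that] by (simp add: less_eq_complex_def)
      have "0 \<le> \<tau> ((id_blinfun - k) o\<^sub>L (S - X))"
        using SXM kM k1 XS[OF X] by (intro nonneg) auto
      then have 1: "0 \<le> (\<tau> S - \<tau> X) - (\<tau> (k o\<^sub>L S) - \<tau> (k o\<^sub>L X))"
        using SM XM kM by (simp add: ld tau_diff mem_intros)
      have "u - E X \<in> M" using kM AM[OF E_mem[OF XM(1)]] by auto
      then have "0 \<le> \<tau> (k o\<^sub>L (u - E X))" using kM k uX[OF X] by (intro nonneg) auto
      then have 2: "0 \<le> \<tau> (k o\<^sub>L u) - \<tau> (k o\<^sub>L X)"
        using kM tk[OF XM(1)] AM[OF E_mem[OF XM(1)]] by (simp add: ld tau_diff mem_intros)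
      from add_mono[OF 1 2] show ?thesis by (simp add: c_def less_eq_complex_def)
    qed
    then have "\<tau> S \<le> c" using supt unfolding is_supremum_def by auto
    then have "0 \<le> \<tau> (k o\<^sub>L u) - \<tau> (k o\<^sub>L E S)" using tk[OF SM] by (simp add: c_def less_eq_complex_def)
    also have "\<dots> = \<tau> (k o\<^sub>L (u - E S))" using kM by (simp add: ld tau_diff mem_intros)
    also have "k o\<^sub>L (u - E S) = (- r) *\<^sub>R (Q o\<^sub>L Q)"
    proof (rule blinfun_eqI)
      fix x
      have "Q (P x) = 0" using J(7) by (metis blinfun_apply_blinfun_compose zero_blinfun.rep_eq)
      then show "(k o\<^sub>L (u - E S)) x = ((- r) *\<^sub>R (Q o\<^sub>L Q)) x"
        by (simp add: J(5) k_def blinfun.bilinear_simps)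
    qed
    finally have "0 \<le> - r * tr (Q o\<^sub>L Q)"
      using kM tr_simps(4)[of "Q o\<^sub>L Q" "-r"] by (simp add: tr_def less_eq_complex_def mem_intros)
    then have "tr (Q o\<^sub>L Q) \<le> 0" using r by (simp add: zero_le_mult_iff mult_le_0_iff)
    moreover have QQ: "psd (Q o\<^sub>L Q)" "Q o\<^sub>L Q \<in> M" using psd_square[OF psd_symmetric[OF J(4)]] kM by auto
    ultimately have "Q o\<^sub>L Q = 0" using tr_pos[of "Q o\<^sub>L Q"] by (intro tr_faithful) auto
    then have "Q = 0" using symmetric_square_zero psd_symmetric J(4) by blast
    then have "psd (u - E S)" using J(3,5) by simp
    then show "op_le (E S) u" using dA by (simp add: op_le_def A.positive_iff)
  qed
qed

lemma E_expectation: "normal_trace_preserving_expectation M \<tau> A E"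
  unfolding normal_trace_preserving_expectation_def
  using E_mem E_add E_scale E_id E_module E_normal tau_E_eq E_psd
  by (auto simp: positive_iff A.positive_iff)

end

section \<open>Complete lattices of commuting projections\<close>

lemma commuting_projections_product:
  assumes "symmetric_op f" "f o\<^sub>L f = f" "symmetric_op g" "g o\<^sub>L g = g" "f o\<^sub>L g = g o\<^sub>L f"
  shows "symmetric_op (f o\<^sub>L g)" "(f o\<^sub>L g) o\<^sub>L (f o\<^sub>L g) = f o\<^sub>L g" "psd (f - (f o\<^sub>L g))"
proof -
  have a: "f (f x) = f x" "g (g x) = g x" "g (f x) = f (g x)" for x
    using assms by (metis blinfun_apply_blinfun_compose)+
  show s: "symmetric_op (f o\<^sub>L g)" by (rule symmetric_op_compose[OF assms(1,3,5)])
  show "(f o\<^sub>L g) o\<^sub>L (f o\<^sub>L g) = f o\<^sub>L g" by (rule blinfun_eqI) (simp add: a)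
  have "(f - (f o\<^sub>L g)) o\<^sub>L (f - (f o\<^sub>L g)) = f - (f o\<^sub>L g)"
    by (rule blinfun_eqI) (simp add: a blinfun.bilinear_simps)
  then show "psd (f - (f o\<^sub>L g))" using psd_square[of "f - (f o\<^sub>L g)"] s assms(1) by simp
qed

lemma projection_contraction:
  assumes "symmetric_op f" "f o\<^sub>L f = f" shows "norm (f x) \<le> norm x"
proof -
  have "(norm (f x))\<^sup>2 \<le> norm (f x) * norm x"
    using norm_cauchy_schwarz[of "f x" x] projection_psd(4)[OF assms, of x] by simp
  then show ?thesis by (cases "norm (f x) = 0") (auto simp: power2_eq_square)
qed

text \<open>
  A Boolean algebra of commuting projections that is closed under decreasing limits. As there is a
  faithful trace, countable infima suffice to produce infima of arbitrary families.
\<close>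

locale projection_lattice = tracial_algebra M \<tau> for M :: "'h::complex_hilbert operator set" and \<tau> +
  fixes L :: "'h operator set"
  assumes L_M: "L \<subseteq> M" and L_proj: "\<And>f. f \<in> L \<Longrightarrow> symmetric_op f \<and> f o\<^sub>L f = f"
    and L_comm: "\<And>f g. f \<in> L \<Longrightarrow> g \<in> L \<Longrightarrow> f o\<^sub>L g = g o\<^sub>L f"
    and L_id: "id_blinfun \<in> L" and L_compl: "\<And>f. f \<in> L \<Longrightarrow> id_blinfun - f \<in> L"
    and L_prod: "\<And>f g. f \<in> L \<Longrightarrow> g \<in> L \<Longrightarrow> f o\<^sub>L g \<in> L"
    and L_lim: "\<And>s l. (\<And>n. s n \<in> L) \<Longrightarrow> (\<And>n. s (Suc n) o\<^sub>L s n = s (Suc n)) \<Longrightarrow>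
       (\<And>x. (\<lambda>n. blinfun_apply (s n) x) \<longlonglongrightarrow> blinfun_apply l x) \<Longrightarrow> l \<in> L"
begin

lemma L_apply: "f \<in> L \<Longrightarrow> f (f x) = f x" "f \<in> L \<Longrightarrow> g \<in> L \<Longrightarrow> f (g x) = g (f x)"
  using L_proj L_comm by (metis blinfun_apply_blinfun_compose)+

lemma L_norm: "f \<in> L \<Longrightarrow> norm (f x) \<le> norm x"
  using L_proj projection_contraction by blast

text \<open>
  \<open>f\<close> is the limit of the partial products. The last bound says that a vector almost fixed by all members is
  almost fixed by the infimum.
\<close>

lemma countable_inf:
  fixes s :: "nat \<Rightarrow> 'h operator"
  assumes s: "\<And>n. s n \<in> L"
  obtains f where "f \<in> L" "\<And>n x. f (s n x) = f x" "\<And>x. (\<And>n. s n x = x) \<Longrightarrow> f x = x"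
    "\<And>x c. (\<And>n. (\<Sum>k<n. norm (x - s k x)) \<le> c) \<Longrightarrow> norm (x - f x) \<le> c"
proof -
  define p where "p = rec_nat id_blinfun (\<lambda>n q. s n o\<^sub>L q)"
  have p0: "p 0 = id_blinfun" and pS: "p (Suc n) = s n o\<^sub>L p n" for n by (auto simp: p_def)
  have pL: "p n \<in> L" for n by (induction n) (auto simp: p0 pS L_id L_prod s)
  have dec: "psd (p n - p (Suc n))" for n
    using commuting_projections_product(3)[of "p n" "s n"] L_proj[OF pL[of n]] L_proj[OF s[of n]]
      L_comm[OF pL s, of n n] by (simp add: pS)
  define q where "q = (\<lambda>n. id_blinfun - p n)"
  have q: "psd (q (Suc n) - q n)" "psd (q n)" "psd (id_blinfun - q n)" for n
    using dec[of n] projection_psd(1,2)[of "p n"] L_proj[OF pL[of n]] by (auto simp: q_def)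
  obtain l :: "'h operator" where l: "\<And>x. (\<lambda>n. q n x) \<longlonglongrightarrow> blinfun_apply l x"
    using monotone_strong_limit[of q, OF q] by metis
  define f where "f = id_blinfun - l"
  have lim: "(\<lambda>n. p n x) \<longlonglongrightarrow> f x" for x
  proof -
    have "(\<lambda>n. x - q n x) \<longlonglongrightarrow> x - l x" by (intro tendsto_intros l)
    then show ?thesis by (simp add: q_def f_def blinfun.diff_left)
  qed
  have fL: "f \<in> L"
  proof (rule L_lim[OF pL _ lim])
    show "p (Suc n) o\<^sub>L p n = p (Suc n)" for n
      by (rule blinfun_eqI) (simp add: pS L_apply(1)[OF pL])
  qed
  have absorb: "p m (s n x) = p m x" if "n < m" for m n x
    using that
  proof (induction m)
    case (Suc m)
    show ?case
    proof (cases "n = m")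
      case True
      then show ?thesis by (simp add: pS L_apply(2)[OF pL s, symmetric] L_apply(1)[OF s])
    qed (use Suc in \<open>auto simp: pS\<close>)
  qed simp
  have a: "f (s n x) = f x" for n x
  proof (rule LIMSEQ_unique[OF lim])
    show "(\<lambda>m. p m (s n x)) \<longlonglongrightarrow> f x"
      by (rule Lim_transform_eventually[OF lim]) (auto intro!: eventually_sequentiallyI[of "Suc n"] simp: absorb)
  qed
  have b: "norm (x - f x) \<le> c" if c: "\<And>n. (\<Sum>k<n. norm (x - s k x)) \<le> c" for x c
  proof (rule LIMSEQ_le_const2)
    show "(\<lambda>n. norm (x - p n x)) \<longlonglongrightarrow> norm (x - f x)" by (intro tendsto_intros lim)
    have "norm (x - p n x) \<le> (\<Sum>k<n. norm (x - s k x))" for n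
    proof (induction n)
      case (Suc n)
      have "x - p (Suc n) x = (x - s n x) + s n (x - p n x)" by (simp add: pS blinfun.diff_right)
      then have "norm (x - p (Suc n) x) \<le> norm (x - s n x) + norm (s n (x - p n x))"
        by (metis norm_triangle_ineq)
      also have "\<dots> \<le> norm (x - s n x) + norm (x - p n x)" using L_norm[OF s] by simp
      finally show ?case using Suc by simp
    qed (simp add: p0)
    then show "\<exists>N. \<forall>n\<ge>N. norm (x - p n x) \<le> c" using c order_trans by blast
  qed
  have "f x = x" if "\<And>n. s n x = x" for x using b[of x 0] that by simp
  with that fL a b show ?thesis by blast
qed

text \<open>
  Among the members of \<open>L\<close> fixing \<open>W\<close> pick a sequence whose traces approach the infimum. The product of its
  infimum \<open>g\<close> with any other such member has no smaller trace, so it equals \<open>g\<close>.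
\<close>

lemma least_fixing:
  fixes W :: "'h set"
  obtains g where "g \<in> L" "\<And>x. x \<in> W \<Longrightarrow> g x = x" "\<And>f x. f \<in> L \<Longrightarrow> (\<And>x. x \<in> W \<Longrightarrow> f x = x) \<Longrightarrow> g (f x) = g x"
proof -
  define K where "K = {f \<in> L. \<forall>x\<in>W. f x = x}"
  have ne: "tr ` K \<noteq> {}" using L_id by (auto simp: K_def)
  have bdd: "bdd_below (tr ` K)"
    using L_M L_proj by (auto simp: K_def bdd_below_def intro!: exI[of _ 0] tr_pos projection_psd(1))
  have "\<exists>f\<in>K. tr f < Inf (tr ` K) + inverse (of_nat (Suc n))" for n
    using cInf_lessD[OF ne, of "Inf (tr ` K) + inverse (of_nat (Suc n))"] by auto
  then obtain s where sK: "\<And>n. s n \<in> K" and str: "\<And>n. tr (s n) < Inf (tr ` K) + inverse (of_nat (Suc n))" by metis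
  have sL: "s n \<in> L" for n using sK by (simp add: K_def)
  obtain g where g: "g \<in> L" "\<And>n x. g (s n x) = g x" "\<And>x. (\<And>n. s n x = x) \<Longrightarrow> g x = x"
    using countable_inf[of s, OF sL] by metis
  have gW: "g x = x" if "x \<in> W" for x using g(3) sK that by (auto simp: K_def)
  have gM: "g \<in> M" "s n \<in> M" for n using g sL L_M by auto
  have "tr g \<le> tr (s n)" for n
  proof -
    have "s n o\<^sub>L g = g" by (rule blinfun_eqI) (simp add: L_apply(2)[OF sL g(1)] g(2))
    then have "psd (s n - g)"
      using commuting_projections_product(3)[of "s n" g] L_proj[OF g(1)] L_proj[OF sL[of n]] L_comm[OF sL g(1), of n] by simp
    then show ?thesis using gM by (intro tr_mono)
  qed
  then have "tr g \<le> Inf (tr ` K) + inverse (of_nat (Suc n))" for n using str by (meson less_imp_le order_trans)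
  moreover have "(\<lambda>n. Inf (tr ` K) + inverse (of_nat (Suc n))) \<longlonglongrightarrow> Inf (tr ` K) + 0"
    by (intro tendsto_intros LIMSEQ_inverse_real_of_nat)
  ultimately have inf: "tr g \<le> Inf (tr ` K) + 0" by (intro LIMSEQ_le_const) auto
  have "g (f x) = g x" if f: "f \<in> L" "\<And>x. x \<in> W \<Longrightarrow> f x = x" for f x
  proof -
    have gf: "g o\<^sub>L f \<in> K" using f gW L_prod[OF g(1)] by (auto simp: K_def)
    have gfM: "g o\<^sub>L f \<in> M" using gf L_M by (auto simp: K_def)
    have "Inf (tr ` K) \<le> tr (g o\<^sub>L f)" using bdd gf by (intro cInf_lower) auto
    then have "tr (g - (g o\<^sub>L f)) \<le> 0" using inf gM gfM by (simp add: tr_simps)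
    moreover have p: "psd (g - (g o\<^sub>L f))"
      using commuting_projections_product(3)[of g f] L_proj[OF g(1)] L_proj[OF f(1)] L_comm[OF g(1) f(1)] by simp
    ultimately have "tr (g - (g o\<^sub>L f)) = 0" using tr_pos[of "g - (g o\<^sub>L f)"] gM gfM by fastforce
    then have "g - (g o\<^sub>L f) = 0" using p gM gfM by (intro tr_faithful) auto
    then show ?thesis by (metis blinfun_apply_blinfun_compose eq_iff_diff_eq_0)
  qed
  with that g(1) gW show ?thesis by blast
qed

text \<open>
  A substitute for the density theorem, in which approximation at single vectors suffices. If \<open>x\<close> is in
  the range of \<open>e\<close> and \<open>y\<close> in its kernel, approximation at \<open>x + y\<close> and a limit inferior give a member of \<open>L\<close> that
  fixes \<open>x\<close> and annihilates \<open>y\<close>. Hence the least member of \<open>L\<close> fixing \<open>y\<close> annihilates the whole range of \<open>e\<close>, and its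
  complement is above the least member \<open>q\<close> fixing that range. So \<open>q\<close> annihilates the kernel of \<open>e\<close>, that is,
  \<open>q = e\<close>.
\<close>

lemma pointwise_approximable_projection_mem:
  assumes e: "symmetric_op e" "e o\<^sub>L e = e" and comm: "\<And>f. f \<in> L \<Longrightarrow> e o\<^sub>L f = f o\<^sub>L e"
    and approx: "\<And>z. e z \<in> closure ((\<lambda>f. blinfun_apply f z) ` L)"
  shows "e \<in> L"
proof -
  have ee: "e (e x) = e x" for x using e(2) by (metis blinfun_apply_blinfun_compose)
  have ef: "e (f x) = f (e x)" if "f \<in> L" for f x using comm[OF that] by (metis blinfun_apply_blinfun_compose)
  have sep: "\<exists>f\<in>L. f x = x \<and> f y = 0" if x: "e x = x" and y: "e y = 0" for x y
  proof -
    have "\<exists>f\<in>L. norm (f (x + y) - x) < (1/2)^k" for k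
    proof -
      have "x \<in> closure ((\<lambda>f. blinfun_apply f (x + y)) ` L)" using approx[of "x + y"] x y by (simp add: blinfun.add_right)
      then show ?thesis unfolding closure_approachable dist_norm by (metis (no_types, lifting) imageE zero_less_divide_1_iff zero_less_numeral zero_less_power)
    qed
    then obtain g where gL: "\<And>k. g k \<in> L" and g: "\<And>k. norm (g k (x + y) - x) < (1/2)^k" by metis
    have gx: "norm (x - g k x) \<le> (1/2)^k" for k
    proof -
      have "x - g k x = - e (g k (x + y) - x)"
        by (simp add: blinfun.diff_right ef[OF gL] x y blinfun.add_right)
      then have "norm (x - g k x) \<le> norm (g k (x + y) - x)"
        using projection_contraction[OF e] by (metis norm_minus_cancel)
      then show ?thesis using g[of k] by linarith
    qed
    have gy: "norm (g k y) \<le> 2 * (1/2)^k" for k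
    proof -
      have "g k y = (g k (x + y) - x) + (x - g k x)" by (simp add: blinfun.add_right)
      then have "norm (g k y) \<le> norm (g k (x + y) - x) + norm (x - g k x)" by (metis norm_triangle_ineq)
      then show ?thesis using g[of k] gx[of k] by linarith
    qed
    have null: "(\<lambda>k. 2 * (1/2::real)^k) \<longlonglongrightarrow> 2 * 0" by (intro tendsto_intros LIMSEQ_power_zero) simp
    \<comment> \<open>The infimum of \<open>g m\<close>, \<open>g (m + 1)\<close>, \<dots> moves \<open>x\<close> little, and annihilates \<open>y\<close> because it absorbs every \<open>g n\<close> with \<open>n \<ge> m\<close>.\<close>
    have "\<exists>h\<in>L. norm (x - h x) \<le> 2 * (1/2)^m \<and> h y = 0" for m
    proof -
      obtain h where h: "h \<in> L" "\<And>n x. h (g (m + n) x) = h x"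
        "\<And>x c. (\<And>n. (\<Sum>k<n. norm (x - g (m + k) x)) \<le> c) \<Longrightarrow> norm (x - h x) \<le> c"
        using countable_inf[of "\<lambda>n. g (m + n)"] gL by metis
      have "norm (x - h x) \<le> 2 * (1/2)^m"
      proof (rule h(3))
        fix n
        have "(\<Sum>k<n. norm (x - g (m + k) x)) \<le> (\<Sum>k<n. (1/2)^(m + k))" by (intro sum_mono gx)
        also have "\<dots> = 2 * ((1/2)^m - (1/2)^(m + n))" by (induction n) simp_all
        also have "\<dots> \<le> 2 * (1/2)^m" by simp
        finally show "(\<Sum>k<n. norm (x - g (m + k) x)) \<le> 2 * (1/2)^m" .
      qed
      moreover have "norm (h y) \<le> 2 * 0"
      proof (rule LIMSEQ_le_const[OF null])
        have "norm (h y) \<le> 2 * (1/2)^n" if "n \<ge> m" for n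
        proof -
          have "h y = h (g n y)" using h(2)[of "n - m" y] that by simp
          then show ?thesis using L_norm[OF h(1), of "g n y"] gy[of n] by simp
        qed
        then show "\<exists>N. \<forall>n\<ge>N. norm (h y) \<le> 2 * (1/2)^n" by blast
      qed
      ultimately show ?thesis using h(1) by auto
    qed
    then obtain h where hL: "\<And>m. h m \<in> L" and hx: "\<And>m. norm (x - h m x) \<le> 2 * (1/2)^m" and hy: "\<And>m. h m y = 0" by metis
    obtain c where c: "c \<in> L" "\<And>n x. c ((id_blinfun - h n) x) = c x"
      "\<And>x. (\<And>n. (id_blinfun - h n) x = x) \<Longrightarrow> c x = x"
      using countable_inf[of "\<lambda>n. id_blinfun - h n"] hL L_compl by metis
    have cy: "c y = y" using c(3) hy by (simp add: blinfun.diff_left)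
    have "norm (c x) \<le> 2 * 0"
    proof (rule LIMSEQ_le_const[OF null])
      have "norm (c x) \<le> 2 * (1/2)^n" for n
        using c(2)[of n x] L_norm[OF c(1), of "x - h n x"] hx[of n] by (simp add: blinfun.diff_left)
      then show "\<exists>N. \<forall>n\<ge>N. norm (c x) \<le> 2 * (1/2)^n" by blast
    qed
    then have "(id_blinfun - c) x = x" "(id_blinfun - c) y = 0" using cy by (auto simp: blinfun.diff_left)
    then show ?thesis using L_compl[OF c(1)] by blast
  qed
  obtain q where q: "q \<in> L" "\<And>x. x \<in> range e \<Longrightarrow> q x = x"
    "\<And>f x. f \<in> L \<Longrightarrow> (\<And>x. x \<in> range e \<Longrightarrow> f x = x) \<Longrightarrow> q (f x) = q x"
    using least_fixing[of "range e"] by metis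
  have qy: "q y = 0" if y: "e y = 0" for y
  proof -
    obtain p where p: "p \<in> L" "\<And>x. x \<in> {y} \<Longrightarrow> p x = x"
      "\<And>f x. f \<in> L \<Longrightarrow> (\<And>x. x \<in> {y} \<Longrightarrow> f x = x) \<Longrightarrow> p (f x) = p x"
      using least_fixing[of "{y}"] by metis
    have py: "p y = y" using p(2) by simp
    have "(id_blinfun - p) x = x" if "x \<in> range e" for x
    proof -
      have "e x = x" using that ee by auto
      then obtain f where f: "f \<in> L" "f x = x" "f y = 0" using sep y by blast
      have "p ((id_blinfun - f) x) = p x"
        by (rule p(3)[OF L_compl[OF f(1)]]) (simp add: blinfun.diff_left f)
      then show ?thesis by (simp add: blinfun.diff_left f)
    qed
    from q(3)[OF L_compl[OF p(1)] this, of y] show ?thesis by (simp add: blinfun.diff_left py)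
  qed
  have "q x = e x" for x
  proof -
    have "q (x - e x) = 0" by (rule qy) (simp add: blinfun.diff_right ee)
    then show ?thesis using q(2)[of "e x"] by (simp add: blinfun.diff_right)
  qed
  then have "q = e" by (rule blinfun_eqI)
  then show ?thesis using q(1) by simp
qed

end

section \<open>The algebra generated by a tree of projections\<close>

definition words :: "nat \<Rightarrow> bool list set" where "words n = {w. length w = n}"

lemma finite_words [simp]: "finite (words n)"
  using finite_lists_length_eq[of "UNIV :: bool set" n] by (simp add: words_def)

lemma words_0 [simp]: "words 0 = {[]}" by (auto simp: words_def)

lemma sum_words_Suc:
  fixes f :: "bool list \<Rightarrow> 'a::comm_monoid_add"
  shows "(\<Sum>w\<in>words (Suc n). f w) = (\<Sum>w\<in>words n. f (True # w) + f (False # w))"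
proof -
  have w: "words (Suc n) = Cons True ` words n \<union> Cons False ` words n"
    by (auto simp: words_def length_Suc_conv image_iff)
  have "(\<Sum>w\<in>words (Suc n). f w) = (\<Sum>w\<in>Cons True ` words n. f w) + (\<Sum>w\<in>Cons False ` words n. f w)"
    unfolding w by (rule sum.union_disjoint) auto
  also have "\<dots> = (\<Sum>w\<in>words n. f (True # w)) + (\<Sum>w\<in>words n. f (False # w))"
    by (simp add: sum.reindex inj_on_def)
  finally show ?thesis by (simp add: sum.distrib)
qed

text \<open>
  The node \<open>P w\<close> is the sum of its two children \<open>P (True # w)\<close> and \<open>P (False # w)\<close>: a word lists the
  choices of a branch from the leaf to the root, so that extending a branch is \<open>Cons\<close>.
\<close>

locale projection_tree = tracial_algebra M \<tau> for M :: "'h::complex_hilbert operator set" and \<tau> +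
  fixes P :: "bool list \<Rightarrow> 'h operator"
  assumes P_M: "P w \<in> M" and P_sym: "symmetric_op (P w)" and P_idem: "P w o\<^sub>L P w = P w"
    and P_Nil: "P [] = id_blinfun" and P_split: "P (True # w) + P (False # w) = P w"
    and P_below: "P w o\<^sub>L P (b # w) = P (b # w)"
begin

lemma P_below': "P w (P (b # w) x) = P (b # w) x" "P (b # w) (P w x) = P (b # w) x"
proof -
  show 1: "P w (P (b # w) x) = P (b # w) x" for x using P_below by (metis blinfun_apply_blinfun_compose)
  have "inner y (P (b # w) (P w x)) = inner y (P (b # w) x)" for y
    using symmetric_opD[OF P_sym, of "b # w" y "P w x"] symmetric_opD[OF P_sym, of w "P (b # w) y" x]
      symmetric_opD[OF P_sym, of "b # w" y x] 1[of y] by simp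
  then show "P (b # w) (P w x) = P (b # w) x" by (metis vector_eq_ldot)
qed

lemma PP: "P w (P w x) = P w x" using P_idem by (metis blinfun_apply_blinfun_compose)

lemma P_sum_apply: "P (True # w) x + P (False # w) x = P w x"
  using P_split[of w] by (metis blinfun.add_left)

lemma siblings: "b \<noteq> c \<Longrightarrow> P (b # w) (P (c # w) x) = 0"
proof -
  assume "b \<noteq> c"
  then have "P (b # w) y + P (c # w) y = P w y" for y using P_sum_apply[of w y] by (cases b; cases c) (auto simp: add.commute)
  from this[of "P (c # w) x"] show ?thesis by (simp add: P_below' PP)
qed

lemma orthogonal: "length v = length w \<Longrightarrow> v \<noteq> w \<Longrightarrow> P v (P w x) = 0"
proof (induction v arbitrary: w x)
  case (Cons b v)
  then obtain c w' where w: "w = c # w'" by (cases w) auto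
  show ?case
  proof (cases "v = w'")
    case True
    then show ?thesis using Cons.prems siblings w by auto
  next
    case False
    then have "P v (P w' y) = 0" for y using Cons w by simp
    then have "P (b # v) (P v (P w' (P (c # w') x))) = 0" by simp
    then show ?thesis by (simp add: w P_below')
  qed
qed simp

lemma partition_of_unity: "(\<Sum>w\<in>words n. P w) = id_blinfun"
  by (induction n) (simp_all add: P_Nil sum_words_Suc P_split)

definition F :: "bool list set \<Rightarrow> 'h operator" where "F J = (\<Sum>w\<in>J. P w)"

lemma F_apply: "F J x = (\<Sum>w\<in>J. P w x)" by (simp add: F_def blinfun.sum_left)

lemma F_M: "F J \<in> M" by (simp add: F_def sum_closed P_M)

lemma F_sym: "symmetric_op (F J)"
  unfolding F_def by (induction J rule: infinite_finite_induct) (auto simp: P_sym)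

lemma P_sum:
  assumes "J \<subseteq> words n" "v \<in> words n"
  shows "P v (\<Sum>w\<in>J. scaleC (c w) (P w x)) = (if v \<in> J then scaleC (c v) (P v x) else 0)"
proof -
  have cl: "P v (scaleC a y) = scaleC a (P v y)" for a y by (rule clinear_scaleC[OF clinear[OF P_M]])
  have fJ: "finite J" using finite_subset[OF assms(1) finite_words] .
  have "P v (\<Sum>w\<in>J. scaleC (c w) (P w x)) = (\<Sum>w\<in>J. if w = v then scaleC (c v) (P v x) else 0)"
    unfolding blinfun.sum_right
    by (intro sum.cong) (use assms in \<open>auto simp: cl PP orthogonal words_def\<close>)
  also have "\<dots> = (if v \<in> J then scaleC (c v) (P v x) else 0)" using fJ by simp
  finally show ?thesis .
qed

lemma P_F: "J \<subseteq> words n \<Longrightarrow> v \<in> words n \<Longrightarrow> P v (F J x) = (if v \<in> J then P v x else 0)"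
  using P_sum[of J n v "\<lambda>_. 1" x] by (simp add: F_apply)

lemma F_prod:
  assumes "J \<subseteq> words n" "K \<subseteq> words n" shows "F J o\<^sub>L F K = F (J \<inter> K)"
proof (rule blinfun_eqI)
  fix x
  have fJ: "finite J" using finite_subset[OF assms(1) finite_words] .
  have "F J (F K x) = (\<Sum>v\<in>J. if v \<in> K then P v x else 0)"
    unfolding F_apply[of J] by (intro sum.cong P_F[OF assms(2)]) (use assms in auto)
  also have "\<dots> = F (J \<inter> K) x" unfolding F_apply using fJ by (simp add: sum.inter_restrict)
  finally show "(F J o\<^sub>L F K) x = F (J \<inter> K) x" by simp
qed

lemma F_idem: "J \<subseteq> words n \<Longrightarrow> F J o\<^sub>L F J = F J" using F_prod[of J n J] by simp

lemma F_compl: "J \<subseteq> words n \<Longrightarrow> id_blinfun - F J = F (words n - J)"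
  unfolding F_def partition_of_unity[symmetric, of n] by (simp add: sum_diff)

text \<open>
  Splitting every node of a level \<open>k\<close> times rewrites a combination of that level on a finer level;
  \<open>drop k w\<close> is the ancestor of \<open>w\<close> on the coarse level.
\<close>

lemma sum_lift: "(\<Sum>w\<in>words (k + n). scaleC (c (drop k w)) (P w x)) = (\<Sum>w\<in>words n. scaleC (c w) (P w x))"
proof (induction k)
  case (Suc k)
  have "(\<Sum>w\<in>words (Suc (k + n)). scaleC (c (drop (Suc k) w)) (P w x))
    = (\<Sum>w\<in>words (k + n). scaleC (c (drop k w)) (P w x))"
    by (simp add: sum_words_Suc scaleC_add_right[symmetric] P_sum_apply)
  then show ?case using Suc by simp
qed simp

lemma F_lift:
  assumes "J \<subseteq> words n" shows "F J = F {w \<in> words (k + n). drop k w \<in> J}"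
proof (rule blinfun_eqI)
  fix x
  have e: "F {w \<in> words m. Q w} x = (\<Sum>w\<in>words m. scaleC (if Q w then 1 else 0) (P w x))" for m Q
  proof -
    have "F {w \<in> words m. Q w} x = (\<Sum>w\<in>{w \<in> words m. Q w}. P w x)" by (simp add: F_apply)
    also have "\<dots> = (\<Sum>w\<in>words m. if Q w then P w x else 0)" by (rule sum.inter_filter) simp
    also have "\<dots> = (\<Sum>w\<in>words m. scaleC (if Q w then 1 else 0) (P w x))"
      using scaleC_of_real[of 0] by (intro sum.cong) auto
    finally show ?thesis .
  qed
  have "J = {w \<in> words n. w \<in> J}" using assms by auto
  then have "F J x = F {w \<in> words n. w \<in> J} x" by simp
  then show "F J x = F {w \<in> words (k + n). drop k w \<in> J} x"
    unfolding e using sum_lift[where c="\<lambda>w. if w \<in> J then 1 else 0" and k=k and n=n and x=x] by simp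
qed

lemma common_level:
  assumes "J \<subseteq> words m" "K \<subseteq> words n"
  obtains p J' K' where "J' \<subseteq> words p" "K' \<subseteq> words p" "F J = F J'" "F K = F K'"
proof -
  have "F J = F {w \<in> words (m + n). drop n w \<in> J}" using F_lift[OF assms(1), of n] by (simp add: add.commute)
  moreover have "F K = F {w \<in> words (m + n). drop m w \<in> K}" by (rule F_lift[OF assms(2)])
  ultimately show ?thesis using that[of _ "m + n"] by (metis (no_types, lifting) mem_Collect_eq subsetI)
qed

lemma P_eq_F: "P w = F {w}" by (simp add: F_def)

lemma P_commute: "P v o\<^sub>L P w = P w o\<^sub>L P v"
proof -
  have "{v} \<subseteq> words (length v)" "{w} \<subseteq> words (length w)" by (auto simp: words_def)
  then obtain p J K where JK: "J \<subseteq> words p" "K \<subseteq> words p" and e: "F {v} = F J" "F {w} = F K"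
    by (rule common_level)
  have "F J o\<^sub>L F K = F K o\<^sub>L F J" using F_prod[OF JK] F_prod[OF JK(2,1)] by (simp add: Int_commute)
  then show ?thesis using e P_eq_F[of v] P_eq_F[of w] by metis
qed

definition A :: "'h operator set" where "A = commutant (commutant (range P))"

lemma P_clinear: "clinear_op (P w)" using clinear P_M by blast

lemma P_adj: "adj (P w) = P w" using symmetric_iff[OF P_M] P_sym by blast

lemma vn_A: "vn_algebra A" and P_A: "P w \<in> A"
proof -
  note d = von_neumann_algebra_double_commutant[of "range P"]
  show "vn_algebra A" unfolding A_def by (rule vn_algebra.intro, rule d(1)) (auto simp: P_clinear P_adj)
  have "range P \<subseteq> A" unfolding A_def by (rule d(2)) (auto simp: P_clinear P_adj)
  then show "P w \<in> A" by auto
qed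

lemma A_sub: "A \<subseteq> M"
proof -
  have "range P \<subseteq> M" using P_M by auto
  then have "A \<subseteq> commutant (commutant M)" unfolding A_def by (intro commutant_antimono)
  then show ?thesis using vn by (simp add: von_neumann_algebra_def)
qed

lemma A_comm: "X \<in> A \<Longrightarrow> Y \<in> A \<Longrightarrow> X o\<^sub>L Y = Y o\<^sub>L X"
proof -
  assume X: "X \<in> A" and Y: "Y \<in> A"
  have "range P \<subseteq> commutant (range P)" using P_commute P_clinear by (auto simp: commutant_def)
  then have "A \<subseteq> commutant (range P)" unfolding A_def by (rule commutant_antimono)
  then have "Y \<in> commutant (range P)" using Y by auto
  then show ?thesis using X unfolding A_def[of] by (auto dest: commutantD)
qed

sublocale A: abelian_subalgebra M \<tau> A
  by (intro abelian_subalgebra.intro abelian_subalgebra_axioms.intro vn_A tracial_algebra_axioms A_sub A_comm)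

text \<open>
  A minimal projection is below one node on every level, so its trace is zero.
\<close>

lemma A_no_minimal:
  assumes small: "\<And>w. tr (P w) \<le> 2 * (1/2) ^ length w"
  shows "\<not> minimal_projection A Q"
proof
  assume m: "minimal_projection A Q"
  then have QA: "Q \<in> A" and Q0: "Q \<noteq> 0" and Qp: "symmetric_op Q" "Q o\<^sub>L Q = Q"
    by (auto simp: minimal_projection_def A.A.projection_iff)
  have QM: "Q \<in> M" using QA A_sub by auto
  have "tr Q \<le> 2 * (1/2)^n" for n
  proof -
    have "\<exists>w\<in>words n. Q o\<^sub>L P w \<noteq> 0"
    proof (rule ccontr)
      assume "\<not> ?thesis"
      then have z: "Q (P w x) = 0" if "w \<in> words n" for w x
        using that by (metis blinfun_apply_blinfun_compose zero_blinfun.rep_eq)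
      have "Q x = Q ((\<Sum>w\<in>words n. P w) x)" for x by (simp add: partition_of_unity)
      then have "Q x = 0" for x by (simp add: z blinfun.sum_left blinfun.sum_right)
      then show False using Q0 by (auto intro: blinfun_eqI)
    qed
    then obtain w where w: "w \<in> words n" "Q o\<^sub>L P w \<noteq> 0" by auto
    note cp = commuting_projections_product[OF Qp P_sym P_idem A_comm[OF QA P_A], of w]
    have QP: "Q o\<^sub>L P w \<in> A" using QA P_A by auto
    have "is_projection (Q o\<^sub>L P w)" using cp QP by (simp add: A.A.projection_iff)
    moreover have "op_le (Q o\<^sub>L P w) Q" using cp(3) QA QP by (auto simp: op_le_def A.A.positive_iff A.A.mem_intros)
    ultimately have "Q o\<^sub>L P w = Q" using m QP w(2) unfolding minimal_projection_def by blast
    then have "P w o\<^sub>L Q = Q" using A_comm[OF QA P_A] by simp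
    then have "psd (P w - Q)"
      using commuting_projections_product(3)[OF P_sym P_idem Qp A_comm[OF P_A QA], of w] by simp
    then have "tr Q \<le> tr (P w)" using QM P_M by (intro tr_mono)
    then show ?thesis using small[of w] w(1) by (simp add: words_def)
  qed
  moreover have "(\<lambda>n. 2 * (1/2::real)^n) \<longlonglongrightarrow> 2 * 0" by (intro tendsto_intros LIMSEQ_power_zero) simp
  ultimately have "tr Q \<le> 2 * 0" by (intro LIMSEQ_le_const) blast+
  then have "tr Q = 0" using tr_pos[OF QM projection_psd(1)[OF Qp]] by simp
  then show False using Q0 tr_faithful[OF QM projection_psd(1)[OF Qp]] by blast
qed

end

context projection_tree
begin

lemma F_A: "F J \<in> A" by (simp add: F_def A.A.sum_closed P_A)

text \<open>
  The projections of \<open>A\<close> that are 2-norm limits of sums of nodes. They turn out to be all projections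
  of \<open>A\<close> (\<open>projection_mem_L\<close>).
\<close>

definition L :: "'h operator set" where
  "L = {f \<in> A. symmetric_op f \<and> f o\<^sub>L f = f \<and>
     (\<forall>\<epsilon>>0. \<exists>n J. J \<subseteq> words n \<and> tr ((f - F J) o\<^sub>L (f - F J)) < \<epsilon>)}"

lemma LD: "f \<in> L \<Longrightarrow> f \<in> A" "f \<in> L \<Longrightarrow> symmetric_op f" "f \<in> L \<Longrightarrow> f o\<^sub>L f = f" "f \<in> L \<Longrightarrow> f \<in> M"
  "f \<in> L \<Longrightarrow> \<epsilon> > 0 \<Longrightarrow> \<exists>n J. J \<subseteq> words n \<and> tr ((f - F J) o\<^sub>L (f - F J)) < \<epsilon>"
  using A_sub by (auto simp: L_def)

lemma tr_square_add_le:
  assumes "X \<in> Msa" "Y \<in> Msa"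
  shows "tr ((X + Y) o\<^sub>L (X + Y)) \<le> 2 * tr (X o\<^sub>L X) + 2 * tr (Y o\<^sub>L Y)"
  using l2.parallelogram[OF assms] l2.B_nonneg[of "X - Y"] assms by simp

text \<open>
  \<open>X\<^sup>2 - (X p)\<^sup>2 = X (1 - p) X\<close> is positive.
\<close>

lemma tr_square_compress_le:
  assumes X: "X \<in> A" "symmetric_op X" and p: "p \<in> A" "symmetric_op p" "p o\<^sub>L p = p"
  shows "X o\<^sub>L p \<in> Msa" "tr ((X o\<^sub>L p) o\<^sub>L (X o\<^sub>L p)) \<le> tr (X o\<^sub>L X)"
proof -
  have M: "X \<in> M" "p \<in> M" using X p A_sub by auto
  have c: "p (X x) = X (p x)" for x using A_comm[OF p(1) X(1)] by (metis blinfun_apply_blinfun_compose)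
  show m: "X o\<^sub>L p \<in> Msa"
    using symmetric_op_compose[OF X(2) p(2) A_comm[OF X(1) p(1)]] M by (auto simp: Msa_def)
  have "(X o\<^sub>L X) - ((X o\<^sub>L p) o\<^sub>L (X o\<^sub>L p)) = X o\<^sub>L (id_blinfun - p) o\<^sub>L X"
    by (rule blinfun_eqI) (simp add: blinfun.bilinear_simps c projection_psd(3)[OF p(2,3)])
  then have "psd ((X o\<^sub>L X) - ((X o\<^sub>L p) o\<^sub>L (X o\<^sub>L p)))"
    using psd_conj[OF projection_psd(2)[OF p(2,3)] X(2)] by simp
  then show "tr ((X o\<^sub>L p) o\<^sub>L (X o\<^sub>L p)) \<le> tr (X o\<^sub>L X)" using M by (intro tr_mono) auto
qed

lemma F_in_L: "J \<subseteq> words n \<Longrightarrow> F J \<in> L"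
  unfolding L_def using F_A F_sym F_idem
  by (auto simp: tr_simps intro!: exI[of _ n] exI[of _ J])

lemma L_id: "id_blinfun \<in> L"
  using F_in_L[of "{[]}" 0] by (simp add: F_def P_Nil)

lemma L_compl:
  assumes f: "f \<in> L" shows "id_blinfun - f \<in> L"
proof -
  have ff: "f (f x) = f x" for x by (rule projection_psd(3)[OF LD(2,3)[OF f]])
  have "(id_blinfun - f) o\<^sub>L (id_blinfun - f) = id_blinfun - f"
    by (rule blinfun_eqI) (simp add: blinfun.bilinear_simps ff)
  moreover have "\<exists>n J. J \<subseteq> words n \<and> tr ((id_blinfun - f - F J) o\<^sub>L (id_blinfun - f - F J)) < \<epsilon>" if eps: "\<epsilon> > 0" for \<epsilon>
  proof -
    obtain n J where J: "J \<subseteq> words n" "tr ((f - F J) o\<^sub>L (f - F J)) < \<epsilon>" using LD(5)[OF f eps] by blast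
    have e: "id_blinfun - f - F (words n - J) = - (f - F J)" using F_compl[OF J(1), symmetric] by simp
    have neg: "(- Z) o\<^sub>L (- Z) = Z o\<^sub>L Z" for Z :: "'h operator"
      by (rule blinfun_eqI) (simp add: blinfun.bilinear_simps)
    show ?thesis using J(2) by (intro exI[of _ n] exI[of _ "words n - J"]) (simp only: e neg Diff_subset simp_thms)
  qed
  moreover have "id_blinfun - f \<in> A" "symmetric_op (id_blinfun - f)" using LD(1,2)[OF f] by auto
  ultimately show ?thesis unfolding L_def by blast
qed

lemma L_prod:
  assumes f: "f \<in> L" and g: "g \<in> L" shows "f o\<^sub>L g \<in> L"
proof -
  note cp = commuting_projections_product[OF LD(2,3)[OF f] LD(2,3)[OF g] A_comm[OF LD(1)[OF f] LD(1)[OF g]]]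
  have "\<exists>n J. J \<subseteq> words n \<and> tr (((f o\<^sub>L g) - F J) o\<^sub>L ((f o\<^sub>L g) - F J)) < \<epsilon>" if eps: "\<epsilon> > 0" for \<epsilon>
  proof -
    obtain n' J' where J': "J' \<subseteq> words n'" "tr ((f - F J') o\<^sub>L (f - F J')) < \<epsilon>/4" using LD(5)[OF f, of "\<epsilon>/4"] eps by auto
    obtain m' K' where K': "K' \<subseteq> words m'" "tr ((g - F K') o\<^sub>L (g - F K')) < \<epsilon>/4" using LD(5)[OF g, of "\<epsilon>/4"] eps by auto
    obtain n J K where JK: "J \<subseteq> words n" "K \<subseteq> words n" "F J' = F J" "F K' = F K"
      using common_level[OF J'(1) K'(1)] .
    define X where "X = f - F J"
    define Y where "Y = g - F K"
    have X: "X \<in> A" "symmetric_op X" and Y: "Y \<in> A" "symmetric_op Y"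
      using LD(1,2)[OF f] LD(1,2)[OF g] F_A F_sym by (auto simp: X_def Y_def)
    note c1 = tr_square_compress_le[OF X LD(1-3)[OF g]]
    note c2 = tr_square_compress_le[OF Y F_A F_sym F_idem[OF JK(1)]]
    have YF: "Y (F J x) = F J (Y x)" for x using A_comm[OF Y(1) F_A] by (metis blinfun_apply_blinfun_compose)
    have "(f o\<^sub>L g) - F (J \<inter> K) = (X o\<^sub>L g) + (Y o\<^sub>L F J)"
      unfolding F_prod[OF JK(1,2), symmetric]
      by (rule blinfun_eqI) (simp add: blinfun.add_left YF, simp add: X_def Y_def blinfun.bilinear_simps)
    then have "tr (((f o\<^sub>L g) - F (J \<inter> K)) o\<^sub>L ((f o\<^sub>L g) - F (J \<inter> K))) \<le> 2 * tr (X o\<^sub>L X) + 2 * tr (Y o\<^sub>L Y)"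
      using tr_square_add_le[OF c1(1) c2(1)] c1(2) c2(2) by simp
    also have "\<dots> < \<epsilon>" using J'(2) K'(2) by (simp add: X_def Y_def JK)
    finally show ?thesis using JK by (intro exI[of _ n] exI[of _ "J \<inter> K"]) auto
  qed
  moreover have "f o\<^sub>L g \<in> A" using LD(1)[OF f] LD(1)[OF g] by auto
  ultimately show ?thesis using cp(1,2) unfolding L_def by blast
qed

text \<open>
  For decreasing projections \<open>\<parallel>s n - l\<parallel>\<^sub>2\<^sup>2 = \<tau>(s n) - \<tau>(l)\<close>, which tends to zero by normality.
\<close>

lemma L_lim:
  assumes s: "\<And>n. s n \<in> L" and dec: "\<And>n. s (Suc n) o\<^sub>L s n = s (Suc n)"
    and l: "\<And>x. (\<lambda>n. blinfun_apply (s n) x) \<longlonglongrightarrow> blinfun_apply l x"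
  shows "l \<in> L"
proof -
  note sp = LD(2,3)[OF s] and sM = LD(4)[OF s] and sA = LD(1)[OF s]
  have lA: "l \<in> A" by (rule A.A.strong_limit_closed[OF sA l])
  have syml: "symmetric_op l" by (rule symmetric_strong_limit[OF l sp(1)])
  have lM: "l \<in> M" using lA A_sub by auto
  have absorb: "s m (s n x) = s m x" if "n \<le> m" for m n x
    using that
  proof (induction m arbitrary: x rule: dec_induct)
    case base show ?case by (rule projection_psd(3)[OF sp])
  next
    case (step m)
    have e: "s (Suc m) (s m y) = s (Suc m) y" for y using dec by (metis blinfun_apply_blinfun_compose)
    have "s (Suc m) (s n x) = s (Suc m) (s m (s n x))" by (simp add: e)
    also have "\<dots> = s (Suc m) x" by (simp add: step.IH e)
    finally show ?case .
  qed
  have ls: "l (s n x) = l x" for n x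
  proof (rule LIMSEQ_unique[OF l])
    show "(\<lambda>m. s m (s n x)) \<longlonglongrightarrow> l x"
      by (rule Lim_transform_eventually[OF l]) (auto intro!: eventually_sequentiallyI[of n] simp: absorb)
  qed
  have "l (l x) = l x" for x
  proof (rule LIMSEQ_unique)
    show "(\<lambda>n. l (s n x)) \<longlonglongrightarrow> l (l x)" by (rule blinfun.tendsto[OF tendsto_const l])
    show "(\<lambda>n. l (s n x)) \<longlonglongrightarrow> l x" by (simp add: ls)
  qed
  then have ll: "l o\<^sub>L l = l" by (intro blinfun_eqI) simp
  have lsc: "l o\<^sub>L s n = l" for n by (rule blinfun_eqI) (simp add: ls)
  have sl: "s n o\<^sub>L l = l" for n using lsc[of n] A_comm[OF lA sA, of n] by simp
  have diff: "(s n - l) o\<^sub>L (s n - l) = s n - l" for n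
  proof (rule blinfun_eqI)
    fix x
    have "s n (l x) = l x" using sl[of n] by (metis blinfun_apply_blinfun_compose)
    then show "((s n - l) o\<^sub>L (s n - l)) x = (s n - l) x"
      by (simp add: blinfun.bilinear_simps ls \<open>\<And>x. l (l x) = l x\<close> projection_psd(3)[OF sp])
  qed
  have bdd: "bdd_below (range (\<lambda>n. tr (s n)))"
    using tr_pos[OF sM projection_psd(1)[OF sp]] by (auto simp: bdd_below_def)
  define c where "c = (INF n. tr (s n))"
  have cle: "c \<le> tr (s n)" for n unfolding c_def by (rule cINF_lower[OF bdd]) simp
  have "tr (id_blinfun - l) \<le> 1 - c"
  proof (rule tr_monotone_limit[of "\<lambda>n. id_blinfun - s n"])
    show "id_blinfun - s n \<in> M" "symmetric_op (id_blinfun - s n)" for n using sM sp by auto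
    show "(\<lambda>n. (id_blinfun - s n) x) \<longlonglongrightarrow> (id_blinfun - l) x" for x
      unfolding blinfun.diff_left by (intro tendsto_intros l)
    show "tr (id_blinfun - s n) \<le> 1 - c" for n using cle[of n] sM by (simp add: tr_simps mem_intros)
    have "s n o\<^sub>L s (Suc n) = s (Suc n)" for n using dec[of n] A_comm[OF sA sA, of n "Suc n"] by simp
    then show "psd (id_blinfun - s (Suc n) - (id_blinfun - s n))" for n
      using commuting_projections_product(3)[OF sp sp A_comm[OF sA sA], of n "Suc n"] by simp
  qed
  then have cl: "c \<le> tr l" using lM by (simp add: tr_simps mem_intros)
  have "\<exists>n J. J \<subseteq> words n \<and> tr ((l - F J) o\<^sub>L (l - F J)) < \<epsilon>" if eps: "\<epsilon> > 0" for \<epsilon>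
  proof -
    have "(INF n. tr (s n)) < c + \<epsilon>/4" using eps by (simp add: c_def)
    then obtain n where n: "tr (s n) < c + \<epsilon>/4" using bdd by (subst (asm) cINF_less_iff) auto
    obtain m J where J: "J \<subseteq> words m" "tr ((s n - F J) o\<^sub>L (s n - F J)) < \<epsilon>/4"
      using LD(5)[OF s, of "\<epsilon>/4" n] eps by auto
    have m: "l - s n \<in> Msa" "s n - F J \<in> Msa" "s n \<in> Msa" "l \<in> Msa" using lM sM syml sp F_M F_sym by (auto simp: Msa_def)
    have "tr ((l - s n) o\<^sub>L (l - s n)) = tr (s n - l)" using l2.B_swap[of l "s n"] m diff[of n] by simp
    also have "\<dots> < \<epsilon>/4" using n cl sM lM by (simp add: tr_simps)
    finally have "2 * tr ((l - s n) o\<^sub>L (l - s n)) + 2 * tr ((s n - F J) o\<^sub>L (s n - F J)) < \<epsilon>" using J(2) by simp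
    then have "tr ((l - F J) o\<^sub>L (l - F J)) < \<epsilon>" using tr_square_add_le[OF m(1,2)] by simp
    then show ?thesis using J(1) by blast
  qed
  then show ?thesis using lA syml ll unfolding L_def by blast
qed

sublocale lat: projection_lattice M \<tau> L
proof unfold_locales
  show "L \<subseteq> M" using LD(4) by blast
  show "id_blinfun \<in> L" by (rule L_id)
qed (use LD(2,3) A_comm[OF LD(1) LD(1)] L_compl L_prod in blast, rule A_comm[OF LD(1) LD(1)],
  auto intro: L_compl L_prod, rule L_lim)

lemma norm_partition: "(norm y)\<^sup>2 = (\<Sum>w\<in>words n. (norm (P w y))\<^sup>2)"
proof -
  have "(norm y)\<^sup>2 = inner ((\<Sum>w\<in>words n. P w) y) y"
    by (simp add: partition_of_unity power2_norm_eq_inner)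
  also have "\<dots> = (\<Sum>w\<in>words n. (norm (P w y))\<^sup>2)"
    by (simp add: blinfun.sum_left inner_sum_left projection_psd(4)[OF P_sym P_idem])
  finally show ?thesis .
qed

text \<open>
  In the decomposition \<open>a = e a + (a - e a)\<close> the vectors \<open>c a - e a\<close> and \<open>a - e a\<close>, or \<open>- e a\<close>, have explicit norms,
  and \<open>|c| \<ge> 1/2\<close> or \<open>|1 - c| \<ge> 1/2\<close> according to the sign of \<open>Re c - 1/2\<close>.
\<close>

lemma truncation_pointwise:
  assumes e: "symmetric_op e" "e o\<^sub>L e = e" "clinear_op e"
  shows "norm ((if Re c \<ge> 1/2 then a else 0) - e a) \<le> 2 * norm (scaleC c a - e a)"
proof -
  define x where "x = e a"
  define y where "y = a - e a"
  have ee: "e (e z) = e z" for z by (rule projection_psd(3)[OF e(1,2)])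
  have a: "a = x + y" by (simp add: x_def y_def)
  have "inner (scaleC u x) (scaleC v y) = 0" for u v
  proof -
    have "scaleC u x = e (scaleC u x)" by (simp add: x_def clinear_scaleC[OF e(3)] ee)
    moreover have "e (scaleC v y) = 0" by (simp add: y_def clinear_scaleC[OF e(3)] blinfun.diff_right ee)
    ultimately show ?thesis using symmetric_opD[OF e(1), of "scaleC u x" "scaleC v y"] by simp
  qed
  then have pyth: "(norm (scaleC u x + scaleC v y))\<^sup>2 = (cmod u)\<^sup>2 * (norm x)\<^sup>2 + (cmod v)\<^sup>2 * (norm y)\<^sup>2" for u v
    by (subst norm_add_Pythagorean) (simp_all add: orthogonal_def norm_scaleC power_mult_distrib)
  have "scaleC c a - e a = scaleC (c - 1) x + scaleC c y"
  proof -
    have "scaleC c a = scaleC c x + scaleC c y" using a scaleC_add_right by metis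
    then show ?thesis using scaleC_add_left[of "c - 1" 1 x] by (simp add: x_def[symmetric])
  qed
  then have r: "(norm (scaleC c a - e a))\<^sup>2 = (cmod (c - 1))\<^sup>2 * (norm x)\<^sup>2 + (cmod c)\<^sup>2 * (norm y)\<^sup>2"
    by (simp add: pyth)
  have "(norm ((if Re c \<ge> 1/2 then a else 0) - e a))\<^sup>2 \<le> (2 * norm (scaleC c a - e a))\<^sup>2"
  proof (cases "Re c \<ge> 1/2")
    case True
    then have "1/2 \<le> cmod c" using complex_Re_le_cmod[of c] by linarith
    then have "(1/2)\<^sup>2 \<le> (cmod c)\<^sup>2" by (intro power_mono) auto
    then have "(1/2)\<^sup>2 * (norm y)\<^sup>2 \<le> (cmod c)\<^sup>2 * (norm y)\<^sup>2" by (intro mult_right_mono) auto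
    then have "(norm y)\<^sup>2 \<le> 4 * ((cmod c)\<^sup>2 * (norm y)\<^sup>2)" by (simp add: power2_eq_square)
    also have "\<dots> \<le> 4 * (norm (scaleC c a - e a))\<^sup>2" unfolding r by simp
    finally show ?thesis using True by (simp add: y_def power_mult_distrib)
  next
    case False
    then have "1/2 \<le> cmod (c - 1)" using complex_Re_le_cmod[of "1 - c"] by (simp add: norm_minus_commute)
    then have "(1/2)\<^sup>2 \<le> (cmod (c - 1))\<^sup>2" by (intro power_mono) auto
    then have "(1/2)\<^sup>2 * (norm x)\<^sup>2 \<le> (cmod (c - 1))\<^sup>2 * (norm x)\<^sup>2" by (intro mult_right_mono) auto
    then have "(norm x)\<^sup>2 \<le> 4 * ((cmod (c - 1))\<^sup>2 * (norm x)\<^sup>2)" by (simp add: power2_eq_square)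
    also have "\<dots> \<le> 4 * (norm (scaleC c a - e a))\<^sup>2" unfolding r by simp
    finally show ?thesis using False by (simp add: x_def power_mult_distrib)
  qed
  then show ?thesis by (rule power2_le_imp_le) simp
qed

text \<open>
  Rounding the coefficients of a combination of nodes to \<open>0\<close> or \<open>1\<close> costs only a factor two in the approximation
  of a projection. This is where unbounded coefficients are brought under control.
\<close>

lemma truncation:
  assumes e: "e \<in> A" "symmetric_op e" "e o\<^sub>L e = e"
  shows "norm (F {w \<in> words n. Re (c w) \<ge> 1/2} z - e z) \<le> 2 * norm ((\<Sum>w\<in>words n. scaleC (c w) (P w z)) - e z)"
proof -
  let ?J = "{w \<in> words n. Re (c w) \<ge> 1/2}"
  let ?u = "\<Sum>w\<in>words n. scaleC (c w) (P w z)"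
  have cl: "clinear_op e" using A.A.clinear e(1) by blast
  have eP: "P w (e z) = e (P w z)" for w using A_comm[OF P_A e(1)] by (metis blinfun_apply_blinfun_compose)
  have "(norm (F ?J z - e z))\<^sup>2 = (\<Sum>w\<in>words n. (norm (P w (F ?J z - e z)))\<^sup>2)" by (rule norm_partition)
  also have "\<dots> \<le> (\<Sum>w\<in>words n. (2 * norm (P w (?u - e z)))\<^sup>2)"
  proof (intro sum_mono power_mono)
    fix w assume w: "w \<in> words n"
    have "P w (F ?J z - e z) = (if Re (c w) \<ge> 1/2 then P w z else 0) - e (P w z)"
      using P_F[of ?J n w z] w by (simp add: blinfun.diff_right eP)
    moreover have "P w (?u - e z) = scaleC (c w) (P w z) - e (P w z)"
      using P_sum[of "words n" n w c z] w by (simp add: blinfun.diff_right eP)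
    ultimately show "norm (P w (F ?J z - e z)) \<le> 2 * norm (P w (?u - e z))"
      using truncation_pointwise[OF e(2,3) cl] by simp
  qed simp
  also have "\<dots> = 4 * (\<Sum>w\<in>words n. (norm (P w (?u - e z)))\<^sup>2)"
    by (simp add: power_mult_distrib sum_distrib_left)
  also have "\<dots> = (2 * norm (?u - e z))\<^sup>2"
    using norm_partition[of "?u - e z" n] by (simp add: power_mult_distrib)
  finally show ?thesis by (rule power2_le_imp_le) simp
qed

end

context projection_tree
begin

text \<open>
  The projection onto the closure of all combinations of nodes applied to \<open>z\<close> commutes with the tree, hence with
  \<open>e\<close>, and it fixes \<open>z\<close>.
\<close>

lemma projection_in_closure:
  assumes e: "e \<in> A" "symmetric_op e" "e o\<^sub>L e = e"
  shows "e z \<in> closure {\<Sum>w\<in>words n. scaleC (c w) (P w z) | n c. True}"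
proof -
  define U where "U = {\<Sum>w\<in>words n. scaleC (c w) (P w z) | n c. True}"
  have UI: "(\<Sum>w\<in>words n. scaleC (c w) (P w z)) \<in> U" for n c by (auto simp: U_def)
  have add: "x + y \<in> U" if "x \<in> U" "y \<in> U" for x y
  proof -
    obtain m c n d where x: "x = (\<Sum>w\<in>words m. scaleC (c w) (P w z))" and y: "y = (\<Sum>w\<in>words n. scaleC (d w) (P w z))"
      using \<open>x \<in> U\<close> \<open>y \<in> U\<close> by (auto simp: U_def)
    have "x = (\<Sum>w\<in>words (m + n). scaleC (c (drop n w)) (P w z))" unfolding x
      using sum_lift[where c=c and k=n and n=m and x=z] by (simp add: add.commute)
    moreover have "y = (\<Sum>w\<in>words (m + n). scaleC (d (drop m w)) (P w z))" unfolding y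
      by (rule sum_lift[symmetric])
    ultimately have "x + y = (\<Sum>w\<in>words (m + n). scaleC (c (drop n w) + d (drop m w)) (P w z))"
      by (simp add: scaleC_add_left sum.distrib)
    then show ?thesis using UI[of "\<lambda>w. c (drop n w) + d (drop m w)" "m + n"] by simp
  qed
  have sum_scale: "scaleC a (\<Sum>w\<in>W. f w) = (\<Sum>w\<in>W. scaleC a (f w))" for a W and f :: "bool list \<Rightarrow> 'h"
    by (induction W rule: infinite_finite_induct) (auto simp: scaleC_add_right)
  have scale: "scaleC a x \<in> U" if "x \<in> U" for a x
  proof -
    obtain m c where "x = (\<Sum>w\<in>words m. scaleC (c w) (P w z))" using \<open>x \<in> U\<close> by (auto simp: U_def)
    then have "scaleC a x = (\<Sum>w\<in>words m. scaleC (a * c w) (P w z))" by (simp add: sum_scale scaleC_scaleC)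
    then show ?thesis using UI[of "\<lambda>w. a * c w" m] by simp
  qed
  have FU: "F J x \<in> U" if JU: "J \<subseteq> words n" "x \<in> U" for J n x
  proof -
    obtain m c where x: "x = (\<Sum>w\<in>words m. scaleC (c w) (P w z))" using JU(2) by (auto simp: U_def)
    have x': "x = (\<Sum>w\<in>words (n + m). scaleC (c (drop n w)) (P w z))" unfolding x by (rule sum_lift[symmetric])
    define K where "K = {w \<in> words (n + m). drop m w \<in> J}"
    have FK: "F J = F K" unfolding K_def using F_lift[OF JU(1), of m] by (simp add: add.commute)
    have K: "K \<subseteq> words (n + m)" by (auto simp: K_def)
    have "F K x = (\<Sum>v\<in>K. P v x)" by (rule F_apply)
    also have "\<dots> = (\<Sum>v\<in>K. scaleC (c (drop n v)) (P v z))"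
      unfolding x' by (intro sum.cong refl) (use K in \<open>auto simp: P_sum[where J="words (n + m)" and n="n + m" and c="\<lambda>w. c (drop n w)"]\<close>)
    also have "\<dots> = (\<Sum>v\<in>words (n + m). if v \<in> K then scaleC (c (drop n v)) (P v z) else 0)"
      using K by (simp add: sum.inter_restrict[symmetric] Int_absorb1)
    also have "\<dots> = (\<Sum>v\<in>words (n + m). scaleC (if v \<in> K then c (drop n v) else 0) (P v z))"
      using scaleC_of_real[of 0] by (intro sum.cong) auto
    finally show ?thesis using UI[of "\<lambda>v. if v \<in> K then c (drop n v) else 0" "n + m"] by (simp add: FK)
  qed
  have PU: "P v x \<in> U" if "x \<in> U" for v x
    using FU[of "{v}" "length v" x] that P_eq_F[of v] by (auto simp: words_def)
  have zU: "z \<in> U" using UI[of "\<lambda>_. 1" 0] by (simp add: P_Nil)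
  have sub: "subspace U"
  proof (rule subspaceI)
    show "0 \<in> U" using scale[OF zU, of 0] scaleC_of_real[of 0 z] by simp
    show "r *\<^sub>R x \<in> U" if "x \<in> U" for r x using scale[OF that, of "of_real r"] by (simp add: scaleC_of_real)
  qed (rule add)
  have cl_inv: "Y x \<in> closure U" if Y: "\<And>x. x \<in> U \<Longrightarrow> Y x \<in> U" and x: "x \<in> closure U" for Y :: "'h operator" and x
  proof -
    have "Y ` closure U \<subseteq> closure U"
      by (rule image_closure_subset) (use Y closure_subset in \<open>auto intro!: continuous_intros\<close>)
    then show ?thesis using x by blast
  qed
  have cl_scale: "scaleC a x \<in> closure U" if "x \<in> closure U" for a x
    using cl_inv[of "scalar_op a" x] scale that by simp
  obtain G :: "'h operator" where G: "symmetric_op G" "\<And>x. G x \<in> closure U" "\<And>x. x \<in> closure U \<Longrightarrow> G x = x"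
    using symmetric_projection[of "closure U"] closure_subspace[OF sub] closed_closure by metis
  have adjI: "inner (scalar_op \<i> x) y = inner x (scalar_op (- \<i>) y)" for x y :: 'h
    by (simp add: inner_scaleC_ii scaleC_eq[of "-\<i>"])
  have "scalar_op \<i> o\<^sub>L G = G o\<^sub>L scalar_op \<i>"
    by (rule projection_commute[OF G adjI]) (simp_all add: cl_scale)
  then have "G (scaleC \<i> x) = scaleC \<i> (G x)" for x by (metis blinfun_apply_blinfun_compose scalar_op_apply)
  then have "clinear_op G" by (simp add: clinear_op_iff)
  moreover have "P v o\<^sub>L G = G o\<^sub>L P v" for v
    by (rule projection_commute[of G "closure U" "P v" "P v"])
      (use G cl_inv PU symmetric_opD[OF P_sym] in auto)
  ultimately have "G \<in> commutant (range P)" by (auto simp: commutant_def)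
  then have "e o\<^sub>L G = G o\<^sub>L e" using e(1) unfolding A_def by (rule commutantD[rotated])
  then have "e (G z) = G (e z)" by (metis blinfun_apply_blinfun_compose)
  moreover have "G z = z" using G(3) zU closure_subset by blast
  ultimately have "e z \<in> closure U" using G(2)[of "e z"] by simp
  then show ?thesis by (simp add: U_def)
qed

lemma projection_mem_L:
  assumes e: "e \<in> A" "symmetric_op e" "e o\<^sub>L e = e"
  shows "e \<in> L"
proof (rule lat.pointwise_approximable_projection_mem[OF e(2,3)])
  show "e o\<^sub>L f = f o\<^sub>L e" if "f \<in> L" for f using A_comm[OF e(1) LD(1)[OF that]] .
  fix z
  show "e z \<in> closure ((\<lambda>f. blinfun_apply f z) ` L)"
    unfolding closure_approachable
  proof (intro allI impI)
    fix \<epsilon> :: real assume eps: "\<epsilon> > 0"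
    then obtain u where u: "u \<in> {\<Sum>w\<in>words n. scaleC (c w) (P w z) | n c. True}" "dist u (e z) < \<epsilon>/2"
      using projection_in_closure[OF e, of z] unfolding closure_approachable by (meson half_gt_zero)
    then obtain n c where uc: "u = (\<Sum>w\<in>words n. scaleC (c w) (P w z))" by auto
    have "norm (F {w \<in> words n. Re (c w) \<ge> 1/2} z - e z) < \<epsilon>"
      using truncation[OF e, of n c z] u(2) by (simp add: uc dist_norm)
    moreover have "F {w \<in> words n. Re (c w) \<ge> 1/2} \<in> L" by (rule F_in_L[of _ n]) auto
    ultimately show "\<exists>y\<in>(\<lambda>f. blinfun_apply f z) ` L. dist y (e z) < \<epsilon>" by (auto simp: dist_norm)
  qed
qed

lemma trace_product_vanishes:
  assumes S: "S \<in> Msa" and zero: "\<And>w. tr (S o\<^sub>L P w) = 0"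
    and e: "e \<in> A" "symmetric_op e" "e o\<^sub>L e = e"
  shows "tr (S o\<^sub>L e) = 0"
proof -
  have eM: "e \<in> Msa" using e A_sub by (auto simp: Msa_def)
  have "\<exists>J. tr ((F J - e) o\<^sub>L (F J - e)) < inverse (real (Suc n))" for n
  proof -
    obtain m J where "tr ((e - F J) o\<^sub>L (e - F J)) < inverse (real (Suc n))"
      using LD(5)[OF projection_mem_L[OF e], of "inverse (real (Suc n))"] by auto
    then show ?thesis using l2.B_swap[OF eM, of "F J"] F_M F_sym by (auto simp: Msa_def)
  qed
  then obtain J where J: "\<And>n. tr ((F (J n) - e) o\<^sub>L (F (J n) - e)) < inverse (real (Suc n))" by metis
  have FM: "F K \<in> Msa" for K using F_M F_sym by (auto simp: Msa_def)
  have "(\<lambda>n. tr ((F (J n) - e) o\<^sub>L (F (J n) - e))) \<longlonglongrightarrow> 0"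
  proof (rule tendsto_sandwich[of "\<lambda>_. 0" _ _ "\<lambda>n. inverse (real (Suc n))"])
    show "\<forall>\<^sub>F n in sequentially. 0 \<le> tr ((F (J n) - e) o\<^sub>L (F (J n) - e))"
      using FM eM by (intro always_eventually allI l2.B_nonneg) auto
    show "\<forall>\<^sub>F n in sequentially. tr ((F (J n) - e) o\<^sub>L (F (J n) - e)) \<le> inverse (real (Suc n))"
      using J by (intro always_eventually allI less_imp_le)
  qed (rule tendsto_const, rule LIMSEQ_inverse_real_of_nat)
  then have "(\<lambda>n. tr (S o\<^sub>L F (J n))) \<longlonglongrightarrow> tr (S o\<^sub>L e)" by (rule tr_l2_tendsto[OF S FM eM])
  moreover have "tr (S o\<^sub>L F K) = 0" for K
  proof -
    have "S o\<^sub>L F K = (\<Sum>w\<in>K. S o\<^sub>L P w)"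
      by (rule blinfun_eqI) (simp add: F_apply blinfun.sum_left blinfun.sum_right)
    then show ?thesis using S P_M zero by (simp add: tr_sum mem_intros Msa_def)
  qed
  ultimately show ?thesis by (simp add: LIMSEQ_const_iff)
qed

text \<open>
  Test \<open>d = X - Y\<close>, its Jordan decomposition, against the range projection of \<open>X\<close>, on which \<open>Y\<close> vanishes.
\<close>

lemma symmetric_zero_if_trace_vanishes:
  assumes d: "d \<in> A" "symmetric_op d"
    and zero: "\<And>e. e \<in> A \<Longrightarrow> symmetric_op e \<Longrightarrow> e o\<^sub>L e = e \<Longrightarrow> tr (d o\<^sub>L e) = 0"
  shows "d = 0"
proof -
  have pos: "X = 0" if X: "X \<in> A" "psd X" "Y \<in> A" "psd Y" "Y o\<^sub>L X = 0" and
    z: "\<And>e. e \<in> A \<Longrightarrow> symmetric_op e \<Longrightarrow> e o\<^sub>L e = e \<Longrightarrow> tr ((X - Y) o\<^sub>L e) = 0" for X Y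
  proof -
    obtain G where G: "G \<in> A" "symmetric_op G" "G o\<^sub>L G = G" "G o\<^sub>L X = X" "X o\<^sub>L G = X"
      "\<And>x. G x \<in> closure (range X)" using A.A.range_projection_closed[OF X(1) psd_symmetric[OF X(2)]] by metis
    have "Y y = 0" if "y \<in> closure (range X)" for y
    proof -
      have "closed {y. Y y = 0}" by (intro closed_Collect_eq continuous_intros)
      moreover have "range X \<subseteq> {y. Y y = 0}"
        using arg_cong[OF X(5), of blinfun_apply] by (auto simp: fun_eq_iff)
      ultimately show ?thesis using that closure_minimal by blast
    qed
    then have "(X - Y) o\<^sub>L G = X" using G(5,6)
      by (intro blinfun_eqI) (metis blinfun.diff_left blinfun_apply_blinfun_compose diff_zero)
    then have "tr X = 0" using z[OF G(1-3)] by simp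
    then show ?thesis using tr_faithful[of X] X A_sub by auto
  qed
  obtain X Y where J: "X \<in> A" "Y \<in> A" "psd X" "psd Y" "d = X - Y" "X o\<^sub>L Y = 0" "Y o\<^sub>L X = 0"
    using A.A.jordan_closed[OF d] .
  have "X = 0" using pos[OF J(1,3,2,4,7)] zero J(5) by simp
  moreover have "Y = 0"
  proof (rule pos[OF J(2,4,1,3,6)])
    fix e assume e: "e \<in> A" "symmetric_op e" "e o\<^sub>L e = e"
    have "(Y - X) o\<^sub>L e = - (d o\<^sub>L e)" by (rule blinfun_eqI) (simp add: J(5) blinfun.bilinear_simps)
    moreover have "d o\<^sub>L e \<in> M" using d e A_sub by auto
    ultimately show "tr ((Y - X) o\<^sub>L e) = 0" using zero[OF e] by (simp add: tr_simps)
  qed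
  ultimately show ?thesis using J(5) by simp
qed

lemma expectation_zero:
  assumes S: "S \<in> M" and zero: "\<And>w. \<tau> (S o\<^sub>L P w) = 0"
  shows "A.E S = 0"
proof -
  have sa: "A.E X = 0" if X: "X \<in> M" "symmetric_op X" and z: "\<And>w. tr (X o\<^sub>L P w) = 0" for X
  proof -
    have EX: "A.E X \<in> A" "A.E X \<in> M" using A.E_mem[OF X(1)] A_sub by auto
    have XMsa: "X \<in> Msa" using X by (simp add: Msa_def)
    obtain d1 d2 where D: "d1 \<in> A" "d2 \<in> A" "symmetric_op d1" "symmetric_op d2" "A.E X = d1 + scale_op \<i> d2"
      using A.A.real_imaginary_parts[OF EX(1)] .
    have dM: "d1 \<in> M" "d2 \<in> M" using D A_sub by auto
    have "tr (d1 o\<^sub>L e) = 0 \<and> tr (d2 o\<^sub>L e) = 0" if e: "e \<in> A" "symmetric_op e" "e o\<^sub>L e = e" for e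
    proof -
      have eM: "e \<in> M" using e A_sub by auto
      have "\<tau> (A.E X o\<^sub>L e) = \<tau> (X o\<^sub>L e)" by (rule A.tau_E[OF X(1) e(1)])
      also have "\<dots> = 0" using tau_prod_real[OF X(1) eM X(2) e(2)] trace_product_vanishes[OF XMsa z e] by simp
      also have "A.E X o\<^sub>L e = (d1 o\<^sub>L e) + scale_op \<i> (d2 o\<^sub>L e)" unfolding D(5)
        by (rule blinfun_eqI) (simp add: blinfun.add_left)
      finally have "complex_of_real (tr (d1 o\<^sub>L e)) + \<i> * complex_of_real (tr (d2 o\<^sub>L e)) = 0"
        using dM eM by (simp add: tau_add tau_scale mem_intros tau_prod_real D e)
      then show ?thesis by (simp add: complex_eq_iff)
    qed
    then have "d1 = 0" "d2 = 0" using symmetric_zero_if_trace_vanishes D by blast+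
    then show ?thesis unfolding D(5) by (intro blinfun_eqI) simp
  qed
  obtain S1 S2 where SS: "S1 \<in> M" "S2 \<in> M" "symmetric_op S1" "symmetric_op S2" "S = S1 + scale_op \<i> S2"
    using real_imaginary_parts[OF S] .
  have "tr (S1 o\<^sub>L P w) = 0 \<and> tr (S2 o\<^sub>L P w) = 0" for w
  proof -
    have "S o\<^sub>L P w = (S1 o\<^sub>L P w) + scale_op \<i> (S2 o\<^sub>L P w)" unfolding SS(5)
      by (rule blinfun_eqI) (simp add: blinfun.add_left)
    then have "complex_of_real (tr (S1 o\<^sub>L P w)) + \<i> * complex_of_real (tr (S2 o\<^sub>L P w)) = 0"
      using zero[of w] SS P_M P_sym by (simp add: tau_add tau_scale mem_intros tau_prod_real)
    then show ?thesis by (simp add: complex_eq_iff)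
  qed
  then have "A.E S1 = 0" "A.E S2 = 0" using sa SS by blast+
  then show ?thesis unfolding SS(5) using SS
    by (simp add: A.E_add A.E_scale mem_intros) (intro blinfun_eqI, simp)
qed

end

context tracial_algebra
begin

text \<open>
  Below the first level every node is halved by \<open>lyapunov\<close>, applied to half of the node. The first
  level is \<open>Q\<close> and \<open>1 - Q\<close>, whose traces are only known to be at most one; hence the factor two in the bound.
\<close>

lemma projection_tree_exists:
  assumes nab: "\<And>P. abelian_projection M P \<Longrightarrow> P = 0"
    and S: "S \<in> M" "\<tau> S = 0" and Q: "Q \<in> M" "symmetric_op Q" "Q o\<^sub>L Q = Q" "\<tau> (S o\<^sub>L Q) = 0"
  obtains P where "projection_tree M \<tau> P" "P [True] = Q" "\<And>w. \<tau> (S o\<^sub>L P w) = 0"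
    "\<And>w. tr (P w) \<le> 2 * (1/2) ^ length w"
proof -
  define good where "good = (\<lambda>G. G \<in> M \<and> symmetric_op G \<and> G o\<^sub>L G = G \<and> \<tau> (S o\<^sub>L G) = 0)"
  define below where "below = (\<lambda>H G. good H \<and> psd (G - H))"
  have "\<exists>H. below H G \<and> \<tau> H = \<tau> G / 2" if G: "good G" for G
  proof -
    have Gp: "G \<in> M" "symmetric_op G" "G o\<^sub>L G = G" "\<tau> (S o\<^sub>L G) = 0" using G by (auto simp: good_def)
    have "psd G" by (rule projection_psd(1)[OF Gp(2,3)])
    moreover have "G - (1/2) *\<^sub>R G = (1 - 1/2) *\<^sub>R G" by (simp only: scaleR_left_diff_distrib scaleR_one)
    ultimately have p: "psd ((1/2) *\<^sub>R G)" "psd (G - (1/2) *\<^sub>R G)" by simp_all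
    have hM: "(1/2) *\<^sub>R G \<in> M" using Gp by auto
    obtain H where H: "H \<in> M" "symmetric_op H" "H o\<^sub>L H = H" "psd (G - H)" "\<tau> H = \<tau> ((1/2) *\<^sub>R G)"
      "\<tau> (S o\<^sub>L H) = \<tau> (S o\<^sub>L ((1/2) *\<^sub>R G))"
      using lyapunov[OF Gp(1-3) hM p S(1) nab] by metis
    have "S o\<^sub>L ((1/2) *\<^sub>R G) = (1/2) *\<^sub>R (S o\<^sub>L G)" by (rule blinfun_eqI) (simp add: blinfun.bilinear_simps)
    then have "\<tau> (S o\<^sub>L H) = 0" using H(6) Gp S by (simp add: tau_scaleR mem_intros)
    then show ?thesis using H Gp by (auto simp: below_def good_def tau_scaleR)
  qed
  then obtain half where half: "\<And>G. good G \<Longrightarrow> below (half G) G \<and> \<tau> (half G) = \<tau> G / 2" by metis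
  define P where "P = rec_list id_blinfun (\<lambda>b w G. let H = if w = [] then Q else half G in if b then H else G - H)"
  have P0: "P [] = id_blinfun" by (simp add: P_def)
  define H where "H = (\<lambda>w. if w = [] then Q else half (P w))"
  have PT: "P (True # w) = H w" and PF: "P (False # w) = P w - H w" for w
    by (simp_all add: P_def H_def Let_def)
  have goodI: "good id_blinfun" using S by (auto simp: good_def)
  have goodQ: "good Q" using Q by (auto simp: good_def)
  have belowQ: "below Q id_blinfun" using goodQ projection_psd(2)[OF Q(2,3)] by (simp add: below_def)
  have diff: "good (G - K) \<and> G o\<^sub>L K = K \<and> G o\<^sub>L (G - K) = G - K" if G: "good G" and K: "below K G" for G K
  proof -
    have Gp: "G \<in> M" "symmetric_op G" "G o\<^sub>L G = G" "\<tau> (S o\<^sub>L G) = 0" using G by (auto simp: good_def)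
    have Kp: "K \<in> M" "symmetric_op K" "K o\<^sub>L K = K" "\<tau> (S o\<^sub>L K) = 0" "psd (G - K)" using K by (auto simp: good_def below_def)
    have e: "K (G x) = K x" "G (K x) = K x" for x
      using below_projection(2,3)[OF Gp(2,3) projection_psd(1)[OF Kp(2,3)] Kp(5)] by auto
    have "(G - K) o\<^sub>L (G - K) = G - K"
      by (rule blinfun_eqI) (simp add: blinfun.bilinear_simps e projection_psd(3)[OF Gp(2,3)] projection_psd(3)[OF Kp(2,3)])
    moreover have "S o\<^sub>L (G - K) = (S o\<^sub>L G) - (S o\<^sub>L K)" by (rule blinfun_eqI) (simp add: blinfun.bilinear_simps)
    then have "\<tau> (S o\<^sub>L (G - K)) = 0" using Gp Kp S by (simp add: tau_diff mem_intros)
    moreover have "G o\<^sub>L K = K" "G o\<^sub>L (G - K) = G - K"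
      by (rule blinfun_eqI, simp add: blinfun.bilinear_simps e projection_psd(3)[OF Gp(2,3)])+
    ultimately show ?thesis using Gp Kp by (auto simp: good_def)
  qed
  have inv: "good (P w) \<and> below (H w) (P w)" for w
  proof (induction w)
    case Nil
    then show ?case using goodI belowQ by (simp add: P0 H_def)
  next
    case (Cons b w)
    have "good (P (b # w))" using Cons diff[of "P w" "H w"] by (cases b) (auto simp: PT PF below_def)
    then show ?case using half[of "P (b # w)"] by (simp add: H_def)
  qed
  have PM: "P w \<in> M" and Psym: "symmetric_op (P w)" and Pid: "P w o\<^sub>L P w = P w" and PS: "\<tau> (S o\<^sub>L P w) = 0" for w
    using inv[of w] by (auto simp: good_def)
  have HM: "H w \<in> M" for w using inv[of w] by (auto simp: below_def good_def)
  have bel: "P w o\<^sub>L P (b # w) = P (b # w)" for w b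
    using diff[of "P w" "H w"] inv[of w] by (cases b) (auto simp: PT PF)
  have tree: "projection_tree M \<tau> P"
    by unfold_locales (auto simp: PM Psym Pid P0 bel, simp add: PT PF)
  have tr_le1: "tr (P w) \<le> 1" for w
    using tr_mono[OF PM mem_intros(2) projection_psd(2)[OF Psym Pid], of w] by (simp add: tr_simps)
  have "tr (P w) \<le> 2 * (1/2) ^ length w" for w
  proof (induction w)
    case Nil
    then show ?case using tr_le1[of "[]"] by simp
  next
    case (Cons b w)
    show ?case
    proof (cases "w = []")
      case True
      then show ?thesis using tr_le1[of "b # w"] by simp
    next
      case False
      then have "\<tau> (H w) = \<tau> (P w) / 2" using half[of "P w"] inv[of w] by (simp add: H_def)
      then have "Re (\<tau> (H w)) = Re (\<tau> (P w) / 2)" by (rule arg_cong)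
      then have "tr (H w) = tr (P w) / 2" by (simp add: tr_def)
      then have "tr (P (b # w)) = tr (P w) / 2" using PM[of w] HM[of w] by (cases b) (auto simp: PT PF tr_simps)
      then show ?thesis using Cons by simp
    qed
  qed
  moreover have "P [True] = Q" by (simp add: PT H_def)
  ultimately show ?thesis using that tree PS by blast
qed

end

section \<open>Spectral measures\<close>

lemma quadratic_form_zero:
  fixes D :: "'h::complex_hilbert operator"
  assumes D: "clinear_op D" and z: "\<And>x. cinner (D x) x = 0"
  shows "D = 0"
proof (rule blinfun_eqI)
  fix x
  have s: "cinner (D u) v + cinner (D v) u = 0" for u v
    using z[of "u + v"] z[of u] z[of v] by (simp add: blinfun.add_right cinner_add_left cinner_add_right add.commute)
  have "cinner (D x) (D x) = 0"
    using s[of x "D x"] s[of "scaleC \<i> x" "D x"]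
    by (simp add: clinear_scaleC[OF D] cinner_scaleC_left cinner_scaleC_right)
  then show "D x = (0::'h operator) x" by (simp add: cinner_self)
qed

text \<open>
  The cross terms \<open>\<langle>N u, v\<rangle>\<close> and \<open>\<langle>N v, u\<rangle>\<close> between range and kernel of \<open>G\<close> have sum zero; with \<open>\<i> u\<close> in place of \<open>u\<close> they
  have difference zero.
\<close>

lemma block_diagonal_commute:
  fixes N G :: "'h::complex_hilbert operator"
  assumes N: "clinear_op N" and G: "clinear_op G" "symmetric_op G" "G o\<^sub>L G = G"
    and split: "\<And>z. cinner (N (G z)) (G z) + cinner (N (z - G z)) (z - G z) = cinner (N z) z"
  shows "N (G x) = G (N x)"
proof -
  have GG: "G (G x) = G x" for x by (rule projection_psd(3)[OF G(2,3)])
  have cross: "cinner (N u) v + cinner (N v) u = 0" if "G u = u" "G v = 0" for u v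
    using split[of "u + v"] that by (simp add: blinfun.add_right cinner_add_left cinner_add_right add.commute)
  have z: "cinner (N u) v = 0 \<and> cinner (N v) u = 0" if uv: "G u = u" "G v = 0" for u v
  proof -
    have "G (scaleC \<i> u) = scaleC \<i> u" using uv by (simp add: clinear_scaleC[OF G(1)])
    from cross[OF this uv(2)] have "\<i> * cinner (N u) v - \<i> * cinner (N v) u = 0"
      by (simp add: clinear_scaleC[OF N] cinner_scaleC_left cinner_scaleC_right)
    then have "cinner (N u) v = cinner (N v) u" by simp
    with cross[OF uv] show ?thesis by simp
  qed
  have zi: "inner (N (G x)) (y - G y) = 0" "inner (N (x - G x)) (G y) = 0" for x y
    using z[of "G x" "y - G y"] z[of "G y" "x - G x"] GG by (simp_all add: blinfun.diff_right inner_eq_Re_cinner)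
  have Gs: "inner (G a) b = inner a (G b)" for a b by (rule symmetric_opD[OF G(2)])
  have "inner (N (G x)) y = inner (G (N x)) y" for y
    using zi(1)[of x y] zi(2)[of x y] Gs[of "N (G x)" y] Gs[of "N x" y]
    by (simp add: blinfun.diff_right inner_diff_right inner_diff_left)
  then show ?thesis by (metis vector_eq_rdot)
qed

locale projection_valued =
  fixes P :: "complex set \<Rightarrow> 'h::complex_hilbert operator"
  assumes pvm: "projection_valued_measure P"
begin

lemma P_lin: "B \<in> sets borel \<Longrightarrow> clinear_op (P B)"
  and P_sym: "B \<in> sets borel \<Longrightarrow> symmetric_op (P B)"
  and P_idem: "B \<in> sets borel \<Longrightarrow> P B o\<^sub>L P B = P B"
  and P_UNIV: "P UNIV = id_blinfun"
  and P_Int: "B \<in> sets borel \<Longrightarrow> C \<in> sets borel \<Longrightarrow> P (B \<inter> C) = P B o\<^sub>L P C"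
  and P_sums: "range S \<subseteq> sets borel \<Longrightarrow> disjoint_family S \<Longrightarrow> (\<lambda>n. P (S n) x) sums P (\<Union>n. S n) x"
  using pvm by (auto simp: projection_valued_measure_def is_projection_def adj_self_iff)

lemma P_empty: "P {} x = 0"
proof -
  have "(\<lambda>n::nat. P {} x) sums P {} x" using P_sums[of "\<lambda>_. {}" x] by (simp add: disjoint_family_on_def)
  then show ?thesis using summable_const_iff sums_summable by blast
qed

definition \<mu> :: "'h \<Rightarrow> complex measure" where "\<mu> x = scalar_spectral_measure P x"

lemma \<mu>_space [simp]: "space (\<mu> x) = UNIV" and \<mu>_sets [measurable_cong, simp]: "sets (\<mu> x) = sets borel"
  unfolding \<mu>_def scalar_spectral_measure_def
  using sets.sigma_sets_eq[of "borel :: complex measure"] by (auto simp: space_measure_of_conv)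

lemma P_norm: "B \<in> sets borel \<Longrightarrow> inner (P B x) x = (norm (P B x))\<^sup>2"
  using projection_psd(4) P_sym P_idem by blast

lemma \<mu>_emeasure: "B \<in> sets borel \<Longrightarrow> emeasure (\<mu> x) B = ennreal ((norm (P B x))\<^sup>2)"
proof -
  assume B: "B \<in> sets borel"
  let ?f = "\<lambda>B. ennreal (Re (cinner (P B x) x))"
  have "emeasure (\<mu> x) B = ?f B"
  proof (rule emeasure_measure_of)
    show "\<mu> x = measure_of UNIV (sets borel) ?f" by (simp add: \<mu>_def scalar_spectral_measure_def)
    show "sets borel \<subseteq> Pow UNIV" by simp
    show "B \<in> sets (\<mu> x)" using B by simp
    show "positive (sets (\<mu> x)) ?f" by (simp add: positive_def P_empty inner_eq_Re_cinner[symmetric])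
    show "countably_additive (sets (\<mu> x)) ?f"
    proof (rule countably_additiveI)
      fix S :: "nat \<Rightarrow> complex set"
      assume S: "range S \<subseteq> sets (\<mu> x)" "disjoint_family S"
      have "(\<lambda>n. inner (P (S n) x) x) sums inner (P (\<Union>n. S n) x) x"
        using bounded_linear.sums[OF bounded_linear_inner_left P_sums[of S x]] S by simp
      then show "(\<Sum>i. ?f (S i)) = ?f (\<Union> (range S))"
        unfolding inner_eq_Re_cinner[symmetric]
      proof (rule suminf_ennreal_eq[rotated])
        show "0 \<le> inner (P (S i) x) x" for i using P_norm[of "S i" x] S by auto
      qed
    qed
  qed
  then show ?thesis using P_norm[OF B] by (simp add: inner_eq_Re_cinner[symmetric])
qed

lemma finite_\<mu>: "finite_measure (\<mu> x)"
  by (rule finite_measureI) (simp add: \<mu>_emeasure)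

lemma \<mu>_measure: "B \<in> sets borel \<Longrightarrow> measure (\<mu> x) B = (norm (P B x))\<^sup>2"
  by (simp add: measure_def \<mu>_emeasure)

lemma \<mu>_null: "B \<in> sets borel \<Longrightarrow> P B x = 0 \<Longrightarrow> B \<in> null_sets (\<mu> x)"
  by (simp add: null_sets_def \<mu>_emeasure)

lemma P_compl: "B \<in> sets borel \<Longrightarrow> P (- B) x = x - P B x"
proof -
  assume B: "B \<in> sets borel"
  have "(\<lambda>n. P (binaryset B (- B) n) x) sums (P B x + P (- B) x)"
    by (rule binaryset_sums) (rule P_empty)
  moreover have "(\<lambda>n. P (binaryset B (- B) n) x) sums P (\<Union>n. binaryset B (- B) n) x"
  proof (rule P_sums)
    show "range (binaryset B (- B)) \<subseteq> sets borel" using B by (auto simp: range_binaryset_eq borel_comp)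
    show "disjoint_family (binaryset B (- B))"
      by (auto simp: disjoint_family_on_def binaryset_def)
  qed
  ultimately have "P B x + P (- B) x = x"
    using sums_unique2 by (fastforce simp: UN_binaryset_eq P_UNIV)
  then show ?thesis by (simp add: algebra_simps)
qed

end

locale spectral_measure_space = projection_valued P
  for N :: "'h::complex_hilbert operator" and P :: "complex set \<Rightarrow> 'h operator" +
  assumes sm: "spectral_measure N P"
begin

lemma N_lin: "clinear_op N"
  and N_form: "cinner (N x) x = integral\<^sup>L (scalar_spectral_measure P x) (\<lambda>z. z)"
  using sm by (auto simp: spectral_measure_def)

lemma bounded_AE: obtains r where "AE w in \<mu> x. cmod w \<le> r"
proof -
  obtain r where r: "P (cball 0 r) = id_blinfun" using sm by (auto simp: spectral_measure_def)
  have "- cball 0 r \<in> null_sets (\<mu> x)"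
    by (rule \<mu>_null) (use P_compl[of "cball 0 r" x] r in \<open>auto simp: borel_comp\<close>)
  then have "AE w in \<mu> x. cmod w \<le> r"
    by (rule AE_I') auto
  then show ?thesis using that by blast
qed

lemma integrable_id: "integrable (\<mu> x) (\<lambda>w. w)"
proof -
  interpret finite_measure "\<mu> x" by (rule finite_\<mu>)
  obtain r where "AE w in \<mu> x. cmod w \<le> r" using bounded_AE .
  then show ?thesis by (intro integrable_const_bound[of _ r]) simp_all
qed

text \<open>
  Compression by \<open>P B\<close> restricts the scalar measures to \<open>B\<close>. As the form of \<open>N\<close> is an integral against them, it splits
  along \<open>B\<close> and its complement, so that \<open>N\<close> commutes with \<open>P B\<close> (\<open>N_commute\<close>).
\<close>

lemma \<mu>_compress:
  assumes B: "B \<in> sets borel"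
  shows "\<mu> (P B x) = density (\<mu> x) (indicator B)"
proof (rule measure_eqI)
  fix C assume "C \<in> sets (\<mu> (P B x))"
  then have C: "C \<in> sets borel" by simp
  have "emeasure (density (\<mu> x) (indicator B)) C = emeasure (\<mu> x) (B \<inter> C)"
    using B C by (simp add: emeasure_density flip: indicator_inter_arith)
  also have "\<dots> = emeasure (\<mu> (P B x)) C"
    using B C P_Int[OF C B] by (simp add: \<mu>_emeasure Int_commute)
  finally show "emeasure (\<mu> (P B x)) C = emeasure (density (\<mu> x) (indicator B)) C" by simp
qed simp

lemma N_form_compress:
  assumes B: "B \<in> sets borel"
  shows "cinner (N (P B x)) (P B x) = (\<integral>w. indicator B w *\<^sub>R w \<partial>\<mu> x)"
proof -
  have i: "(\<lambda>w. ennreal (indicator B w)) = (indicator B :: complex \<Rightarrow> ennreal)"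
    by (auto simp: indicator_def fun_eq_iff)
  have "cinner (N (P B x)) (P B x) = integral\<^sup>L (density (\<mu> x) (\<lambda>w. ennreal (indicator B w))) (\<lambda>w. w)"
    by (simp add: N_form \<mu>_def[symmetric] \<mu>_compress[OF B] i)
  also have "\<dots> = (\<integral>w. indicator B w *\<^sub>R w \<partial>\<mu> x)"
    using B by (intro integral_density) auto
  finally show ?thesis .
qed

lemma integrable_compress: "B \<in> sets borel \<Longrightarrow> integrable (\<mu> x) (\<lambda>w. indicator B w *\<^sub>R w)"
  using integrable_mult_indicator[OF _ integrable_id] by simp

lemma N_commute:
  assumes B: "B \<in> sets borel"
  shows "N (P B x) = P B (N x)"
proof (rule block_diagonal_commute[OF N_lin P_lin[OF B] P_sym[OF B] P_idem[OF B]])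
  fix z
  have B': "- B \<in> sets borel" using B by (simp add: borel_comp)
  have "cinner (N z) z = (\<integral>w. w \<partial>\<mu> z)" by (simp add: N_form \<mu>_def)
  also have "\<dots> = (\<integral>w. indicator B w *\<^sub>R w + indicator (- B) w *\<^sub>R w \<partial>\<mu> z)"
    by (intro Bochner_Integration.integral_cong) (auto simp: indicator_def)
  also have "\<dots> = cinner (N (P B z)) (P B z) + cinner (N (P (- B) z)) (P (- B) z)"
    using N_form_compress[OF B, of z] N_form_compress[OF B', of z] integrable_compress[OF B, of z] integrable_compress[OF B', of z]
    by simp
  finally show "cinner (N (P B z)) (P B z) + cinner (N (z - P B z)) (z - P B z) = cinner (N z) z"
    by (simp add: P_compl[OF B])
qed

lemma eigen:
  "N (P {c} x) = scaleC c (P {c} x)"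
proof -
  have S: "{c} \<in> sets borel" by simp
  define D where "D = (N - scalar_op c) o\<^sub>L P {c}"
  have cl: "clinear_op D" unfolding D_def
    by (simp add: clinear_op_def blinfun.diff_left clinear_scaleC[OF N_lin] clinear_scaleC[OF P_lin[OF S]] scaleC_scaleC mult.commute)
  have "cinner (D x) x = 0" for x
  proof -
    let ?y = "P {c} x"
    have yy: "P {c} ?y = ?y" by (rule projection_psd(3)[OF P_sym[OF S] P_idem[OF S]])
    have sy: "cinner (P {c} a) b = cinner a (P {c} b)" for a b
      using symmetric_opD[OF P_sym[OF S]] by (simp add: cinner_eq clinear_scaleC[OF P_lin[OF S], symmetric])
    have "cinner (N ?y) ?y = (\<integral>w. indicator {c} w *\<^sub>R w \<partial>\<mu> x)" by (rule N_form_compress[OF S])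
    also have "\<dots> = (\<integral>w. indicator {c} w *\<^sub>R c \<partial>\<mu> x)"
      by (intro Bochner_Integration.integral_cong) (auto simp: indicator_def)
    also have "\<dots> = measure (\<mu> x) {c} *\<^sub>R c"
      by (subst integral_scaleR_left) (auto simp: \<mu>_emeasure)
    also have "\<dots> = c * cinner ?y ?y" by (simp add: \<mu>_measure cinner_self scaleR_conv_of_real mult.commute)
    finally have 1: "cinner (N ?y) ?y = c * cinner ?y ?y" .
    have Dx: "D x = N ?y - scaleC c ?y" by (simp add: D_def blinfun.diff_left)
    have "P {c} (D x) = D x" by (simp add: Dx blinfun.diff_right clinear_scaleC[OF P_lin[OF S]] yy N_commute[OF S, symmetric])
    then have "cinner (D x) x = cinner (D x) ?y" using sy[of "D x" x] by simp
    also have "\<dots> = 0" using cinner_add_left[of "D x" "scaleC c ?y" ?y] by (simp add: Dx cinner_scaleC_left 1)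
    finally show ?thesis .
  qed
  then have "D = 0" by (rule quadratic_form_zero[OF cl])
  then have "D x = 0" by simp
  then show ?thesis by (simp add: D_def blinfun.diff_left)
qed

text \<open>
  \<open>P B x\<close> is again an eigenvector, so that the integral of \<open>u (w - c)\<close> over \<open>B\<close> is zero, whereas its
  real part is at least \<open>\<epsilon>\<close> times the measure of \<open>B\<close>. For \<open>|u| = 1\<close> the set is a half plane not containing \<open>c\<close>; the
  integral formula for the form of \<open>N\<close> involves first moments only, which suits half planes better than
  complements of discs.
\<close>

lemma eigenvector_half_plane_null:
  assumes x: "N x = scaleC c x" and e: "\<epsilon> > 0" and B: "B = {w. Re (u * (w - c)) \<ge> \<epsilon>}"
  shows "B \<in> sets borel" "P B x = 0"
proof -
  show Bs: "B \<in> sets borel" unfolding B by (intro borel_closed closed_Collect_le continuous_intros)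
  interpret finite_measure "\<mu> x" by (rule finite_\<mu>)
  have "N (P B x) = scaleC c (P B x)" by (simp add: N_commute[OF Bs] x clinear_scaleC[OF P_lin[OF Bs]])
  then have "cinner (N (P B x)) (P B x) = c * of_real ((norm (P B x))\<^sup>2)" by (simp add: cinner_scaleC_left cinner_self)
  then have 1: "(\<integral>w. indicator B w *\<^sub>R w \<partial>\<mu> x) = c * of_real (measure (\<mu> x) B)"
    by (simp add: N_form_compress[OF Bs] \<mu>_measure[OF Bs])
  have i2: "integrable (\<mu> x) (\<lambda>w. indicator B w *\<^sub>R c)" using Bs by (intro integrable_scaleR_left) (auto simp: \<mu>_emeasure)
  have i3: "integrable (\<mu> x) (\<lambda>w. u * (indicator B w *\<^sub>R w - indicator B w *\<^sub>R c))"
    using integrable_compress[OF Bs] i2 by (intro integrable_mult_right Bochner_Integration.integrable_diff)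
  have "(\<integral>w. u * (indicator B w *\<^sub>R w - indicator B w *\<^sub>R c) \<partial>\<mu> x)
     = u * ((\<integral>w. indicator B w *\<^sub>R w \<partial>\<mu> x) - (\<integral>w. indicator B w *\<^sub>R c \<partial>\<mu> x))"
    using integrable_compress[OF Bs] i2 by simp
  also have "(\<integral>w. indicator B w *\<^sub>R c \<partial>\<mu> x) = c * of_real (measure (\<mu> x) B)"
    using Bs by (subst integral_scaleR_left) (auto simp: \<mu>_emeasure scaleR_conv_of_real mult.commute)
  finally have z: "(\<integral>w. u * (indicator B w *\<^sub>R w - indicator B w *\<^sub>R c) \<partial>\<mu> x) = 0"
    unfolding 1 by simp
  have "(\<integral>w. Re (u * (indicator B w *\<^sub>R w - indicator B w *\<^sub>R c)) \<partial>\<mu> x) = 0"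
    unfolding integral_Re[OF i3] z by simp
  moreover have "(\<integral>w. indicator B w * \<epsilon> \<partial>\<mu> x) \<le> (\<integral>w. Re (u * (indicator B w *\<^sub>R w - indicator B w *\<^sub>R c)) \<partial>\<mu> x)"
  proof (rule integral_mono)
    show "integrable (\<mu> x) (\<lambda>w. indicator B w * \<epsilon>)" using Bs by (intro integrable_mult_left) (auto simp: \<mu>_emeasure)
    show "integrable (\<mu> x) (\<lambda>w. Re (u * (indicator B w *\<^sub>R w - indicator B w *\<^sub>R c)))" using i3 by (rule integrable_Re)
    show "indicator B w * \<epsilon> \<le> Re (u * (indicator B w *\<^sub>R w - indicator B w *\<^sub>R c))" for w
      by (cases "w \<in> B") (auto simp: B algebra_simps)
  qed
  moreover have "(\<integral>w. indicator B w * \<epsilon> \<partial>\<mu> x) = measure (\<mu> x) B * \<epsilon>" using Bs by simp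
  ultimately have "measure (\<mu> x) B \<le> 0" using e by (simp add: mult_le_0_iff)
  then show "P B x = 0" by (simp add: \<mu>_measure[OF Bs])
qed

text \<open>
  Countably many half planes, in the four coordinate directions, cover the complement of \<open>c\<close>.
\<close>

lemma eigenvector_fixed:
  assumes x: "N x = scaleC c x"
  shows "P {c} x = x"
proof -
  define H where "H = (\<lambda>(n::nat) u. {w. Re (u * (w - c)) \<ge> inverse (real (Suc n))})"
  have null: "H n u \<in> null_sets (\<mu> x)" for n u
  proof -
    have "0 < inverse (real (Suc n))" by simp
    moreover have "H n u = {w. Re (u * (w - c)) \<ge> inverse (real (Suc n))}" by (simp add: H_def)
    ultimately show ?thesis using eigenvector_half_plane_null[OF x] \<mu>_null by blast
  qed
  have U: "(\<Union>n. \<Union>u\<in>{1, -1, \<i>, -\<i>}. H n u) \<in> null_sets (\<mu> x)"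
    by (intro null_sets_UN null_sets_UN'[OF countable_finite]) (auto intro: null)
  have sub: "- {c} \<subseteq> (\<Union>n. \<Union>u\<in>{1, -1, \<i>, -\<i>}. H n u)"
  proof
    fix w assume "w \<in> - {c}"
    then have "Re (w - c) \<noteq> 0 \<or> Im (w - c) \<noteq> 0" by (auto simp: complex_eq_iff)
    then have "Re (w - c) > 0 \<or> - Re (w - c) > 0 \<or> - Im (w - c) > 0 \<or> Im (w - c) > 0" by linarith
    then have "\<exists>u\<in>{1, -1, \<i>, -\<i>}. Re (u * (w - c)) > 0" by simp
    then obtain u where u: "u \<in> {1, -1, \<i>, -\<i>}" "Re (u * (w - c)) > 0" by blast
    obtain n where "inverse (real (Suc n)) < Re (u * (w - c))" using reals_Archimedean[OF u(2)] by blast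
    then have "w \<in> H n u" by (simp add: H_def)
    then show "w \<in> (\<Union>n. \<Union>u\<in>{1, -1, \<i>, -\<i>}. H n u)" using u(1) by blast
  qed
  have "- {c} \<in> null_sets (\<mu> x)" by (rule null_sets_subset[OF U _ sub]) (simp add: borel_comp)
  then have "(norm (P (- {c}) x))\<^sup>2 = 0"
    using \<mu>_emeasure[of "- {c}" x] by (simp add: null_sets_def borel_comp)
  then show ?thesis using P_compl[of "{c}" x] by simp
qed

end

text \<open>
  The range of \<open>P {c}\<close> is the eigenspace of \<open>N\<close>, which the commutant of \<open>A\<close> preserves; the commutant is closed
  under adjoints.
\<close>

lemma spectral_projection_mem:
  assumes A: "vn_algebra A" and N: "N \<in> A" and sm: "spectral_measure N P"
  shows "P {c} \<in> A"
proof -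
  interpret vn_algebra A by fact
  interpret spectral_measure_space N P
    by unfold_locales (use sm in \<open>auto simp: spectral_measure_def\<close>)
  have S: "{c} \<in> sets borel" by simp
  show ?thesis
  proof (rule memI)
    fix Y assume Y: "Y \<in> commutant A"
    have cY: "clinear_op Y" by (rule commutant_clinear[OF Y])
    have inv: "Z x \<in> {x. N x = scaleC c x}" if Z: "Z \<in> commutant A" and x: "x \<in> {x. N x = scaleC c x}" for Z :: "'a operator" and x
    proof -
      have "N (Z x) = Z (N x)" using commutes[OF N Z] by simp
      then show ?thesis using x by (simp add: clinear_scaleC[OF commutant_clinear[OF Z]])
    qed
    show "Y o\<^sub>L P {c} = P {c} o\<^sub>L Y"
    proof (rule projection_commute[of "P {c}" "{x. N x = scaleC c x}" Y "adj Y"])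
      show "symmetric_op (P {c})" by (rule P_sym[OF S])
      show "P {c} x \<in> {x. N x = scaleC c x}" for x using eigen by simp
      show "P {c} x = x" if "x \<in> {x. N x = scaleC c x}" for x using eigenvector_fixed that by simp
      show "inner (Y x) y = inner x (adj Y y)" for x y by (rule inner_adj[OF cY])
    qed (rule inv[OF Y], simp, rule inv[OF commutant_adj_closed[OF Y]], simp)
  qed
qed


lemma two_point_spectral_measure:
  fixes G :: "'h::complex_hilbert operator"
  assumes G: "is_projection G" and ne: "c \<noteq> d"
  shows "spectral_measure (scale_op c G + scale_op d (id_blinfun - G))
    (\<lambda>B. (if c \<in> B then G else 0) + (if d \<in> B then id_blinfun - G else 0))"
proof -
  let ?N = "scale_op c G + scale_op d (id_blinfun - G)"
  define P where "P = (\<lambda>B. (if c \<in> B then G else 0) + (if d \<in> B then id_blinfun - G else 0))"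
  have Gc: "clinear_op G" and Gs: "symmetric_op G" and Gi: "G o\<^sub>L G = G"
    using G by (auto simp: is_projection_def adj_self_iff)
  have GG: "G (G x) = G x" for x by (rule projection_psd(3)[OF Gs Gi])
  have Gsc: "G (scaleC a x) = scaleC a (G x)" for a x by (rule clinear_scaleC[OF Gc])
  have Gadj: "inner (G x) y = inner x (G y)" for x y by (rule symmetric_opD[OF Gs])
  have Papp: "P B x = (if c \<in> B then G x else 0) + (if d \<in> B then x - G x else 0)" for B x
    by (simp add: P_def blinfun.bilinear_simps)
  have Nc: "clinear_op ?N"
    by (simp add: clinear_op_def blinfun.bilinear_simps Gsc scaleC_scaleC scaleC_add_right mult.commute)
  have inner_sc: "inner (scaleC a x) y = inner x (scaleC (cnj a) y)" for a and x y :: 'h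
    by (simp add: inner_eq_Re_cinner cinner_scaleC_left cinner_scaleC_right)
  have "adj ?N = scale_op (cnj c) G + scale_op (cnj d) (id_blinfun - G)"
    by (rule adj_unique(2)[OF Nc])
      (simp add: blinfun.bilinear_simps inner_add_left inner_add_right inner_diff_left inner_diff_right inner_sc Gadj Gsc)
  then have normal: "adj ?N o\<^sub>L ?N = ?N o\<^sub>L adj ?N"
    by (intro blinfun_eqI) (simp add: blinfun.bilinear_simps Gsc GG scaleC_scaleC scaleC_add_right mult.commute)
  have pvm: "projection_valued_measure P"
    unfolding projection_valued_measure_def
  proof (intro conjI ballI allI impI)
    fix B :: "complex set"
    have "clinear_op (P B)" by (simp add: clinear_op_def Papp Gsc scaleC_add_right)
    moreover have "symmetric_op (P B)" using Gs by (simp add: P_def)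
    moreover have "P B o\<^sub>L P B = P B" by (rule blinfun_eqI) (simp add: Papp blinfun.bilinear_simps GG)
    ultimately show "is_projection (P B)" by (simp add: is_projection_def adj_self_iff)
  next
    show "P UNIV = id_blinfun" by (simp add: P_def)
  next
    fix B C :: "complex set"
    show "P (B \<inter> C) = P B o\<^sub>L P C" by (rule blinfun_eqI) (simp add: Papp blinfun.bilinear_simps GG)
  next
    fix S :: "nat \<Rightarrow> complex set" and x
    assume "range S \<subseteq> sets borel \<and> disjoint_family S"
    then have dis: "\<And>m n. m \<noteq> n \<Longrightarrow> S m \<inter> S n = {}" by (auto simp: disjoint_family_on_def)
    have one: "(\<lambda>n. if a \<in> S n then y else 0) sums (if a \<in> (\<Union>n. S n) then y else 0)" for a and y :: 'h
    proof (cases "a \<in> (\<Union>n. S n)")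
      case True
      then obtain k where k: "a \<in> S k" by auto
      then have "(\<lambda>n. if a \<in> S n then y else 0) = (\<lambda>n. if n = k then y else 0)"
        using dis[of k] by (fastforce simp: fun_eq_iff)
      then show ?thesis using True sums_single[of k "\<lambda>_. y"] by simp
    qed auto
    show "(\<lambda>n. P (S n) x) sums P (\<Union>n. S n) x"
      unfolding Papp by (intro sums_add one)
  qed
  have bnd: "\<exists>r. P (cball 0 r) = id_blinfun"
    by (rule exI[of _ "max (cmod c) (cmod d)"]) (simp add: P_def)
  have form: "cinner (?N x) x = integral\<^sup>L (scalar_spectral_measure P x) (\<lambda>z. z)" for x
  proof -
    let ?\<mu> = "scalar_spectral_measure P x"
    interpret projection_valued P by unfold_locales (rule pvm)
    have sp: "space ?\<mu> = UNIV" and st: "sets ?\<mu> = sets borel"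
      using \<mu>_space[of x] \<mu>_sets[of x] unfolding \<mu>_def by auto
    have em: "emeasure ?\<mu> B = ennreal ((norm (P B x))\<^sup>2)" if "B \<in> sets borel" for B
      using \<mu>_emeasure[OF that] unfolding \<mu>_def .
    have ms: "measure ?\<mu> B = (norm (P B x))\<^sup>2" if "B \<in> sets borel" for B
      using em[OF that] by (simp add: measure_def)
    have Bs: "{c} \<in> sets borel" "{d} \<in> sets borel" "- {c, d} \<in> sets borel" by (auto simp: borel_comp)
    have "- {c, d} \<in> null_sets ?\<mu>" using em[OF Bs(3)] Bs st by (simp add: null_sets_def Papp)
    then have ae: "AE z in ?\<mu>. z = indicator {c} z *\<^sub>R c + indicator {d} z *\<^sub>R d"
      by (rule AE_I') (use ne in \<open>auto simp: indicator_def\<close>)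
    have ic: "integrable ?\<mu> (\<lambda>z. indicator {a} z *\<^sub>R a)" for a
      using st em[of "{a}"] by (intro integrable_scaleR_left) auto
    have iv: "(\<integral>z. indicator {a} z *\<^sub>R a \<partial>?\<mu>) = measure ?\<mu> {a} *\<^sub>R a" for a
      using st sp em[of "{a}"] by (subst integral_scaleR_left) auto
    have "(\<integral>z. z \<partial>?\<mu>) = (\<integral>z. indicator {c} z *\<^sub>R c + indicator {d} z *\<^sub>R d \<partial>?\<mu>)"
    proof (rule integral_cong_AE[OF _ _ ae])
      show "(\<lambda>z. z) \<in> borel_measurable ?\<mu>" using st by (simp add: measurable_cong_sets[OF st refl])
      show "(\<lambda>z. indicator {c} z *\<^sub>R c + indicator {d} z *\<^sub>R d) \<in> borel_measurable ?\<mu>"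
        using ic[of c] ic[of d] by (intro borel_measurable_integrable Bochner_Integration.integrable_add)
    qed
    also have "\<dots> = measure ?\<mu> {c} *\<^sub>R c + measure ?\<mu> {d} *\<^sub>R d"
      using ic iv by simp
    also have "\<dots> = c * of_real ((norm (G x))\<^sup>2) + d * of_real ((norm (x - G x))\<^sup>2)"
      using ne by (simp add: ms Papp scaleR_conv_of_real mult.commute)
    also have "\<dots> = cinner (?N x) x"
    proof -
      have cs: "cinner (G a) b = cinner a (G b)" for a b by (simp add: cinner_eq Gadj Gsc[symmetric])
      have 0: "cinner a 0 = 0" for a :: 'h by (simp add: cinner_eq complex_eq_iff)
      have o: "cinner (x - G x) (G x) = 0" using cs[of "x - G x" x, symmetric] cinner_add_left[of 0 0 x]
        by (simp add: blinfun.diff_right GG)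
      have o': "cinner (G x) (x - G x) = 0" using cs[of x "x - G x"] 0 by (simp add: blinfun.diff_right GG)
      have "cinner (G x) x = cinner (G x) (G x)" using cinner_add_right[of "G x" "x - G x" "G x"] o' by simp
      moreover have "cinner (x - G x) x = cinner (x - G x) (x - G x)" using cinner_add_right[of "x - G x" "x - G x" "G x"] o by simp
      ultimately show ?thesis
        by (simp add: blinfun.bilinear_simps cinner_add_left cinner_scaleC_left cinner_self del: scaleC_linear)
    qed
    finally show ?thesis by simp
  qed
  show ?thesis unfolding spectral_measure_def P_def[symmetric] using Nc normal pvm bnd form by blast
qed

section \<open>Numerical ranges and diffuse abelian subalgebras\<close>

context tracial_algebra
begin

text \<open>
  The Lyapunov projection \<open>Q\<close> works unless \<open>T\<close> has the mean \<open>c\<close> on \<open>1 - Q\<close> as well, or \<open>1 - Q = 0\<close>. In these cases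
  \<open>T\<close> has the mean \<open>c\<close> on \<open>1\<close>, and \<open>Q = 1\<close> is chosen together with an arbitrary \<open>d \<noteq> c\<close>. Distinct
  values make \<open>Q\<close> the spectral projection of \<open>c Q + d (1 - Q)\<close> at \<open>c\<close>.
\<close>

lemma compressing_projection_exists:
  assumes nab: "\<And>P. abelian_projection M P \<Longrightarrow> P = 0" and T: "T \<in> M"
    and X: "X \<in> M" "psd X" "psd (id_blinfun - X)" and mean: "\<tau> (T o\<^sub>L X) = c * \<tau> X"
  obtains Q d where "Q \<in> M" "symmetric_op Q" "Q o\<^sub>L Q = Q" "tr X \<le> tr Q" "c \<noteq> d"
    "\<tau> (T o\<^sub>L Q) = c * \<tau> Q" "\<tau> (T o\<^sub>L (id_blinfun - Q)) = d * \<tau> (id_blinfun - Q)"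
proof -
  let ?I = "id_blinfun :: 'h operator"
  have I: "?I \<in> M" "symmetric_op ?I" "?I o\<^sub>L ?I = ?I" by auto
  obtain Q where Q: "Q \<in> M" "symmetric_op Q" "Q o\<^sub>L Q = Q" "\<tau> Q = \<tau> X" "\<tau> (T o\<^sub>L Q) = \<tau> (T o\<^sub>L X)"
    using lyapunov[OF I X T nab] by metis
  define d where "d = \<tau> (T o\<^sub>L (?I - Q)) / \<tau> (?I - Q)"
  have trQ: "tr Q = tr X" using Q(4) by (simp add: tr_def)
  have IQ: "?I - Q \<in> M" "psd (?I - Q)" using Q projection_psd(2) by auto
  have mQ: "\<tau> (T o\<^sub>L Q) = c * \<tau> Q" using Q mean by simp
  show ?thesis
  proof (cases "\<tau> (?I - Q) \<noteq> 0 \<and> d \<noteq> c")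
    case True
    then have "\<tau> (T o\<^sub>L (?I - Q)) = d * \<tau> (?I - Q)" by (simp add: d_def)
    with True show ?thesis by (intro that[OF Q(1-3) _ _ mQ]) (auto simp: trQ)
  next
    case False
    have *: "\<tau> (T o\<^sub>L (?I - Q)) = c * \<tau> (?I - Q)"
    proof (cases "\<tau> (?I - Q) = 0")
      case True
      then have "?I - Q = 0" using tau_faithful IQ by blast
      then show ?thesis by simp
    qed (use False in \<open>simp add: d_def field_simps\<close>)
    have "T = (T o\<^sub>L Q) + (T o\<^sub>L (?I - Q))" by (rule blinfun_eqI) (simp add: blinfun.bilinear_simps)
    then have "\<tau> T = \<tau> (T o\<^sub>L Q) + \<tau> (T o\<^sub>L (?I - Q))" using tau_add[of "T o\<^sub>L Q" "T o\<^sub>L (?I - Q)"] T Q IQ by (auto simp: mem_intros)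
    also have "\<dots> = c * (\<tau> Q + \<tau> (?I - Q))" by (simp add: mQ * distrib_left)
    also have "\<tau> Q + \<tau> (?I - Q) = 1" using Q by (simp add: tau_diff tau_id mem_intros)
    finally have "\<tau> (T o\<^sub>L ?I) = c * \<tau> ?I" by (simp add: tau_id)
    moreover have "tr X \<le> tr ?I" by (rule tr_mono[OF X(1) I(1) X(3)])
    ultimately show ?thesis by (intro that[of ?I "c + 1"] I) simp_all
  qed
qed

text \<open>
  The tree is built for \<open>S = T - (c Q + d (1 - Q))\<close>, which has mean zero on both blocks, and the subtracted operator
  lies in the generated algebra.
\<close>

lemma diffuse_algebra_with_spectral_projection:
  assumes nab: "\<And>P. abelian_projection M P \<Longrightarrow> P = 0" and T: "T \<in> M"
    and X: "X \<in> M" "psd X" "psd (id_blinfun - X)" and mean: "\<tau> (T o\<^sub>L X) = c * \<tau> X"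
  shows "\<exists>A E Q. diffuse_abelian_subalgebra M A \<and> normal_trace_preserving_expectation M \<tau> A E \<and>
       is_spectral_projection (E T) {c} Q \<and> \<tau> X \<le> \<tau> Q"
proof -
  let ?I = "id_blinfun :: 'h operator"
  obtain Q d where Q: "Q \<in> M" "symmetric_op Q" "Q o\<^sub>L Q = Q" "tr X \<le> tr Q" "c \<noteq> d"
    "\<tau> (T o\<^sub>L Q) = c * \<tau> Q" "\<tau> (T o\<^sub>L (?I - Q)) = d * \<tau> (?I - Q)"
    using compressing_projection_exists[OF nab T X mean] by metis
  define h where "h = scale_op c Q + scale_op d (?I - Q)"
  define S where "S = T - h"
  have IQ: "?I - Q \<in> M" using Q by auto
  have hM: "h \<in> M" and SM: "S \<in> M" using Q IQ T by (auto simp: h_def S_def)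
  have QQ: "Q (Q x) = Q x" for x by (rule projection_psd(3)[OF Q(2,3)])
  have SQ: "S o\<^sub>L Q = (T o\<^sub>L Q) - scale_op c Q" "S o\<^sub>L (?I - Q) = (T o\<^sub>L (?I - Q)) - scale_op d (?I - Q)"
    by (rule blinfun_eqI, simp add: S_def h_def blinfun.bilinear_simps QQ)+
  have 1: "\<tau> (S o\<^sub>L Q) = 0" using Q T SM by (simp add: SQ tau_diff tau_scale mem_intros)
  have 2: "\<tau> (S o\<^sub>L (?I - Q)) = 0" using Q IQ T SM by (simp add: SQ tau_diff[of "T o\<^sub>L (?I - Q)"] tau_scale mem_intros)
  have "S = (S o\<^sub>L Q) + (S o\<^sub>L (?I - Q))" by (rule blinfun_eqI) (simp add: blinfun.bilinear_simps)
  then have "\<tau> S = \<tau> (S o\<^sub>L Q) + \<tau> (S o\<^sub>L (?I - Q))"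
    using tau_add[of "S o\<^sub>L Q" "S o\<^sub>L (?I - Q)"] SM Q IQ by (auto simp: mem_intros)
  then have S0: "\<tau> S = 0" using 1 2 by simp
  obtain P where P: "projection_tree M \<tau> P" "P [True] = Q" "\<And>w. \<tau> (S o\<^sub>L P w) = 0"
    "\<And>w. tr (P w) \<le> 2 * (1/2) ^ length w"
    using projection_tree_exists[OF nab SM S0 Q(1-3) 1] by metis
  interpret T: projection_tree M \<tau> P by fact
  have "Q \<in> T.A" using T.P_A[of "[True]"] P(2) by simp
  then have hA: "h \<in> T.A" by (auto simp: h_def)
  have "T.A.E T = T.A.E S + T.A.E h" using T.A.E_add[OF SM hM] by (simp add: S_def)
  then have ET: "T.A.E T = h" using T.expectation_zero[OF SM P(3)] T.A.E_id[OF hA] by simp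
  have "is_spectral_projection (T.A.E T) {c} Q"
    unfolding is_spectral_projection_def ET h_def
    using two_point_spectral_measure[of Q c d] Q projection_iff[OF Q(1)]
    by (intro conjI exI[of _ "\<lambda>B. (if c \<in> B then Q else 0) + (if d \<in> B then ?I - Q else 0)"]) auto
  moreover have "\<tau> X \<le> \<tau> Q"
    using tau_real[OF Q(1,2)] tau_real[OF X(1) psd_symmetric[OF X(2)]] Q(4) by (simp add: less_eq_complex_def)
  moreover have "diffuse_abelian_subalgebra M T.A"
    unfolding diffuse_abelian_subalgebra_def
    using T.A_sub T.A.A.vn T.A_comm T.A_no_minimal[OF P(4)] by auto
  ultimately show ?thesis using T.A.E_expectation by blast
qed

text \<open>
  The projection lies in \<open>A\<close>, so \<open>\<tau>(T Q) = \<tau>(E(T Q)) = \<tau>(E(T) Q)\<close>, and \<open>E(T) Q = c Q\<close>.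
\<close>

lemma spectral_projection_mean:
  assumes A: "diffuse_abelian_subalgebra M A" and E: "normal_trace_preserving_expectation M \<tau> A E"
    and Q: "is_spectral_projection (E T) {c} Q" and T: "T \<in> M"
  shows "Q \<in> M" "psd Q" "psd (id_blinfun - Q)" "\<tau> (T o\<^sub>L Q) = c * \<tau> Q"
proof -
  have vnA: "vn_algebra A" and AM: "A \<subseteq> M" using A by (auto simp: diffuse_abelian_subalgebra_def vn_algebra_def)
  interpret A: vn_algebra A by fact
  obtain P where P: "spectral_measure (E T) P" "Q = P {c}" using Q by (auto simp: is_spectral_projection_def)
  interpret P: spectral_measure_space "E T" P
    by unfold_locales (use P in \<open>auto simp: spectral_measure_def\<close>)
  have ET: "E T \<in> A" using E T by (simp add: normal_trace_preserving_expectation_def)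
  have QA: "Q \<in> A" unfolding P(2) by (rule spectral_projection_mem[OF vnA ET P(1)])
  then show QM: "Q \<in> M" using AM by auto
  have S: "{c} \<in> sets borel" by simp
  have Qp: "symmetric_op Q" "Q o\<^sub>L Q = Q" unfolding P(2) by (rule P.P_sym[OF S], rule P.P_idem[OF S])
  show "psd Q" "psd (id_blinfun - Q)" using projection_psd(1,2)[OF Qp] by auto
  have "E (id_blinfun o\<^sub>L T o\<^sub>L Q) = id_blinfun o\<^sub>L E T o\<^sub>L Q"
    using E QA T A.mem_intros(2) unfolding normal_trace_preserving_expectation_def by blast
  then have "E (T o\<^sub>L Q) = E T o\<^sub>L Q" by simp
  also have "\<dots> = scale_op c Q" by (rule blinfun_eqI) (simp add: P(2) P.eigen)
  finally have "\<tau> (T o\<^sub>L Q) = \<tau> (scale_op c Q)"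
    using E mem_intros(7)[OF T QM] unfolding normal_trace_preserving_expectation_def by metis
  then show "\<tau> (T o\<^sub>L Q) = c * \<tau> Q" by (simp add: tau_scale QM)
qed

end

theorem proposition6p2:
  fixes M :: "'h::complex_hilbert operator set"
    and \<tau> :: "'h operator \<Rightarrow> complex"
    and T :: "'h operator"
    and \<mu> :: complex
    and \<alpha> :: real
  assumes "II1_factor M \<tau>"
    and "T \<in> M"
    and "0 < \<alpha>" and "\<alpha> \<le> 1"
  shows "\<mu> \<in> alpha_numerical_range M \<tau> \<alpha> T \<longleftrightarrow>
    (\<exists>A E Q. diffuse_abelian_subalgebra M A \<and>
       normal_trace_preserving_expectation M \<tau> A E \<and>
       is_spectral_projection (E T) {\<mu>} Q \<and>
       complex_of_real \<alpha> \<le> \<tau> Q)"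
proof
  interpret tracial_algebra M \<tau>
    using assms(1) by unfold_locales (auto simp: II1_factor_def factor_def)
  have nab: "\<And>P. abelian_projection M P \<Longrightarrow> P = 0"
    using assms(1) by (auto simp: II1_factor_def type_II1_def)
  have op_le_psd: "op_le X Y \<longleftrightarrow> psd (Y - X)" if "X \<in> M" "Y \<in> M" for X Y
    using that by (auto simp: op_le_def positive_iff mem_intros)
  {
    assume "\<mu> \<in> alpha_numerical_range M \<tau> \<alpha> T"
    then obtain X where X: "X \<in> M" "psd X" "psd (id_blinfun - X)" "\<tau> X = of_real \<alpha>"
      and m: "\<mu> = \<tau> (T o\<^sub>L X) / of_real \<alpha>"
      by (auto simp: alpha_numerical_range_def op_le_psd mem_intros)
    have "\<tau> (T o\<^sub>L X) = \<mu> * \<tau> X" using m X(4) assms(3) by simp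
    from diffuse_algebra_with_spectral_projection[OF nab assms(2) X(1-3) this]
    show "\<exists>A E Q. diffuse_abelian_subalgebra M A \<and> normal_trace_preserving_expectation M \<tau> A E \<and>
       is_spectral_projection (E T) {\<mu>} Q \<and> complex_of_real \<alpha> \<le> \<tau> Q" by (simp add: X(4))
  next
    assume "\<exists>A E Q. diffuse_abelian_subalgebra M A \<and> normal_trace_preserving_expectation M \<tau> A E \<and>
       is_spectral_projection (E T) {\<mu>} Q \<and> complex_of_real \<alpha> \<le> \<tau> Q"
    then obtain A E Q where *: "diffuse_abelian_subalgebra M A" "normal_trace_preserving_expectation M \<tau> A E"
       "is_spectral_projection (E T) {\<mu>} Q" and le: "complex_of_real \<alpha> \<le> \<tau> Q" by blast
    note Q = spectral_projection_mean[OF * assms(2)]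
    have tQ: "\<tau> Q = of_real (tr Q)" by (rule tau_real[OF Q(1) psd_symmetric[OF Q(2)]])
    then have a: "\<alpha> \<le> tr Q" using le by (simp add: less_eq_complex_def)
    \<comment> \<open>The spectral projection may be larger than needed; shrinking it by \<open>r\<close> keeps the mean of \<open>T\<close>.\<close>
    define r where "r = \<alpha> / tr Q"
    have r: "0 \<le> r" "r \<le> 1" "r * tr Q = \<alpha>" using a assms(3) by (auto simp: r_def)
    define X where "X = r *\<^sub>R Q"
    have XM: "X \<in> M" using Q by (auto simp: X_def)
    have e: "id_blinfun - X = (id_blinfun - Q) + (1 - r) *\<^sub>R Q" by (simp add: X_def algebra_simps)
    have psds: "psd X" "psd (id_blinfun - X)"
      unfolding e unfolding X_def using r by (intro psd_simps Q; simp)+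
    have tX: "\<tau> X = of_real \<alpha>" using Q(1) r(3) by (simp add: X_def tau_scaleR tQ flip: of_real_mult)
    have "T o\<^sub>L X = r *\<^sub>R (T o\<^sub>L Q)" by (rule blinfun_eqI) (simp add: X_def blinfun.bilinear_simps)
    then have "\<tau> (T o\<^sub>L X) = of_real r * (\<mu> * of_real (tr Q))"
      using Q assms(2) by (simp add: tau_scaleR mem_intros tQ)
    also have "\<dots> = \<mu> * of_real \<alpha>" unfolding r(3)[symmetric] by simp
    finally have "\<mu> = \<tau> (T o\<^sub>L X) / of_real \<alpha>" using assms(3) by simp
    then show "\<mu> \<in> alpha_numerical_range M \<tau> \<alpha> T"
      using XM psds tX by (auto simp: alpha_numerical_range_def op_le_psd mem_intros)
  }
qed

end
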